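(* Let $n\geq 1$ and let $X=(X_1,\ldots,X_n)$ be an isotropic unconditional log-concave random vector in $\mathbb{R}^n$. Then for every $a\in\mathbb{R}^n\setminus\{0\}$ and every $p\geq 2$, $$\Big\|\sum_{i=1}^n a_iX_i\Big\|_p\geq \gamma_p\|a\|_2-\frac{p}{\|a\|_2}\Big(3\sum_{i=1}^na_i^4\Big)^{1/2}\geq \gamma_p\|a\|_2-\sqrt{3}\,p\,\|a\|_{\infty}.$$
   Context: For a random variable $Y$ and $p>0$, $\|Y\|_p=(\mathbb{E}|Y|^p)^{1/p}$. $\gamma_p=\|G\|_p$ where $G$ is a standard Gaussian $\mathcal{N}(0,1)$ random variable. For $a\in\mathbb{R}^n$, $\|a\|_2=(\sum_i a_i^2)^{1/2}$ and $\|a\|_\infty=\max_i|a_i|$. A random vector $X$ in $\mathbb{R}^n$ is log-concave if it has a density of the form $e^{-h}$ with $h\colon\mathbb{R}^n\to(-\infty,\infty]$ convex. $X$ is unconditional if $(\eta_1X_1,\ldots,\eta_nX_n)$ has the same distribution as $X$ for every choice of signs $\eta_i\in\{-1,1\}$. $X$ is isotropic if its covariance matrix is the identity. *)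

theory Defs
  imports "HOL-Probability.Probability"
begin

definition Lp_norm :: "'a measure \<Rightarrow> real \<Rightarrow> ('a \<Rightarrow> real) \<Rightarrow> real" where
  "Lp_norm M p Y = (LINT \<omega>|M. \<bar>Y \<omega>\<bar> powr p) powr (1 / p)"

definition gaussian_norm :: "real \<Rightarrow> real" where
  "gaussian_norm p = Lp_norm (density lborel std_normal_density) p (\<lambda>x. x)"

text \<open>
  The library's convexity predicate for functions is restricted to real values. Here the
  convexity inequality is evaluated in the extended reals, where \<open>0 * \<infinity> = 0\<close>.
\<close>

definition convex_extended :: "('v::real_vector \<Rightarrow> ereal) \<Rightarrow> bool" where
  "convex_extended h \<longleftrightarrow>
    (\<forall>x. h x \<noteq> -\<infinity>) \<and>
    (\<forall>x y. \<forall>u\<ge>0. \<forall>v\<ge>0. u + v = 1 \<longrightarrow>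
      h (u *\<^sub>R x + v *\<^sub>R y) \<le> ereal u * h x + ereal v * h y)"

text \<open>The function \<open>exp (- y)\<close> for \<open>y\<close> in \<open>(-\<infinity>, \<infinity>]\<close>; the value at \<open>-\<infinity>\<close> is irrelevant.\<close>

definition exp_minus :: "ereal \<Rightarrow> ennreal" where
  "exp_minus y = (if y = \<infinity> then 0 else ennreal (exp (- real_of_ereal y)))"

definition log_concave :: "'a measure \<Rightarrow> ('a \<Rightarrow> real ^ 'n) \<Rightarrow> bool" where
  "log_concave M X \<longleftrightarrow>
    (\<exists>h. convex_extended h \<and> distributed M lborel X (\<lambda>x. exp_minus (h x)))"

definition unconditional :: "'a measure \<Rightarrow> ('a \<Rightarrow> real ^ 'n) \<Rightarrow> bool" where
  "unconditional M X \<longleftrightarrow>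
    (\<forall>\<eta>::'n \<Rightarrow> real. (\<forall>i. \<eta> i \<in> {-1, 1}) \<longrightarrow>
      distr M borel (\<lambda>\<omega>. \<chi> i. \<eta> i * X \<omega> $ i) = distr M borel X)"

definition covariance_matrix :: "'a measure \<Rightarrow> ('a \<Rightarrow> real ^ 'n) \<Rightarrow> real ^ 'n ^ 'n" where
  "covariance_matrix M X =
    (\<chi> i j. LINT \<omega>|M. (X \<omega> $ i - (LINT \<omega>'|M. X \<omega>' $ i)) * (X \<omega> $ j - (LINT \<omega>'|M. X \<omega>' $ j)))"

text \<open>
  Square integrability is required explicitly, since the Bochner integral of a
  non-integrable function is \<open>0\<close>. No condition is imposed on the mean.
\<close>

definition isotropic :: "'a measure \<Rightarrow> ('a \<Rightarrow> real ^ 'n) \<Rightarrow> bool" where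
  "isotropic M X \<longleftrightarrow>
    (\<forall>i. integrable M (\<lambda>\<omega>. (X \<omega> $ i)\<^sup>2)) \<and> covariance_matrix M X = mat 1"

end

theory Submission
  imports Defs
begin

text \<open>
By homogeneity let \<open>norm a = 1\<close>, and write \<open>Y = \<Sum>i. a\<^sub>i * X\<^sub>i\<close>, \<open>\<beta>\<^sup>2 = \<Sum>i. a\<^sub>i ^ 4\<close> and
\<open>\<gamma>\<close> for the \<open>p\<close>-th Gaussian norm. Since \<open>X\<close> is unconditional, \<open>Y\<close> has the law of
\<open>\<Sum>i. \<eta>\<^sub>i * a\<^sub>i * X\<^sub>i\<close> with independent uniform signs \<open>\<eta>\<^sub>i\<close> that are independent of \<open>X\<close>. The proof first
compares sign sums with a Gaussian variable for fixed coefficients \<open>b\<^sub>i = a\<^sub>i * X\<^sub>i\<close>, and then averages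
over \<open>X\<close>. Log-concavity enters through the moments of the coordinates: they are all finite, and the
fourth ones are at most \<open>6\<close>.

\<^bold>\<open>Orders at least four.\<close> Let \<open>S\<close> be a sign sum with coefficients \<open>b\<close> of norm one and \<open>S'\<close> an independent one
with many small coefficients. Along the rotation \<open>cos \<theta> * S + sin \<theta> * S'\<close> the \<open>p\<close>-th moment \<open>\<phi>\<close> has a
derivative that Stein's identity for signs expresses through the error of the trapezoid rule, hence
through a fourth derivative. This gives
\<open>\<phi>' \<le> p (p - 1) (p - 2) (p - 3) / 3 * (\<Sum>i. b\<^sub>i ^ 4) * cos \<theta> ^ 3 * sin \<theta> * \<phi> powr ((p - 4) / p)\<close>,
which says that the fourth power \<open>\<phi> powr (4 / p)\<close> of the norm grows by at most
\<open>(p - 1) (p - 2) (p - 3) / 3 * (\<Sum>i. b\<^sub>i ^ 4)\<close> from \<open>S\<close> to \<open>S'\<close> (\<open>rademacher_moment_comparison\<close>). By the central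
limit theorem \<open>S'\<close> may be replaced by a Gaussian variable. The resulting bound is polynomial in \<open>b\<close>, so it can be
averaged over \<open>X\<close>, and it yields \<open>\<gamma> ^ 4 - 2 (p - 1) (p - 2) (p - 3) \<beta>\<^sup>2\<close> as a lower bound for the fourth
power of the norm of \<open>Y\<close> (\<open>Lp_norm_linear_form_power4\<close>). If \<open>sqrt 3 * p * \<beta> \<le> 7 / 10 * \<gamma>\<close>, this implies the claim
by elementary algebra and \<open>\<gamma>\<^sup>2 \<ge> (p / exp 1) * 2 powr (- 1 / p)\<close>. Otherwise the claimed bound is below
\<open>3 / 10 * \<gamma>\<close>, and it follows for \<open>p \<le> 24\<close> from the fact that the norm is at least one, and for
larger \<open>p\<close> from the case \<open>p / 3\<close> and the monotonicity of the norms.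

\<^bold>\<open>Orders between two and four.\<close> Here the fourth derivative of the power function is singular. Instead,
\<open>\<bar>y\<bar> powr p\<close> is a positive multiple of the integral of \<open>(cos (t * y) - 1 + t\<^sup>2 * y\<^sup>2 / 2) * t powr (- p - 1)\<close> over \<open>t > 0\<close>.
As the second moments of \<open>Y\<close> and of the Gaussian variable agree, only the cosine integrals matter; that of
\<open>Y\<close> is the mean of \<open>\<Prod>i. cos (t * b\<^sub>i)\<close> and falls short of the Gaussian one by at most the minimum of \<open>2\<close>
and \<open>3 / 4 * \<beta>\<^sup>2 * t ^ 4\<close>. This costs at most a multiple of \<open>\<beta> powr (p / 2)\<close> in the \<open>p\<close>-th moment
(\<open>moment_ge_gaussian_of_cos\<close>), which suffices, because the claim is trivial unless \<open>\<beta>\<close> is small.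

\<^bold>\<open>The fourth moment of a coordinate.\<close> The density may be replaced by a version that is even in each
coordinate, hence decreasing in the modulus of each coordinate. For such functions the superlevel sets on lines are
symmetric intervals, and the Prekopa-Leindler inequality is immediate (\<open>prekopa_leindler_even\<close>). Integrating out all
but one coordinate shows that \<open>t \<mapsto> P (\<bar>X\<^sub>i\<bar> \<ge> t)\<close> is log-concave. A log-concave tail crosses the exponential
tail with the same second moment only once, from above to below, so its fourth moment is the smaller one
(\<open>log_concave_tail_moments\<close>).
\<close>

section \<open>Averages over independent signs\<close>

text \<open>The expectation of \<open>f\<close> at the random sum of the \<open>b\<^sub>i\<close> with independent uniform signs. Sums over
sign vectors avoid a probability space and make differentiation in a parameter trivial.\<close>

definition sign_mean :: "'i set \<Rightarrow> ('i \<Rightarrow> real) \<Rightarrow> (real \<Rightarrow> real) \<Rightarrow> real" where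
  "sign_mean I b f = (\<Sum>\<eta>\<in>I \<rightarrow>\<^sub>E {-1, 1}. f (\<Sum>i\<in>I. b i * \<eta> i)) / 2 ^ card I"

lemma card_sign_vectors: "finite I \<Longrightarrow> card (I \<rightarrow>\<^sub>E {-1, 1 :: real}) = 2 ^ card I"
  by (simp add: card_PiE numeral_2_eq_2)

lemma finite_sign_vectors: "finite I \<Longrightarrow> finite (I \<rightarrow>\<^sub>E {-1, 1 :: real})"
  by (simp add: finite_PiE)

lemma sign_mean_const: "finite I \<Longrightarrow> sign_mean I b (\<lambda>_. c) = c"
  by (simp add: sign_mean_def card_sign_vectors)

lemma sign_mean_mono:
  "(\<And>s. f s \<le> g s) \<Longrightarrow> sign_mean I b f \<le> sign_mean I b g"
  by (auto simp: sign_mean_def intro!: divide_right_mono sum_mono)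

lemma sign_mean_add: "sign_mean I b (\<lambda>s. f s + g s) = sign_mean I b f + sign_mean I b g"
  by (simp add: sign_mean_def sum.distrib add_divide_distrib)

lemma sign_mean_diff: "sign_mean I b (\<lambda>s. f s - g s) = sign_mean I b f - sign_mean I b g"
  by (simp add: sign_mean_def sum_subtractf diff_divide_distrib)

lemma sign_mean_cmult: "sign_mean I b (\<lambda>s. c * f s) = c * sign_mean I b f"
  by (simp add: sign_mean_def sum_distrib_left)

lemma sign_mean_scale: "sign_mean I (\<lambda>i. c * b i) f = sign_mean I b (\<lambda>s. f (c * s))"
  by (simp add: sign_mean_def sum_distrib_left mult.assoc)

lemma sign_mean_swap:
  "sign_mean I b (\<lambda>s. sign_mean J c (f s)) = sign_mean J c (\<lambda>t. sign_mean I b (\<lambda>s. f s t))"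
  unfolding sign_mean_def sum_divide_distrib
  by (subst sum.swap) (simp add: mult.commute)

lemma DERIV_sign_mean:
  assumes "\<And>s. ((\<lambda>x. f x s) has_real_derivative f' s) (at x within A)"
  shows "((\<lambda>x. sign_mean I b (f x)) has_real_derivative sign_mean I b f') (at x within A)"
  unfolding sign_mean_def by (auto intro!: derivative_eq_intros DERIV_sum assms)

lemma sum_flip_sign:
  assumes I: "finite I" and i: "i \<in> I"
  shows "(\<Sum>\<eta>\<in>I \<rightarrow>\<^sub>E {-1, 1 :: real}. g (\<eta>(i := - \<eta> i))) = (\<Sum>\<eta>\<in>I \<rightarrow>\<^sub>E {-1, 1}. g \<eta>)"
proof (rule sum.reindex_bij_witness[where i="\<lambda>\<eta>. \<eta>(i := - \<eta> i)" and j="\<lambda>\<eta>. \<eta>(i := - \<eta> i)"])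
  fix \<eta> :: "_ \<Rightarrow> real" assume "\<eta> \<in> I \<rightarrow>\<^sub>E {-1, 1}"
  with i show "\<eta>(i := - \<eta> i) \<in> I \<rightarrow>\<^sub>E {-1, 1}"
    by (fastforce simp: PiE_iff extensional_def)
qed (use i in \<open>auto simp: PiE_iff extensional_def\<close>)

lemma signed_sum_flip:
  assumes "finite I" "i \<in> I"
  shows "(\<Sum>j\<in>I. b j * (\<eta>(i := - \<eta> i)) j) = (\<Sum>j\<in>I. b j * \<eta> j) - 2 * (b i * \<eta> i :: real)"
proof -
  have "(\<Sum>j\<in>I. b j * (\<eta>(i := - \<eta> i)) j) = - (b i * \<eta> i) + (\<Sum>j\<in>I - {i}. b j * \<eta> j)"
    using assms by (simp add: sum.remove)
  moreover have "(\<Sum>j\<in>I. b j * \<eta> j) = b i * \<eta> i + (\<Sum>j\<in>I - {i}. b j * \<eta> j)"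
    using assms by (simp add: sum.remove)
  ultimately show ?thesis by simp
qed

text \<open>Flipping the \<open>i\<close>-th sign preserves the average, so both sides may be averaged over the pair
\<open>\<eta>\<close> and its flip. With the other signs fixed, the sum takes the values \<open>x + c\<close> and \<open>x - c\<close>, where
\<open>c\<close> is the signed \<open>i\<close>-th term, and the claim becomes the assumed two-point inequality.\<close>

lemma stein_coordinate_le:
  fixes b :: "'a \<Rightarrow> real"
  assumes I: "finite I" and i: "i \<in> I"
    and step: "\<And>x c. c * (f (x + c) - f (x - c)) \<le> c\<^sup>2 * (g (x + c) + g (x - c)) + c ^ 4 * (k (x + c) + k (x - c))"
  shows "(\<Sum>\<eta>\<in>I \<rightarrow>\<^sub>E {-1, 1}. b i * \<eta> i * f (\<Sum>j\<in>I. b j * \<eta> j))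
    \<le> (\<Sum>\<eta>\<in>I \<rightarrow>\<^sub>E {-1, 1}. (b i)\<^sup>2 * g (\<Sum>j\<in>I. b j * \<eta> j) + (b i) ^ 4 * k (\<Sum>j\<in>I. b j * \<eta> j))"
proof -
  let ?E = "I \<rightarrow>\<^sub>E {-1, 1 :: real}"
  define S where "S \<eta> = (\<Sum>j\<in>I. b j * \<eta> j)" for \<eta> :: "'a \<Rightarrow> real"
  define F where "F \<eta> = b i * \<eta> i * f (S \<eta>)" for \<eta>
  define G where "G \<eta> = (b i)\<^sup>2 * g (S \<eta>) + (b i) ^ 4 * k (S \<eta>)" for \<eta>
  let ?fl = "\<lambda>\<eta> :: _ \<Rightarrow> real. \<eta>(i := - \<eta> i)"
  have Sfl: "S (?fl \<eta>) = S \<eta> - 2 * (b i * \<eta> i)" for \<eta>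
    unfolding S_def by (rule signed_sum_flip[OF I i])
  have "F \<eta> + F (?fl \<eta>) \<le> G \<eta> + G (?fl \<eta>)" if "\<eta> \<in> ?E" for \<eta>
  proof -
    define c where "c = b i * \<eta> i"
    define x where "x = S \<eta> - c"
    have "\<eta> i \<in> {-1, 1}" using that i by (auto simp: PiE_iff)
    then have c2: "c\<^sup>2 = (b i)\<^sup>2" and c4: "c ^ 4 = b i ^ 4"
      by (auto simp: c_def power_mult_distrib)
    have S: "S \<eta> = x + c" "S (?fl \<eta>) = x - c" by (simp_all add: x_def Sfl c_def)
    have "F \<eta> = c * f (x + c)" "F (?fl \<eta>) = - c * f (x - c)"
      unfolding S[symmetric] by (simp_all add: F_def c_def)
    moreover have "G \<eta> = c\<^sup>2 * g (x + c) + c ^ 4 * k (x + c)"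
      "G (?fl \<eta>) = c\<^sup>2 * g (x - c) + c ^ 4 * k (x - c)"
      by (simp_all only: G_def S c2 c4)
    ultimately show ?thesis using step[of c x] by (simp add: algebra_simps)
  qed
  then have "(\<Sum>\<eta>\<in>?E. F \<eta> + F (?fl \<eta>)) \<le> (\<Sum>\<eta>\<in>?E. G \<eta> + G (?fl \<eta>))" by (rule sum_mono)
  then have "(\<Sum>\<eta>\<in>?E. F \<eta>) \<le> (\<Sum>\<eta>\<in>?E. G \<eta>)"
    unfolding sum.distrib sum_flip_sign[OF I i] by simp
  then show ?thesis by (simp add: F_def G_def S_def)
qed

text \<open>A one-sided Stein identity for signs. For a Gaussian variable \<open>s\<close> one has
\<open>E (s * f s) = \<sigma>\<^sup>2 * E (f' s)\<close>; for signs the difference quotient takes the place of the derivative, and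
any two-point comparison of it with functions \<open>g\<close> and \<open>k\<close> passes to the average.\<close>

lemma sign_mean_stein_le:
  assumes I: "finite I"
    and step: "\<And>x c. c * (f (x + c) - f (x - c)) \<le> c\<^sup>2 * (g (x + c) + g (x - c)) + c ^ 4 * (k (x + c) + k (x - c))"
  shows "sign_mean I b (\<lambda>s. s * f s)
    \<le> (\<Sum>i\<in>I. (b i)\<^sup>2) * sign_mean I b g + (\<Sum>i\<in>I. (b i) ^ 4) * sign_mean I b k"
proof -
  let ?E = "I \<rightarrow>\<^sub>E {-1, 1 :: real}"
  let ?S = "\<lambda>\<eta>. \<Sum>j\<in>I. b j * \<eta> j"
  have "(\<Sum>\<eta>\<in>?E. ?S \<eta> * f (?S \<eta>)) = (\<Sum>i\<in>I. \<Sum>\<eta>\<in>?E. b i * \<eta> i * f (?S \<eta>))"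
    by (subst sum.swap) (simp add: sum_distrib_right)
  also have "\<dots> \<le> (\<Sum>i\<in>I. \<Sum>\<eta>\<in>?E. (b i)\<^sup>2 * g (?S \<eta>) + (b i) ^ 4 * k (?S \<eta>))"
    by (intro sum_mono stein_coordinate_le I step)
  also have "\<dots> = (\<Sum>i\<in>I. (b i)\<^sup>2) * (\<Sum>\<eta>\<in>?E. g (?S \<eta>)) + (\<Sum>i\<in>I. (b i) ^ 4) * (\<Sum>\<eta>\<in>?E. k (?S \<eta>))"
    by (simp add: sum.distrib sum_distrib_left[symmetric] sum_distrib_right[symmetric])
  finally show ?thesis
    unfolding sign_mean_def by (simp add: divide_right_mono flip: add_divide_distrib)
qed

text \<open>Stein's identity is exact for linear functions, so the inequality is applied to \<open>s\<close> and to \<open>- s\<close>.\<close>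

lemma sign_mean_square:
  assumes I: "finite I"
  shows "sign_mean I b (\<lambda>s. s\<^sup>2) = (\<Sum>i\<in>I. (b i)\<^sup>2)"
proof -
  have "sign_mean I b (\<lambda>s. s * s) \<le> (\<Sum>i\<in>I. (b i)\<^sup>2) * sign_mean I b (\<lambda>_. 1) + (\<Sum>i\<in>I. (b i) ^ 4) * sign_mean I b (\<lambda>_. 0)"
    by (rule sign_mean_stein_le[OF I]) (simp add: power2_eq_square algebra_simps)
  moreover have "sign_mean I b (\<lambda>s. s * (- s)) \<le> (\<Sum>i\<in>I. (b i)\<^sup>2) * sign_mean I b (\<lambda>_. -1) + (\<Sum>i\<in>I. (b i) ^ 4) * sign_mean I b (\<lambda>_. 0)"
    by (rule sign_mean_stein_le[OF I]) (simp add: power2_eq_square algebra_simps)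
  moreover have "sign_mean I b (\<lambda>s. s * (- s)) = - sign_mean I b (\<lambda>s. s * s)"
    using sign_mean_cmult[of I b "-1" "\<lambda>s. s * s"] by simp
  ultimately show ?thesis
    by (simp add: sign_mean_const[OF I] power2_eq_square)
qed

lemma sign_mean_linear:
  assumes I: "finite I"
  shows "sign_mean I b (\<lambda>s. s) = 0"
proof -
  have "sign_mean I b (\<lambda>s. s * c) \<le> (\<Sum>i\<in>I. (b i)\<^sup>2) * sign_mean I b (\<lambda>_. 0) + (\<Sum>i\<in>I. (b i) ^ 4) * sign_mean I b (\<lambda>_. 0)" for c
    by (rule sign_mean_stein_le[OF I]) simp
  from this[of 1] this[of "-1"] show ?thesis
    using sign_mean_cmult[of I b "-1" "\<lambda>s. s"] by (simp add: sign_mean_const[OF I])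
qed

section \<open>Powers of the absolute value and the trapezoid rule\<close>

text \<open>Up to constant factors, the odd derivatives of \<open>\<bar>y\<bar> powr p\<close>.\<close>

definition signed_powr :: "real \<Rightarrow> real \<Rightarrow> real" where
  "signed_powr q y = sgn y * \<bar>y\<bar> powr q"

lemma DERIV_zero_of_powr_bound:
  fixes q :: real
  assumes q: "q > 1" and bound: "\<And>h. \<bar>f h\<bar> \<le> \<bar>h\<bar> powr q"
  shows "(f has_real_derivative 0) (at 0)"
proof -
  have f0: "f 0 = 0" using bound[of 0] by simp
  have "((\<lambda>h :: real. \<bar>h\<bar> powr (q - 1)) \<longlongrightarrow> \<bar>0\<bar> powr (q - 1)) (at 0)"
    using q by (intro tendsto_intros) auto
  then have lim: "((\<lambda>h :: real. \<bar>h\<bar> powr (q - 1)) \<longlongrightarrow> 0) (at 0)" by simp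
  have "\<bar>f h / h\<bar> \<le> \<bar>h\<bar> powr (q - 1)" if "h \<noteq> 0" for h
    using bound[of h] that by (simp add: abs_divide powr_diff divide_right_mono)
  then have "eventually (\<lambda>h. norm (f h / h) \<le> \<bar>h\<bar> powr (q - 1)) (at 0)"
    by (auto simp: eventually_at intro!: exI[of _ 1])
  from Lim_null_comparison[OF this lim] show ?thesis
    by (simp add: DERIV_def f0)
qed

lemma DERIV_abs_powr:
  assumes q: "q > 1"
  shows "((\<lambda>y. \<bar>y\<bar> powr q) has_real_derivative q * signed_powr (q - 1) y) (at y)"
proof -
  consider "y > 0" | "y < 0" | "y = 0" by linarith
  then show ?thesis
  proof cases
    case 1
    have "((\<lambda>y. y powr q) has_real_derivative q * y powr (q - 1)) (at y)"
      by (rule has_real_derivative_powr[OF 1])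
    then have "((\<lambda>y. \<bar>y\<bar> powr q) has_real_derivative q * y powr (q - 1)) (at y)"
      by (rule has_field_derivative_transform_within_open[where S="{0<..}"]) (use 1 in auto)
    then show ?thesis using 1 by (simp add: signed_powr_def)
  next
    case 2
    have "((\<lambda>y. (- y) powr q) has_real_derivative q * (- y) powr (q - 1) * (-1)) (at y)"
      by (rule DERIV_chain2[OF has_real_derivative_powr]) (use 2 in \<open>auto intro!: derivative_eq_intros\<close>)
    then have "((\<lambda>y. \<bar>y\<bar> powr q) has_real_derivative q * (- y) powr (q - 1) * (-1)) (at y)"
      by (rule has_field_derivative_transform_within_open[where S="{..<0}"]) (use 2 in auto)
    then show ?thesis using 2 by (simp add: signed_powr_def)
  next
    case 3
    show ?thesis unfolding 3
      using DERIV_zero_of_powr_bound[OF q, of "\<lambda>y. \<bar>y\<bar> powr q"] by (simp add: signed_powr_def)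
  qed
qed

lemma DERIV_signed_powr:
  assumes q: "q > 1"
  shows "(signed_powr q has_real_derivative q * \<bar>y\<bar> powr (q - 1)) (at y)"
proof -
  consider "y > 0" | "y < 0" | "y = 0" by linarith
  then show ?thesis
  proof cases
    case 1
    have "((\<lambda>y. y powr q) has_real_derivative q * y powr (q - 1)) (at y)"
      by (rule has_real_derivative_powr[OF 1])
    then have "(signed_powr q has_real_derivative q * y powr (q - 1)) (at y)"
      by (rule has_field_derivative_transform_within_open[where S="{0<..}"])
         (use 1 in \<open>auto simp: signed_powr_def\<close>)
    then show ?thesis using 1 by simp
  next
    case 2
    have "((\<lambda>y. - ((- y) powr q)) has_real_derivative - (q * (- y) powr (q - 1) * (-1))) (at y)"
      by (rule DERIV_minus, rule DERIV_chain2[OF has_real_derivative_powr])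
         (use 2 in \<open>auto intro!: derivative_eq_intros\<close>)
    then have "(signed_powr q has_real_derivative - (q * (- y) powr (q - 1) * (-1))) (at y)"
      by (rule has_field_derivative_transform_within_open[where S="{..<0}"])
         (use 2 in \<open>auto simp: signed_powr_def\<close>)
    then show ?thesis using 2 by simp
  next
    case 3
    show ?thesis unfolding 3
      using DERIV_zero_of_powr_bound[OF q, of "signed_powr q"]
      by (simp add: signed_powr_def abs_mult sgn_if)
  qed
qed

lemma signed_powr_1: "signed_powr 1 y = y"
  by (simp add: signed_powr_def sgn_if)

lemma signed_powr_mono:
  assumes q: "q \<ge> 1" and xy: "x \<le> y"
  shows "signed_powr q x \<le> signed_powr q y"
proof (cases "q = 1")
  case True
  then show ?thesis using xy by (simp add: signed_powr_1)
next
  case False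
  with q have "q > 1" by simp
  from DERIV_signed_powr[OF this] show ?thesis
    by (intro DERIV_nonneg_imp_nondecreasing[OF xy]) (use q in fastforce)
qed

lemma powr_above_tangent:
  fixes z m s :: real
  assumes "z \<ge> 0" "m > 0" "s \<ge> 1"
  shows "m powr s + s * m powr (s - 1) * (z - m) \<le> z powr s"
proof (cases "z = 0")
  case True
  have "m powr (s - 1) * m = m powr s" using assms by (simp add: powr_diff)
  then have "m powr s + s * m powr (s - 1) * (z - m) = m powr s * (1 - s)"
    using True by (simp add: algebra_simps)
  also have "\<dots> \<le> 0" using assms by (simp add: mult_nonneg_nonpos)
  finally show ?thesis using True by simp
next
  case False
  have "z powr s - m powr s \<ge> s * m powr (s - 1) * (z - m)"
    by (rule convex_on_imp_above_tangent[OF powr_convex[OF assms(3)]])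
       (use assms False in \<open>auto simp: has_field_derivative_at_within has_real_derivative_powr interior_open\<close>)
  then show ?thesis by simp
qed

lemma convex_on_abs_powr:
  assumes r: "r \<ge> (1 :: real)"
  shows "convex_on UNIV (\<lambda>y :: real. \<bar>y\<bar> powr r)"
proof (rule convex_onI)
  fix t x y :: real
  assume t: "0 < t" "t < 1"
  define m where "m = (1 - t) * \<bar>x\<bar> + t * \<bar>y\<bar>"
  have m0: "m \<ge> 0" using t by (simp add: m_def)
  have "\<bar>(1 - t) *\<^sub>R x + t *\<^sub>R y\<bar> \<le> m"
    using abs_triangle_ineq[of "(1 - t) * x" "t * y"] t by (simp add: m_def abs_mult)
  then have "\<bar>(1 - t) *\<^sub>R x + t *\<^sub>R y\<bar> powr r \<le> m powr r"
    using r by (intro powr_mono2) auto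
  also have "m powr r \<le> (1 - t) * \<bar>x\<bar> powr r + t * \<bar>y\<bar> powr r"
  proof (cases "m = 0")
    case True
    then show ?thesis using t by simp
  next
    case False
    then have m: "m > 0" using m0 by simp
    define T where "T z = m powr r + r * m powr (r - 1) * (z - m)" for z
    have "m powr r = (1 - t) * T \<bar>x\<bar> + t * T \<bar>y\<bar>"
    proof -
      have "(1 - t) * T \<bar>x\<bar> + t * T \<bar>y\<bar> = m powr r + r * m powr (r - 1) * ((1 - t) * \<bar>x\<bar> + t * \<bar>y\<bar> - m)"
        by (simp add: T_def algebra_simps)
      then show ?thesis by (simp add: m_def)
    qed
    also have "\<dots> \<le> (1 - t) * \<bar>x\<bar> powr r + t * \<bar>y\<bar> powr r"
      unfolding T_def using t by (intro add_mono mult_left_mono powr_above_tangent m r) auto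
    finally show ?thesis .
  qed
  finally show "\<bar>(1 - t) *\<^sub>R x + t *\<^sub>R y\<bar> powr r \<le> (1 - t) * \<bar>x\<bar> powr r + t * \<bar>y\<bar> powr r" .
qed simp

text \<open>The two inner points are convex combinations of the two outer ones with exchanged weights.\<close>

lemma convex_symmetric_sum_mono:
  fixes k :: "real \<Rightarrow> real"
  assumes k: "convex_on UNIV k" and c: "0 \<le> s" "s \<le> c"
  shows "k (x + s) + k (x - s) \<le> k (x + c) + k (x - c)"
proof (cases "c = 0")
  case False
  with c have c0: "c > 0" by simp
  define u where "u = (c + s) / (2 * c)"
  define v where "v = (c - s) / (2 * c)"
  have uv: "u \<ge> 0" "v \<ge> 0" "u + v = 1" using c c0 by (auto simp: u_def v_def field_simps)
  have "x + s = u *\<^sub>R (x + c) + v *\<^sub>R (x - c)" "x - s = v *\<^sub>R (x + c) + u *\<^sub>R (x - c)"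
    using c0 by (simp_all add: u_def v_def field_simps)
  then have "k (x + s) \<le> u * k (x + c) + v * k (x - c)" "k (x - s) \<le> v * k (x + c) + u * k (x - c)"
    using k uv unfolding convex_on_def by (metis UNIV_I add.commute)+
  then have "k (x + s) + k (x - s) \<le> (u + v) * (k (x + c) + k (x - c))"
    by (simp add: algebra_simps)
  then show ?thesis using uv by simp
qed (use c in auto)

text \<open>The trapezoid rule overestimates the integral of the convex function \<open>f2\<close> over \<open>[x - c, x + c]\<close>. The extra
factor \<open>c\<close> makes the statement even in \<open>c\<close>, which is the form needed for signed coefficients.\<close>

lemma trapezoid_upper:
  assumes d1: "\<And>y. (f1 has_real_derivative f2 y) (at y)"
    and d2: "\<And>y. (f2 has_real_derivative f3 y) (at y)"
    and mono: "\<And>y z. y \<le> z \<Longrightarrow> f3 y \<le> f3 z"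
  shows "c * (f1 (x + c) - f1 (x - c)) \<le> c\<^sup>2 * (f2 (x + c) + f2 (x - c))"
proof -
  have pos: "f1 (x + c) - f1 (x - c) \<le> c * (f2 (x + c) + f2 (x - c))" if c: "c \<ge> 0" for c
  proof -
    define \<psi> where "\<psi> s = s * (f2 (x + s) + f2 (x - s)) - (f1 (x + s) - f1 (x - s))" for s
    have "(\<psi> has_real_derivative s * (f3 (x + s) - f3 (x - s))) (at s)" for s
      unfolding \<psi>_def by (auto intro!: derivative_eq_intros DERIV_chain2[OF d1] DERIV_chain2[OF d2])
    then have "\<psi> 0 \<le> \<psi> c"
      by (intro DERIV_nonneg_imp_nondecreasing[OF c]) (fastforce intro!: mult_nonneg_nonneg mono)
    then show ?thesis by (simp add: \<psi>_def)
  qed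
  show ?thesis
  proof (cases "c \<ge> 0")
    case True
    then show ?thesis using mult_left_mono[OF pos[OF True] True]
      by (simp add: power2_eq_square algebra_simps)
  next
    case False
    then show ?thesis using mult_left_mono[OF pos[of "- c"], of "- c"]
      by (simp add: power2_eq_square algebra_simps)
  qed
qed

text \<open>The error of the trapezoid rule for \<open>f2\<close> is controlled by its second derivative. To cover powers whose
fourth derivative is not convex, that derivative enters only through a convex majorant \<open>k\<close>, and only by way
of the increments of \<open>f3\<close>; convexity moves all evaluation points to the end points \<open>x \<plusminus> c\<close>.\<close>

lemma trapezoid_lower:
  assumes d1: "\<And>y. (f1 has_real_derivative f2 y) (at y)"
    and d2: "\<And>y. (f2 has_real_derivative f3 y) (at y)"
    and k: "convex_on UNIV k"
    and f3: "\<And>x c. c \<ge> 0 \<Longrightarrow> f3 (x + c) - f3 (x - c) \<le> c * (k (x + c) + k (x - c))"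
  shows "c * (f1 (x + c) - f1 (x - c))
    \<ge> c\<^sup>2 * (f2 (x + c) + f2 (x - c)) - c ^ 4 / 3 * (k (x + c) + k (x - c))"
proof -
  have pos: "f1 (x + c) - f1 (x - c) \<ge> c * (f2 (x + c) + f2 (x - c)) - c ^ 3 / 3 * (k (x + c) + k (x - c))"
    if c: "c \<ge> 0" for c
  proof -
    \<comment> \<open>By convexity, the end point value \<open>A\<close> bounds \<open>k (x + s) + k (x - s)\<close> for all \<open>s\<close> between \<open>0\<close> and \<open>c\<close>.\<close>
    define A where "A = k (x + c) + k (x - c)"
    define \<psi> where "\<psi> s = f1 (x + s) - f1 (x - s) - s * (f2 (x + s) + f2 (x - s)) + s ^ 3 / 3 * A" for s
    have d: "(\<psi> has_real_derivative s\<^sup>2 * A - s * (f3 (x + s) - f3 (x - s))) (at s)" for s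
      unfolding \<psi>_def
      by (auto intro!: derivative_eq_intros DERIV_chain2[OF d1] DERIV_chain2[OF d2])
    have nn: "s\<^sup>2 * A - s * (f3 (x + s) - f3 (x - s)) \<ge> 0" if "0 \<le> s" "s \<le> c" for s
    proof -
      have "s * (f3 (x + s) - f3 (x - s)) \<le> s * (s * (k (x + s) + k (x - s)))"
        by (intro mult_left_mono f3 that)
      also have "\<dots> \<le> s * (s * A)"
        unfolding A_def by (intro mult_left_mono convex_symmetric_sum_mono k that)
      finally show ?thesis by (simp add: power2_eq_square)
    qed
    have "\<psi> 0 \<le> \<psi> c"
      by (rule DERIV_nonneg_imp_nondecreasing[OF c]) (use d nn in blast)
    then show ?thesis by (simp add: \<psi>_def A_def)
  qed
  show ?thesis
  proof (cases "c \<ge> 0")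
    case True
    then show ?thesis using mult_left_mono[OF pos[OF True] True]
      by (simp add: power2_eq_square power3_eq_cube power4_eq_xxxx field_simps)
  next
    case False
    then show ?thesis using mult_left_mono[OF pos[of "- c"], of "- c"]
      by (simp add: power2_eq_square power3_eq_cube power4_eq_xxxx field_simps)
  qed
qed

text \<open>The case distinction in the assumption is needed because \<open>0 powr 0 = 0\<close>: for \<open>q = 1\<close> the derivative of
\<open>signed_powr q\<close> is constantly one, also at zero.\<close>

lemma signed_powr_trapezoid:
  assumes q: "q \<ge> 1" and k: "convex_on UNIV k"
    and le: "\<And>y. (if q = 1 then 1 else \<bar>y\<bar> powr (q - 1)) \<le> k y" and c: "c \<ge> 0"
  shows "signed_powr q (x + c) - signed_powr q (x - c) \<le> q * (c * (k (x + c) + k (x - c)))"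
proof (cases "q = 1")
  case True
  have "2 * c \<le> c * (k (x + c) + k (x - c))"
    using le[of "x + c"] le[of "x - c"] c True mult_left_mono[of 2 "k (x + c) + k (x - c)" c] by simp
  then show ?thesis using True by (simp add: signed_powr_1)
next
  case False
  with q have q1: "q > 1" by simp
  define A where "A = k (x + c) + k (x - c)"
  define \<psi> where "\<psi> s = q * (s * A) - (signed_powr q (x + s) - signed_powr q (x - s))" for s
  have d: "(\<psi> has_real_derivative q * (A - (\<bar>x + s\<bar> powr (q - 1) + \<bar>x - s\<bar> powr (q - 1)))) (at s)" for s
    unfolding \<psi>_def
    by (auto intro!: derivative_eq_intros DERIV_chain2[OF DERIV_signed_powr[OF q1]] simp: algebra_simps)
  have "q * (A - (\<bar>x + s\<bar> powr (q - 1) + \<bar>x - s\<bar> powr (q - 1))) \<ge> 0" if "0 \<le> s" "s \<le> c" for s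
    using le[of "x + s"] le[of "x - s"] False convex_symmetric_sum_mono[OF k that, of x] q
    by (intro mult_nonneg_nonneg) (auto simp: A_def)
  then have "\<psi> 0 \<le> \<psi> c" by (intro DERIV_nonneg_imp_nondecreasing[OF c]) (use d in blast)
  then show ?thesis by (simp add: \<psi>_def A_def)
qed

section \<open>Interpolation between two sign sums\<close>

lemma sign_mean_power_mean:
  assumes I: "finite I" and J: "finite J" and s: "s \<ge> 1" and Z: "\<And>x y. Z x y \<ge> 0"
  shows "(sign_mean I b (\<lambda>x. sign_mean J c (Z x))) powr s
    \<le> sign_mean I b (\<lambda>x. sign_mean J c (\<lambda>y. Z x y powr s))"
proof -
  define m where "m = sign_mean I b (\<lambda>x. sign_mean J c (Z x))"
  have "sign_mean I b (\<lambda>x. sign_mean J c (\<lambda>_. 0)) \<le> m"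
    unfolding m_def by (intro sign_mean_mono Z)
  then have m0: "m \<ge> 0" by (simp add: sign_mean_const I J)
  show ?thesis
  proof (cases "m = 0")
    case True
    have "sign_mean I b (\<lambda>x. sign_mean J c (\<lambda>_. 0)) \<le> sign_mean I b (\<lambda>x. sign_mean J c (\<lambda>y. Z x y powr s))"
      by (intro sign_mean_mono) simp
    then show ?thesis using True by (simp add: sign_mean_const I J flip: m_def)
  next
    case False
    with m0 have m: "m > 0" by simp
    have "m powr s = sign_mean I b (\<lambda>x. sign_mean J c (\<lambda>y. m powr s + s * m powr (s - 1) * (Z x y - m)))"
      by (simp add: sign_mean_add sign_mean_cmult sign_mean_diff sign_mean_const I J flip: m_def)
    also have "\<dots> \<le> sign_mean I b (\<lambda>x. sign_mean J c (\<lambda>y. Z x y powr s))"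
      by (intro sign_mean_mono powr_above_tangent Z m s)
    finally show ?thesis by (simp add: m_def)
  qed
qed

text \<open>The left-hand side is the derivative along the rotation at \<open>u = cos \<theta>\<close> and \<open>v = sin \<theta>\<close>. By Stein's
identity each of its two terms equals \<open>u * v\<close> times the mean of \<open>f2\<close> up to the trapezoid error. The
main terms cancel. The error of the second sum has the favourable sign, so only the error of the
first one remains.\<close>

lemma rademacher_interpolation_step:
  assumes I: "finite I" and J: "finite J"
    and b: "(\<Sum>i\<in>I. (b i)\<^sup>2) = 1" and c: "(\<Sum>j\<in>J. (c j)\<^sup>2) = 1"
    and d1: "\<And>y. (f1 has_real_derivative f2 y) (at y)"
    and d2: "\<And>y. (f2 has_real_derivative f3 y) (at y)"
    and mono: "\<And>y z. y \<le> z \<Longrightarrow> f3 y \<le> f3 z"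
    and k: "convex_on UNIV k"
    and f3: "\<And>x c. c \<ge> 0 \<Longrightarrow> f3 (x + c) - f3 (x - c) \<le> c * (k (x + c) + k (x - c))"
    and u: "u > 0" and v: "v > 0"
  shows "sign_mean I b (\<lambda>s. sign_mean J c (\<lambda>t. f1 (u * s + v * t) * (u * t - v * s)))
    \<le> u ^ 3 * v * (\<Sum>i\<in>I. (b i) ^ 4) / 3 * sign_mean I b (\<lambda>s. sign_mean J c (\<lambda>t. k (u * s + v * t)))"
proof -
  let ?B = "\<Sum>i\<in>I. (b i) ^ 4"
  define G where "G = sign_mean I b (\<lambda>s. sign_mean J c (\<lambda>t. f2 (u * s + v * t)))"
  define K where "K = sign_mean I b (\<lambda>s. sign_mean J c (\<lambda>t. k (u * s + v * t)))"
  have up: "sign_mean J c (\<lambda>t. t * f1 (x + v * t)) \<le> v * sign_mean J c (\<lambda>t. f2 (x + v * t))" for x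
  proof -
    have "sign_mean J c (\<lambda>t. t * f1 (x + v * t))
      \<le> (\<Sum>j\<in>J. (c j)\<^sup>2) * sign_mean J c (\<lambda>t. v * f2 (x + v * t)) + (\<Sum>j\<in>J. c j ^ 4) * sign_mean J c (\<lambda>t. 0)"
    proof (rule sign_mean_stein_le[OF J])
      fix y e
      have "v * e * (f1 (x + v * y + v * e) - f1 (x + v * y - v * e))
        \<le> (v * e)\<^sup>2 * (f2 (x + v * y + v * e) + f2 (x + v * y - v * e))"
        by (rule trapezoid_upper[OF d1 d2 mono])
      then have "v * (e * (f1 (x + v * (y + e)) - f1 (x + v * (y - e))))
        \<le> v * (e\<^sup>2 * (v * f2 (x + v * (y + e)) + v * f2 (x + v * (y - e))))"
        by (simp add: algebra_simps power2_eq_square)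
      then show "e * (f1 (x + v * (y + e)) - f1 (x + v * (y - e)))
        \<le> e\<^sup>2 * (v * f2 (x + v * (y + e)) + v * f2 (x + v * (y - e))) + e ^ 4 * (0 + 0)"
        using v by simp
    qed
    then show ?thesis using c by (simp add: sign_mean_cmult sign_mean_const J)
  qed
  have lo: "sign_mean I b (\<lambda>s. s * f1 (u * s + x))
    \<ge> u * sign_mean I b (\<lambda>s. f2 (u * s + x)) - u ^ 3 / 3 * ?B * sign_mean I b (\<lambda>s. k (u * s + x))" for x
  proof -
    have "sign_mean I b (\<lambda>s. s * ((-1) * f1 (u * s + x)))
      \<le> (\<Sum>i\<in>I. (b i)\<^sup>2) * sign_mean I b (\<lambda>s. - u * f2 (u * s + x))
        + ?B * sign_mean I b (\<lambda>s. u ^ 3 / 3 * k (u * s + x))"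
    proof (rule sign_mean_stein_le[OF I])
      fix y e
      have "u * e * (f1 (u * y + x + u * e) - f1 (u * y + x - u * e))
        \<ge> (u * e)\<^sup>2 * (f2 (u * y + x + u * e) + f2 (u * y + x - u * e))
          - (u * e) ^ 4 / 3 * (k (u * y + x + u * e) + k (u * y + x - u * e))"
        by (rule trapezoid_lower[OF d1 d2 k f3])
      then have "u * (e * ((-1) * f1 (u * (y + e) + x) - (-1) * f1 (u * (y - e) + x)))
        \<le> u * (e\<^sup>2 * (- u * f2 (u * (y + e) + x) + - u * f2 (u * (y - e) + x))
          + e ^ 4 * (u ^ 3 / 3 * k (u * (y + e) + x) + u ^ 3 / 3 * k (u * (y - e) + x)))"
        by (simp add: algebra_simps power2_eq_square power3_eq_cube power4_eq_xxxx)
      then show "e * ((-1) * f1 (u * (y + e) + x) - (-1) * f1 (u * (y - e) + x))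
        \<le> e\<^sup>2 * (- u * f2 (u * (y + e) + x) + - u * f2 (u * (y - e) + x))
          + e ^ 4 * (u ^ 3 / 3 * k (u * (y + e) + x) + u ^ 3 / 3 * k (u * (y - e) + x))"
        using u by simp
    qed
    moreover have "sign_mean I b (\<lambda>s. s * ((-1) * f1 (u * s + x))) = - sign_mean I b (\<lambda>s. s * f1 (u * s + x))"
      using sign_mean_cmult[of I b "-1" "\<lambda>s. s * f1 (u * s + x)"] by simp
    moreover have "sign_mean I b (\<lambda>s. - u * f2 (u * s + x)) = - u * sign_mean I b (\<lambda>s. f2 (u * s + x))"
      by (rule sign_mean_cmult)
    moreover have "sign_mean I b (\<lambda>s. u ^ 3 / 3 * k (u * s + x)) = u ^ 3 / 3 * sign_mean I b (\<lambda>s. k (u * s + x))"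
      by (rule sign_mean_cmult)
    ultimately show ?thesis using b by (simp only:) (simp add: mult_ac)
  qed
  have B: "sign_mean I b (\<lambda>s. sign_mean J c (\<lambda>t. t * f1 (u * s + v * t))) \<le> v * G"
  proof -
    have "sign_mean I b (\<lambda>s. sign_mean J c (\<lambda>t. t * f1 (u * s + v * t)))
      \<le> sign_mean I b (\<lambda>s. v * sign_mean J c (\<lambda>t. f2 (u * s + v * t)))"
      by (intro sign_mean_mono up)
    then show ?thesis by (simp add: G_def sign_mean_cmult)
  qed
  have "u * G - u ^ 3 / 3 * ?B * K
    = sign_mean J c (\<lambda>t. u * sign_mean I b (\<lambda>s. f2 (u * s + v * t)) - u ^ 3 / 3 * ?B * sign_mean I b (\<lambda>s. k (u * s + v * t)))"
    unfolding sign_mean_diff sign_mean_cmult G_def K_def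
    by (simp add: sign_mean_swap[of I b J c "\<lambda>s t. f2 (u * s + v * t)"] sign_mean_swap[of I b J c "\<lambda>s t. k (u * s + v * t)"])
  also have "\<dots> \<le> sign_mean J c (\<lambda>t. sign_mean I b (\<lambda>s. s * f1 (u * s + v * t)))"
    by (intro sign_mean_mono lo)
  also have "\<dots> = sign_mean I b (\<lambda>s. sign_mean J c (\<lambda>t. s * f1 (u * s + v * t)))"
    by (rule sign_mean_swap)
  finally have A: "u * G - u ^ 3 / 3 * ?B * K \<le> sign_mean I b (\<lambda>s. sign_mean J c (\<lambda>t. s * f1 (u * s + v * t)))" .
  have "sign_mean I b (\<lambda>s. sign_mean J c (\<lambda>t. f1 (u * s + v * t) * (u * t - v * s)))
    = sign_mean I b (\<lambda>s. sign_mean J c (\<lambda>t. u * (t * f1 (u * s + v * t)) - v * (s * f1 (u * s + v * t))))"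
    by (simp add: algebra_simps)
  also have "\<dots> = u * sign_mean I b (\<lambda>s. sign_mean J c (\<lambda>t. t * f1 (u * s + v * t)))
      - v * sign_mean I b (\<lambda>s. sign_mean J c (\<lambda>t. s * f1 (u * s + v * t)))"
    by (simp only: sign_mean_diff sign_mean_cmult)
  also have "\<dots> \<le> u * (v * G) - v * (u * G - u ^ 3 / 3 * ?B * K)"
    by (intro diff_mono mult_left_mono A B) (use u v in auto)
  finally show ?thesis by (simp add: K_def algebra_simps)
qed

lemma abs_powr_half: "(y\<^sup>2) powr (p / 2) = \<bar>y :: real\<bar> powr p"
proof -
  have "(y\<^sup>2) powr (p / 2) = (\<bar>y\<bar> powr 2) powr (p / 2)" by (cases "y = 0") (auto simp: powr_numeral)
  also have "\<dots> = \<bar>y\<bar> powr (2 * (p / 2))" by (rule powr_powr)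
  finally show ?thesis by simp
qed

text \<open>The tangent at one of the concave function \<open>z powr (r / 2)\<close>, evaluated at \<open>z = y\<^sup>2\<close>.\<close>

lemma abs_powr_le_quadratic:
  assumes r: "0 \<le> r" "r \<le> 2"
  shows "(if r = 0 then 1 else \<bar>y\<bar> powr r) \<le> 1 - r / 2 + r / 2 * (y :: real)\<^sup>2"
proof (cases "y = 0 \<or> r = 0")
  case False
  then have "(y\<^sup>2) powr (r / 2) * 1 powr (1 - r / 2) \<le> r / 2 * y\<^sup>2 + (1 - r / 2) * 1"
    by (intro Youngs_inequality_0) (use r in auto)
  then show ?thesis using False by (simp add: abs_powr_half)
qed (use r in auto)

lemma sign_mean_rotation_square:
  assumes I: "finite I" and J: "finite J"
    and b: "(\<Sum>i\<in>I. (b i)\<^sup>2) = 1" and c: "(\<Sum>j\<in>J. (c j)\<^sup>2) = 1"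
  shows "sign_mean I b (\<lambda>s. sign_mean J c (\<lambda>t. (u * s + v * t)\<^sup>2)) = u\<^sup>2 + v\<^sup>2"
proof -
  have "(\<lambda>s. sign_mean J c (\<lambda>t. (u * s + v * t)\<^sup>2)) = (\<lambda>s. sign_mean J c (\<lambda>t. (u\<^sup>2 * s\<^sup>2 + 2 * u * v * s * t) + v\<^sup>2 * t\<^sup>2))"
    by (simp add: power2_eq_square algebra_simps)
  also have "\<dots> = (\<lambda>s. u\<^sup>2 * s\<^sup>2 + v\<^sup>2)"
    by (simp add: sign_mean_add sign_mean_cmult sign_mean_const sign_mean_square sign_mean_linear J c)
  finally show ?thesis
    by (simp add: sign_mean_add sign_mean_cmult sign_mean_const sign_mean_square I b)
qed

text \<open>The rotated sum has variance one, so its norms of order at least two are at least one.\<close>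

lemma rotation_moment_ge_1:
  assumes I: "finite I" and J: "finite J"
    and b: "(\<Sum>i\<in>I. (b i)\<^sup>2) = 1" and c: "(\<Sum>j\<in>J. (c j)\<^sup>2) = 1"
    and uv: "u\<^sup>2 + v\<^sup>2 = 1" and p: "p \<ge> 2"
  shows "sign_mean I b (\<lambda>s. sign_mean J c (\<lambda>t. \<bar>u * s + v * t\<bar> powr p)) \<ge> 1"
  using sign_mean_power_mean[OF I J, of "p / 2" "\<lambda>s t. (u * s + v * t)\<^sup>2" b c] p
    sign_mean_rotation_square[OF I J b c, of u v] uv
  by (simp add: abs_powr_half)

text \<open>The fourth derivative of \<open>\<bar>y\<bar> powr p\<close> is a multiple of \<open>\<bar>y\<bar> powr r\<close> with \<open>r = p - 4\<close>. For \<open>r \<ge> 1\<close> this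
is convex, and its mean is estimated by the power mean inequality. For \<open>r < 1\<close> it is not
convex, but lies below a convex quadratic polynomial of mean one, while the right-hand side is at least one.\<close>

lemma fourth_derivative_majorant:
  assumes I: "finite I" and J: "finite J"
    and b: "(\<Sum>i\<in>I. (b i)\<^sup>2) = 1" and c: "(\<Sum>j\<in>J. (c j)\<^sup>2) = 1" and p: "p \<ge> 4"
  obtains k :: "real \<Rightarrow> real" where "convex_on UNIV k"
    "\<And>y. (if p - 3 = 1 then 1 else \<bar>y\<bar> powr (p - 3 - 1)) \<le> k y"
    "\<And>u v. u\<^sup>2 + v\<^sup>2 = 1 \<Longrightarrow> sign_mean I b (\<lambda>s. sign_mean J c (\<lambda>t. k (u * s + v * t)))
      \<le> sign_mean I b (\<lambda>s. sign_mean J c (\<lambda>t. \<bar>u * s + v * t\<bar> powr p)) powr ((p - 4) / p)"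
proof (cases "p \<ge> 5")
  case True
  show ?thesis
  proof
    show "convex_on UNIV (\<lambda>y :: real. \<bar>y\<bar> powr (p - 4))"
      by (rule convex_on_abs_powr) (use True in simp)
    fix u v :: real
    let ?m = "\<lambda>q. sign_mean I b (\<lambda>s. sign_mean J c (\<lambda>t. \<bar>u * s + v * t\<bar> powr q))"
    have nn: "?m q \<ge> 0" for q
    proof -
      have "sign_mean I b (\<lambda>s. sign_mean J c (\<lambda>t. 0)) \<le> ?m q" by (intro sign_mean_mono) simp
      then show ?thesis by (simp add: sign_mean_const I J)
    qed
    have "?m (p - 4) powr (p / (p - 4)) \<le> ?m p"
      using sign_mean_power_mean[OF I J, of "p / (p - 4)" "\<lambda>s t. \<bar>u * s + v * t\<bar> powr (p - 4)" b c] True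
      by (simp add: powr_powr)
    then have "(?m (p - 4) powr (p / (p - 4))) powr ((p - 4) / p) \<le> ?m p powr ((p - 4) / p)"
      using True by (intro powr_mono2) auto
    then show "?m (p - 4) \<le> ?m p powr ((p - 4) / p)" using True nn by (simp add: powr_powr)
  qed (use True in auto)
next
  case False
  define r where "r = p - 4"
  have r: "0 \<le> r" "r \<le> 2" using p False by (auto simp: r_def)
  show ?thesis
  proof
    show "convex_on UNIV (\<lambda>y :: real. 1 - r / 2 + r / 2 * y\<^sup>2)"
    proof (rule convex_on_add)
      have "convex_on UNIV (\<lambda>y :: real. \<bar>y\<bar> powr 2)" by (rule convex_on_abs_powr) simp
      moreover have "(\<lambda>y :: real. \<bar>y\<bar> powr 2) = power2" by (auto simp: powr_numeral)
      ultimately have "convex_on UNIV (power2 :: real \<Rightarrow> real)" by simp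
      then show "convex_on UNIV (\<lambda>y :: real. r / 2 * y\<^sup>2)" using r by (intro convex_on_cmul) auto
    qed (auto simp: convex_on_const)
    show "(if p - 3 = 1 then 1 else \<bar>y\<bar> powr (p - 3 - 1)) \<le> 1 - r / 2 + r / 2 * y\<^sup>2" for y
      using abs_powr_le_quadratic[OF r, of y] by (auto simp: r_def)
    fix u v :: real assume uv: "u\<^sup>2 + v\<^sup>2 = 1"
    have "sign_mean I b (\<lambda>s. sign_mean J c (\<lambda>t. 1 - r / 2 + r / 2 * (u * s + v * t)\<^sup>2))
      = 1 - r / 2 + r / 2 * sign_mean I b (\<lambda>s. sign_mean J c (\<lambda>t. (u * s + v * t)\<^sup>2))"
      by (simp only: sign_mean_add sign_mean_cmult sign_mean_const I J)
    also have "\<dots> = 1" by (simp add: sign_mean_rotation_square[OF I J b c] uv)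
    also have "1 \<le> sign_mean I b (\<lambda>s. sign_mean J c (\<lambda>t. \<bar>u * s + v * t\<bar> powr p)) powr ((p - 4) / p)"
      by (rule ge_one_powr_ge_zero) (use rotation_moment_ge_1[OF I J b c uv] p in auto)
    finally show "sign_mean I b (\<lambda>s. sign_mean J c (\<lambda>t. 1 - r / 2 + r / 2 * (u * s + v * t)\<^sup>2))
      \<le> sign_mean I b (\<lambda>s. sign_mean J c (\<lambda>t. \<bar>u * s + v * t\<bar> powr p)) powr ((p - 4) / p)" .
  qed
qed

text \<open>Let \<open>\<phi> \<theta>\<close> be the moment of \<open>cos \<theta> * S + sin \<theta> * S'\<close>. The interpolation step bounds \<open>\<phi>'\<close> by a
multiple of \<open>cos \<theta> ^ 3 * sin \<theta> * \<phi> powr ((p - 4) / p)\<close>. The last factor disappears in the derivative of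
\<open>\<phi> powr (4 / p)\<close>, and \<open>- 4 * cos \<theta> ^ 3 * sin \<theta>\<close> is the derivative of \<open>cos \<theta> ^ 4\<close>. Therefore
\<open>\<phi> powr (4 / p)\<close> plus a multiple of \<open>cos \<theta> ^ 4\<close> decreases from \<open>\<theta> = 0\<close> to \<open>\<theta> = pi / 2\<close>.\<close>

theorem rademacher_moment_comparison:
  assumes I: "finite I" and J: "finite J"
    and b: "(\<Sum>i\<in>I. (b i)\<^sup>2) = 1" and c: "(\<Sum>j\<in>J. (c j)\<^sup>2) = 1" and p: "p \<ge> 4"
  shows "sign_mean J c (\<lambda>t. \<bar>t\<bar> powr p) powr (4 / p)
    \<le> sign_mean I b (\<lambda>s. \<bar>s\<bar> powr p) powr (4 / p) + (p - 1) * (p - 2) * (p - 3) / 3 * (\<Sum>i\<in>I. (b i) ^ 4)"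
proof -
  let ?B = "\<Sum>i\<in>I. (b i) ^ 4"
  let ?P = "(p - 1) * (p - 2) * (p - 3)"
  obtain k :: "real \<Rightarrow> real" where k: "convex_on UNIV k"
    and kge: "\<And>y. (if p - 3 = 1 then 1 else \<bar>y\<bar> powr (p - 3 - 1)) \<le> k y"
    and kle: "\<And>u v. u\<^sup>2 + v\<^sup>2 = 1 \<Longrightarrow> sign_mean I b (\<lambda>s. sign_mean J c (\<lambda>t. k (u * s + v * t)))
      \<le> sign_mean I b (\<lambda>s. sign_mean J c (\<lambda>t. \<bar>u * s + v * t\<bar> powr p)) powr ((p - 4) / p)"
    by (rule fourth_derivative_majorant[OF I J b c p]) blast
  have B0: "?B \<ge> 0" by (intro sum_nonneg) simp
  define f1 where "f1 = (\<lambda>y. p * signed_powr (p - 1) y)"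
  define f2 where "f2 = (\<lambda>y. p * (p - 1) * \<bar>y\<bar> powr (p - 2))"
  define f3 where "f3 = (\<lambda>y. p * ((p - 1) * (p - 2)) * signed_powr (p - 3) y)"
  have p3: "p - 1 - 1 = p - 2" "p - 2 - 1 = p - 3" by simp_all
  have d0: "((\<lambda>y. \<bar>y\<bar> powr p) has_real_derivative f1 y) (at y)" for y
    unfolding f1_def by (rule DERIV_abs_powr) (use p in simp)
  have d1: "(f1 has_real_derivative f2 y) (at y)" for y
    unfolding f1_def f2_def using p3 DERIV_cmult[OF DERIV_signed_powr[of "p - 1" y], of p] p
    by (simp add: mult.assoc)
  have d2: "(f2 has_real_derivative f3 y) (at y)" for y
    unfolding f2_def f3_def using p3 DERIV_cmult[OF DERIV_abs_powr[of "p - 2" y], of "p * (p - 1)"] p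
    by (simp add: mult.assoc)
  have mono: "f3 y \<le> f3 z" if "y \<le> z" for y z
    unfolding f3_def by (intro mult_left_mono signed_powr_mono that) (use p in auto)
  define K where "K y = p * ?P * k y" for y
  have Kconv: "convex_on UNIV K"
    unfolding K_def by (intro convex_on_cmul k) (use p in auto)
  have f3K: "f3 (x + e) - f3 (x - e) \<le> e * (K (x + e) + K (x - e))" if "e \<ge> 0" for x e
  proof -
    have "f3 (x + e) - f3 (x - e) = p * ((p - 1) * (p - 2)) * (signed_powr (p - 3) (x + e) - signed_powr (p - 3) (x - e))"
      by (simp add: f3_def right_diff_distrib)
    also have "\<dots> \<le> p * ((p - 1) * (p - 2)) * ((p - 3) * (e * (k (x + e) + k (x - e))))"
      by (intro mult_left_mono signed_powr_trapezoid k kge that) (use p in auto)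
    also have "\<dots> = e * (K (x + e) + K (x - e))"
      using p by (simp add: K_def algebra_simps)
    finally show ?thesis .
  qed
  define \<phi> where "\<phi> \<theta> = sign_mean I b (\<lambda>s. sign_mean J c (\<lambda>t. \<bar>cos \<theta> * s + sin \<theta> * t\<bar> powr p))" for \<theta>
  have \<phi>1: "\<phi> \<theta> \<ge> 1" for \<theta>
    unfolding \<phi>_def by (rule rotation_moment_ge_1[OF I J b c]) (use p in auto)
  define D where "D \<theta> = sign_mean I b (\<lambda>s. sign_mean J c (\<lambda>t. f1 (cos \<theta> * s + sin \<theta> * t) * (cos \<theta> * t - sin \<theta> * s)))" for \<theta>
  have d\<phi>: "(\<phi> has_real_derivative D \<theta>) (at \<theta>)" for \<theta>
    unfolding \<phi>_def D_def
    by (intro DERIV_sign_mean DERIV_chain2[OF d0]) (auto intro!: derivative_eq_intros)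
  have D: "D \<theta> \<le> p * ?P * ?B / 3 * ((cos \<theta>) ^ 3 * sin \<theta>) * \<phi> \<theta> powr ((p - 4) / p)"
    if "0 < \<theta>" "\<theta> < pi / 2" for \<theta>
  proof -
    have cs: "cos \<theta> > 0" "sin \<theta> > 0" using that by (auto intro!: cos_gt_zero sin_gt_zero)
    have "D \<theta> \<le> (cos \<theta>) ^ 3 * sin \<theta> * ?B / 3 * sign_mean I b (\<lambda>s. sign_mean J c (\<lambda>t. K (cos \<theta> * s + sin \<theta> * t)))"
      unfolding D_def by (rule rademacher_interpolation_step[OF I J b c d1 d2 mono Kconv f3K cs])
    also have "\<dots> = p * ?P * ?B / 3 * ((cos \<theta>) ^ 3 * sin \<theta>) * sign_mean I b (\<lambda>s. sign_mean J c (\<lambda>t. k (cos \<theta> * s + sin \<theta> * t)))"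
      by (simp add: K_def sign_mean_cmult)
    also have "\<dots> \<le> p * ?P * ?B / 3 * ((cos \<theta>) ^ 3 * sin \<theta>) * \<phi> \<theta> powr ((p - 4) / p)"
      unfolding \<phi>_def by (intro mult_left_mono kle) (use cs p B0 in auto)
    finally show ?thesis .
  qed
  define \<psi> where "\<psi> \<theta> = \<phi> \<theta> powr (4 / p) + ?P / 3 * ?B * (cos \<theta>) ^ 4" for \<theta>
  have d\<psi>: "(\<psi> has_real_derivative
      (4 / p) * \<phi> \<theta> powr (4 / p - 1) * D \<theta> - 4 * (?P / 3 * ?B * ((cos \<theta>) ^ 3 * sin \<theta>))) (at \<theta>)" for \<theta>
  proof -
    have "((\<lambda>\<theta>. \<phi> \<theta> powr (4 / p)) has_real_derivative (4 / p) * \<phi> \<theta> powr (4 / p - 1) * D \<theta>) (at \<theta>)"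
      by (rule DERIV_chain2[OF has_real_derivative_powr d\<phi>]) (use \<phi>1[of \<theta>] in simp)
    moreover have "((\<lambda>\<theta>. ?P / 3 * ?B * (cos \<theta>) ^ 4) has_real_derivative - 4 * (?P / 3 * ?B * ((cos \<theta>) ^ 3 * sin \<theta>))) (at \<theta>)"
      by (auto intro!: derivative_eq_intros)
    ultimately show ?thesis unfolding \<psi>_def using DERIV_add by fastforce
  qed
  have "\<psi> 0 \<ge> \<psi> (pi / 2)"
  proof (rule DERIV_nonpos_imp_decreasing_open[where f=\<psi>])
    fix \<theta> :: real assume \<theta>: "0 < \<theta>" "\<theta> < pi / 2"
    have "(4 / p) * \<phi> \<theta> powr (4 / p - 1) * D \<theta>
      \<le> (4 / p) * \<phi> \<theta> powr (4 / p - 1) * (p * ?P * ?B / 3 * ((cos \<theta>) ^ 3 * sin \<theta>) * \<phi> \<theta> powr ((p - 4) / p))"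
      by (intro mult_left_mono D \<theta>) (use p in auto)
    also have "\<dots> = 4 * (?P / 3 * ?B * ((cos \<theta>) ^ 3 * sin \<theta>)) * (\<phi> \<theta> powr (4 / p - 1) * \<phi> \<theta> powr ((p - 4) / p))"
      using p by simp
    also have "\<phi> \<theta> powr (4 / p - 1) * \<phi> \<theta> powr ((p - 4) / p) = 1"
    proof -
      have "4 / p - 1 + (p - 4) / p = 0" using p by (simp add: field_simps)
      then show ?thesis using \<phi>1[of \<theta>] by (simp flip: powr_add)
    qed
    finally show "\<exists>y. (\<psi> has_real_derivative y) (at \<theta>) \<and> y \<le> 0"
      using d\<psi>[of \<theta>] by (intro exI conjI) auto
  qed (auto intro!: continuous_at_imp_continuous_on DERIV_isCont d\<psi>)
  then show ?thesis
    by (simp add: \<psi>_def \<phi>_def sign_mean_const I J)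
qed

section \<open>Sign sums converge to the Gaussian law\<close>

text \<open>Expand \<open>\<Prod>i. (cis (b\<^sub>i) + cis (- b\<^sub>i))\<close>.\<close>

lemma sum_signs_cis:
  assumes I: "finite I"
  shows "(\<Sum>\<eta>\<in>I \<rightarrow>\<^sub>E {-1, 1 :: real}. cis (\<Sum>i\<in>I. b i * \<eta> i)) = complex_of_real (2 ^ card I * (\<Prod>i\<in>I. cos (b i)))"
proof -
  have cis_sum: "cis (\<Sum>i\<in>A. f i) = (\<Prod>i\<in>A. cis (f i))" if "finite A" for A and f :: "'a \<Rightarrow> real"
    using that by (induction A) (auto simp flip: cis_mult)
  have "(\<Sum>\<eta>\<in>I \<rightarrow>\<^sub>E {-1, 1 :: real}. cis (\<Sum>i\<in>I. b i * \<eta> i))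
    = (\<Sum>\<eta>\<in>I \<rightarrow>\<^sub>E {-1, 1 :: real}. \<Prod>i\<in>I. cis (b i * \<eta> i))"
    by (simp add: cis_sum I)
  also have "\<dots> = (\<Prod>i\<in>I. \<Sum>s\<in>{-1, 1 :: real}. cis (b i * s))"
    by (rule prod_sum_PiE[symmetric]) (use I in auto)
  also have "\<dots> = (\<Prod>i\<in>I. complex_of_real (2 * cos (b i)))"
    by (intro prod.cong refl) (simp add: complex_eq_iff)
  finally show ?thesis by (simp add: prod.distrib)
qed

lemma sign_mean_cos:
  assumes "finite I"
  shows "sign_mean I b (\<lambda>s. cos (t * s)) = (\<Prod>i\<in>I. cos (t * b i))"
proof -
  have "(\<Sum>\<eta>\<in>I \<rightarrow>\<^sub>E {-1, 1 :: real}. cos (t * (\<Sum>i\<in>I. b i * \<eta> i)))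
    = Re (\<Sum>\<eta>\<in>I \<rightarrow>\<^sub>E {-1, 1 :: real}. cis (\<Sum>i\<in>I. t * b i * \<eta> i))"
    by (simp add: sum_distrib_left mult.assoc)
  also have "\<dots> = 2 ^ card I * (\<Prod>i\<in>I. cos (t * b i))"
    by (simp only: sum_signs_cis[OF assms] Re_complex_of_real)
  finally show ?thesis by (simp add: sign_mean_def)
qed

lemma cos_ge_quadratic: "cos (x :: real) \<ge> 1 - x\<^sup>2 / 2"
proof -
  obtain t where "cos x = (\<Sum>m<2. cos_coeff m * x ^ m) + (cos (t + 1/2 * real 2 * pi) / fact 2) * x ^ 2"
    using Maclaurin_cos_expansion[of x 2] by blast
  then have "cos x = 1 - cos t / 2 * x\<^sup>2" by (simp add: cos_coeff_def lessThan_nat_numeral fact_numeral)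
  moreover have "cos t * x\<^sup>2 \<le> 1 * x\<^sup>2" by (intro mult_right_mono) auto
  ultimately show ?thesis by simp
qed

lemma cos_le_quartic: "cos (x :: real) \<le> 1 - x\<^sup>2 / 2 + x ^ 4 / 24"
proof -
  obtain t where "cos x = (\<Sum>m<4. cos_coeff m * x ^ m) + (cos (t + 1/2 * real 4 * pi) / fact 4) * x ^ 4"
    using Maclaurin_cos_expansion[of x 4] by blast
  moreover have "cos (t + 1/2 * real 4 * pi) \<le> 1" by simp
  ultimately have "cos x \<le> (\<Sum>m<4. cos_coeff m * x ^ m) + 1 / fact 4 * x ^ 4"
    by (smt (verit) divide_right_mono fact_ge_zero mult_right_mono zero_le_even_power even_numeral)
  then show ?thesis by (simp add: cos_coeff_def lessThan_nat_numeral fact_numeral)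
qed

lemma cos_ge_sextic: "cos (x :: real) \<ge> 1 - x\<^sup>2 / 2 + x ^ 4 / 24 - x ^ 6 / 720"
proof -
  obtain t where "cos x = (\<Sum>m<6. cos_coeff m * x ^ m) + (cos (t + 1/2 * real 6 * pi) / fact 6) * x ^ 6"
    using Maclaurin_cos_expansion[of x 6] by blast
  moreover have "(cos (t + 1/2 * real 6 * pi) / fact 6) * x ^ 6 \<ge> (- 1 / fact 6) * x ^ 6"
    by (intro mult_right_mono divide_right_mono) auto
  ultimately have "cos x \<ge> (\<Sum>m<6. cos_coeff m * x ^ m) + (- 1 / fact 6) * x ^ 6" by simp
  then show ?thesis by (simp add: cos_coeff_def lessThan_nat_numeral fact_numeral)
qed

lemma exp_minus_le_quadratic:
  assumes "y \<ge> (0 :: real)"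
  shows "exp (- y) \<le> 1 - y + y\<^sup>2 / 2"
proof -
  define g where "g y = 1 - y + y\<^sup>2 / 2 - exp (- y)" for y :: real
  have "(g has_real_derivative (-1 + x + exp (- x))) (at x)" for x
    unfolding g_def by (auto intro!: derivative_eq_intros)
  moreover have "-1 + x + exp (- x) \<ge> 0" for x :: real
    using exp_ge_add_one_self[of "- x"] by simp
  ultimately have "g 0 \<le> g y"
    by (intro DERIV_nonneg_imp_nondecreasing[OF assms]) blast
  then show ?thesis by (simp add: g_def)
qed

text \<open>Both functions agree with \<open>1 - x\<^sup>2 / 2\<close> up to an error of fourth order.\<close>

lemma abs_cos_minus_gauss_le: "\<bar>cos (x :: real) - exp (- x\<^sup>2 / 2)\<bar> \<le> x ^ 4 / 8"
proof -
  have "exp (- x\<^sup>2 / 2) \<le> 1 - x\<^sup>2 / 2 + x ^ 4 / 8"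
    using exp_minus_le_quadratic[of "x\<^sup>2 / 2"] by (simp add: power_divide flip: power_mult)
  moreover have "exp (- x\<^sup>2 / 2) \<ge> 1 - x\<^sup>2 / 2"
    using exp_ge_add_one_self[of "- x\<^sup>2 / 2"] by simp
  moreover have "x ^ 4 \<ge> 0" by simp
  ultimately show ?thesis using cos_ge_quadratic[of x] cos_le_quartic[of x] by linarith
qed

lemma cos_power_tendsto_gauss:
  "(\<lambda>n. cos (t / sqrt (Suc n)) ^ Suc n) \<longlonglongrightarrow> exp (- t\<^sup>2 / 2)"
proof (rule LIM_zero_cancel, rule Lim_null_comparison)
  show "(\<lambda>n. t ^ 4 / 8 * (1 / real (Suc n))) \<longlonglongrightarrow> 0"
    using tendsto_mult[OF tendsto_const LIMSEQ_inverse_real_of_nat, of "t ^ 4 / 8"]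
    by (simp add: inverse_eq_divide)
  show "eventually (\<lambda>n. norm (cos (t / sqrt (Suc n)) ^ Suc n - exp (- t\<^sup>2 / 2)) \<le> t ^ 4 / 8 * (1 / real (Suc n))) sequentially"
  proof (intro always_eventually allI)
    fix n :: nat
    define x where "x = t / sqrt (Suc n)"
    have x2: "x\<^sup>2 = t\<^sup>2 / Suc n" by (simp add: x_def power_divide)
    have x4: "x ^ 4 = t ^ 4 / (Suc n)\<^sup>2"
    proof -
      have "x ^ 4 = (x\<^sup>2)\<^sup>2" by simp
      then show ?thesis unfolding x2 by (simp add: power_divide flip: power_mult)
    qed
    have e: "exp (- x\<^sup>2 / 2) ^ Suc n = exp (- t\<^sup>2 / 2)"
    proof -
      have "real (Suc n) * (- x\<^sup>2 / 2) = - t\<^sup>2 / 2" unfolding x2 by (simp del: of_nat_Suc)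
      then show ?thesis by (simp only: exp_of_nat_mult[symmetric])
    qed
    have "norm (cos x ^ Suc n - exp (- x\<^sup>2 / 2) ^ Suc n) \<le> Suc n * norm (cos x - exp (- x\<^sup>2 / 2))"
      by (intro norm_power_diff) auto
    also have "\<dots> \<le> Suc n * (x ^ 4 / 8)"
      using abs_cos_minus_gauss_le[of x] by (intro mult_left_mono) auto
    also have "\<dots> = t ^ 4 / 8 * (1 / real (Suc n))"
    proof -
      have "N * (t ^ 4 / N\<^sup>2 / 8) = t ^ 4 / 8 * (1 / N)" if "N > 0" for N :: real
        using that by (simp add: field_simps power2_eq_square)
      then show ?thesis unfolding x4 by (simp del: of_nat_Suc)
    qed
    finally have "norm (cos x ^ Suc n - exp (- t\<^sup>2 / 2)) \<le> t ^ 4 / 8 * (1 / real (Suc n))"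
      unfolding e .
    then show "norm (cos (t / sqrt (Suc n)) ^ Suc n - exp (- t\<^sup>2 / 2)) \<le> t ^ 4 / 8 * (1 / real (Suc n))"
      unfolding x_def .
  qed
qed

definition sign_sum_law :: "'i set \<Rightarrow> ('i \<Rightarrow> real) \<Rightarrow> real measure" where
  "sign_sum_law I b = distr (measure_pmf (pmf_of_set (I \<rightarrow>\<^sub>E {-1, 1}))) borel (\<lambda>\<eta>. \<Sum>i\<in>I. b i * \<eta> i)"

lemma signs_nonempty: "I \<rightarrow>\<^sub>E {-1, 1 :: real} \<noteq> {}"
  by (simp add: PiE_eq_empty_iff)

lemma real_distribution_sign_sum_law: "real_distribution (sign_sum_law I b)"
  unfolding sign_sum_law_def by (intro prob_space.real_distribution_distr prob_space_measure_pmf) simp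

lemma integral_sign_sum_law:
  assumes "finite I" and [measurable]: "f \<in> borel_measurable borel"
  shows "integral\<^sup>L (sign_sum_law I b) f = sign_mean I b f"
  unfolding sign_sum_law_def
  by (subst integral_distr)
     (auto simp: integral_pmf_of_set[OF signs_nonempty finite_sign_vectors[OF assms(1)]]
       sign_mean_def card_sign_vectors[OF assms(1)])

lemma char_sign_sum_law:
  assumes I: "finite I"
  shows "char (sign_sum_law I b) t = complex_of_real (\<Prod>i\<in>I. cos (t * b i))"
proof -
  let ?E = "I \<rightarrow>\<^sub>E {-1, 1 :: real}"
  have "char (sign_sum_law I b) t = (\<integral>\<eta>. cis (t * (\<Sum>i\<in>I. b i * \<eta> i)) \<partial>measure_pmf (pmf_of_set ?E))"
    unfolding sign_sum_law_def char_def by (subst integral_distr) (auto simp: cis_conv_exp)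
  also have "\<dots> = (\<Sum>\<eta>\<in>?E. pmf (pmf_of_set ?E) \<eta> *\<^sub>R cis (t * (\<Sum>i\<in>I. b i * \<eta> i)))"
    by (rule integral_measure_pmf) (simp_all add: finite_sign_vectors[OF I] set_pmf_of_set[OF signs_nonempty])
  also have "\<dots> = (1 / 2 ^ card I) *\<^sub>R (\<Sum>\<eta>\<in>?E. cis (\<Sum>i\<in>I. t * b i * \<eta> i))"
    by (simp add: pmf_of_set[OF signs_nonempty finite_sign_vectors[OF I]] scaleR_sum_right
        card_sign_vectors[OF I] sum_distrib_left mult.assoc)
  also have "\<dots> = complex_of_real (\<Prod>i\<in>I. cos (t * b i))"
    unfolding sum_signs_cis[OF I] by (simp add: scaleR_conv_of_real)
  finally show ?thesis .
qed

text \<open>By Levy's continuity theorem: the characteristic functions are \<open>cos (t / sqrt n) ^ n\<close>.\<close>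

lemma weak_conv_sign_sums:
  "weak_conv_m (\<lambda>n. sign_sum_law {..<Suc n} (\<lambda>_. 1 / sqrt (Suc n))) std_normal_distribution"
proof (rule levy_continuity)
  show "real_distribution std_normal_distribution" by (rule real_dist_normal_dist)
  fix t
  have "(\<lambda>n. char (sign_sum_law {..<Suc n} (\<lambda>_. 1 / sqrt (Suc n))) t) = (\<lambda>n. complex_of_real (cos (t / sqrt (Suc n)) ^ Suc n))"
    by (simp add: char_sign_sum_law)
  then show "(\<lambda>n. char (sign_sum_law {..<Suc n} (\<lambda>_. 1 / sqrt (Suc n))) t) \<longlonglongrightarrow> char std_normal_distribution t"
    using tendsto_of_real[OF cos_power_tendsto_gauss[of t]]
    by (simp add: char_std_normal_distribution)
qed (rule real_distribution_sign_sum_law)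

text \<open>Weak convergence controls the bounded continuous truncations of \<open>\<bar>x\<bar> powr p\<close>. This is enough, since only
an upper bound for the limit is claimed.\<close>

lemma gaussian_moment_le_of_sign_sums:
  assumes p: "p > 0" and int: "integrable std_normal_distribution (\<lambda>x. \<bar>x\<bar> powr p)"
    and le: "\<And>n. sign_mean {..<Suc n} (\<lambda>_. 1 / sqrt (Suc n)) (\<lambda>s. \<bar>s\<bar> powr p) \<le> U"
  shows "(LINT x|std_normal_distribution. \<bar>x\<bar> powr p) \<le> U"
proof -
  have trunc: "(LINT x|std_normal_distribution. min (\<bar>x\<bar> powr p) (real k)) \<le> U" for k
  proof (rule LIMSEQ_le_const2)
    let ?f = "\<lambda>x :: real. min (\<bar>x\<bar> powr p) (real k)"
    have cont: "isCont ?f x" for x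
    proof -
      have "continuous_on UNIV ?f" using p by (intro continuous_intros continuous_on_powr') auto
      then show ?thesis by (simp add: continuous_on_eq_continuous_at)
    qed
    show "(\<lambda>n. integral\<^sup>L (sign_sum_law {..<Suc n} (\<lambda>_. 1 / sqrt (Suc n))) ?f) \<longlonglongrightarrow> (LINT x|std_normal_distribution. ?f x)"
      by (rule weak_conv_imp_integral_bdd_continuous_conv[OF real_distribution_sign_sum_law real_dist_normal_dist weak_conv_sign_sums cont, where B="real k"])
         auto
    have "integral\<^sup>L (sign_sum_law {..<Suc n} (\<lambda>_. 1 / sqrt (Suc n))) ?f \<le> U" for n
    proof -
      have "integral\<^sup>L (sign_sum_law {..<Suc n} (\<lambda>_. 1 / sqrt (Suc n))) ?f = sign_mean {..<Suc n} (\<lambda>_. 1 / sqrt (Suc n)) ?f"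
        by (rule integral_sign_sum_law) auto
      also have "\<dots> \<le> sign_mean {..<Suc n} (\<lambda>_. 1 / sqrt (Suc n)) (\<lambda>s. \<bar>s\<bar> powr p)"
        by (intro sign_mean_mono) auto
      finally show ?thesis using le[of n] by simp
    qed
    then show "\<exists>N. \<forall>n\<ge>N. integral\<^sup>L (sign_sum_law {..<Suc n} (\<lambda>_. 1 / sqrt (Suc n))) ?f \<le> U" by blast
  qed
  have "(\<lambda>k. LINT x|std_normal_distribution. min (\<bar>x\<bar> powr p) (real k)) \<longlonglongrightarrow> (LINT x|std_normal_distribution. \<bar>x\<bar> powr p)"
  proof (rule integral_dominated_convergence[where w="\<lambda>x. \<bar>x\<bar> powr p"])
    show "AE x in std_normal_distribution. (\<lambda>k. min (\<bar>x\<bar> powr p) (real k)) \<longlonglongrightarrow> \<bar>x\<bar> powr p"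
    proof (intro always_eventually allI)
      fix x :: real
      obtain N where N: "\<bar>x\<bar> powr p \<le> real N" using real_arch_simple by blast
      have "\<forall>k\<ge>N. min (\<bar>x\<bar> powr p) (real k) = \<bar>x\<bar> powr p"
        using N by (intro allI impI min_absorb1) linarith
      then show "(\<lambda>k. min (\<bar>x\<bar> powr p) (real k)) \<longlonglongrightarrow> \<bar>x\<bar> powr p"
        by (intro tendsto_eventually) (auto simp: eventually_sequentially)
    qed
  qed (use int in auto)
  then show ?thesis by (rule LIMSEQ_le_const2) (use trunc in blast)
qed

section \<open>Moments of the Gaussian law\<close>

lemma ln_one_plus_ge_quadratic:
  assumes "z \<ge> (0 :: real)"
  shows "z - z\<^sup>2 / 2 \<le> ln (1 + z)"
proof -
  define g where "g z = ln (1 + z) - z + z\<^sup>2 / 2" for z :: real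
  have "(g has_real_derivative (1 / (1 + x) - 1 + x)) (at x)" if "x \<ge> 0" for x
    unfolding g_def using that by (auto intro!: derivative_eq_intros)
  moreover have "1 / (1 + x) - 1 + x \<ge> 0" if "x \<ge> 0" for x :: real
    using that by (simp add: field_simps)
  ultimately have "g 0 \<le> g z"
    by (intro DERIV_nonneg_imp_nondecreasing[OF assms]) blast
  then show ?thesis by (simp add: g_def)
qed

text \<open>The function \<open>x powr p * exp (- x\<^sup>2 / 2)\<close> has its maximum at \<open>sqrt p\<close>, and its logarithm has second derivative at
most \<open>-1\<close>; explicitly, \<open>ln z \<le> z - 1\<close> for \<open>z = x / sqrt p\<close>.\<close>

lemma powr_gauss_upper:
  assumes p: "p > 0" and x: "x > 0"
  shows "x powr p * exp (- x\<^sup>2 / 2) \<le> (p / exp 1) powr (p / 2) * exp (- (x - sqrt p)\<^sup>2 / 2)"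
proof -
  have sp: "sqrt p > 0" "sqrt p * sqrt p = p" using p by auto
  have "ln (x / sqrt p) \<le> x / sqrt p - 1" using x p by (intro ln_le_minus_one) simp
  then have "p * (ln x - ln (sqrt p)) \<le> p * (x / sqrt p - 1)"
    using x p by (intro mult_left_mono) (auto simp: ln_div)
  also have "p * (x / sqrt p - 1) = sqrt p * x - p"
  proof -
    have "p * (x / sqrt p) = sqrt p * (sqrt p * (x / sqrt p))" by (simp only: mult.assoc[symmetric] sp)
    also have "sqrt p * (x / sqrt p) = x" using sp(1) by simp
    finally show ?thesis by (simp only: right_diff_distrib mult_1_right)
  qed
  finally have "p * ln x - x\<^sup>2 / 2 \<le> p / 2 * (ln p - 1) - (x - sqrt p)\<^sup>2 / 2"
    using p by (simp add: ln_sqrt power2_diff field_simps)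
  then have "exp (p * ln x + - x\<^sup>2 / 2) \<le> exp (p / 2 * (ln p - 1) + - (x - sqrt p)\<^sup>2 / 2)" by simp
  moreover have "(p / exp 1) powr (p / 2) = exp (p / 2 * (ln p - 1))" "x powr p = exp (p * ln x)"
    using x p by (simp_all add: powr_def ln_div)
  ultimately show ?thesis by (simp only: exp_add)
qed

text \<open>To the right of the maximum \<open>sqrt p\<close> the second derivative of the logarithm is at least \<open>-2\<close>.\<close>

lemma powr_gauss_lower:
  assumes p: "p > 0" and x: "x \<ge> sqrt p"
  shows "(p / exp 1) powr (p / 2) * exp (- (x - sqrt p)\<^sup>2) \<le> x powr p * exp (- x\<^sup>2 / 2)"
proof -
  have sp: "sqrt p > 0" "sqrt p * sqrt p = p" using p by auto
  have x0: "x > 0" using x sp by linarith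
  define z where "z = x / sqrt p - 1"
  have z0: "z \<ge> 0" using x sp by (simp add: z_def)
  have x_eq: "x = sqrt p * (1 + z)" using sp by (simp add: z_def)
  have "ln x = ln (sqrt p) + ln (1 + z)" unfolding x_eq using sp z0 by (intro ln_mult_pos) auto
  then have "ln x \<ge> ln p / 2 + (z - z\<^sup>2 / 2)"
    using ln_one_plus_ge_quadratic[OF z0] p by (simp add: ln_sqrt)
  then have "p * ln x \<ge> p * (ln p / 2 + (z - z\<^sup>2 / 2))" using p by (intro mult_left_mono) auto
  moreover have "x\<^sup>2 = p * (1 + z)\<^sup>2"
    unfolding x_eq power_mult_distrib using p by simp
  moreover have "(x - sqrt p)\<^sup>2 = p * z\<^sup>2"
  proof -
    have "x - sqrt p = sqrt p * z" by (simp add: x_eq algebra_simps)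
    then show ?thesis unfolding power_mult_distrib using p by (simp add: power_mult_distrib)
  qed
  ultimately have "p / 2 * (ln p - 1) - (x - sqrt p)\<^sup>2 \<le> p * ln x - x\<^sup>2 / 2"
    by (simp add: power2_eq_square field_simps)
  then have "exp (p / 2 * (ln p - 1) + - (x - sqrt p)\<^sup>2) \<le> exp (p * ln x + - x\<^sup>2 / 2)" by simp
  moreover have "(p / exp 1) powr (p / 2) = exp (p / 2 * (ln p - 1))" "x powr p = exp (p * ln x)"
    using x0 p by (simp_all add: powr_def ln_div)
  ultimately show ?thesis by (simp only: exp_add)
qed

lemma gaussian_abs_moment_pointwise_upper:
  assumes p: "p > 0"
  shows "std_normal_density x * \<bar>x\<bar> powr p
    \<le> (p / exp 1) powr (p / 2) * (normal_density (sqrt p) 1 x + normal_density (- sqrt p) 1 x)"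
proof -
  have *: "std_normal_density y * y powr p \<le> (p / exp 1) powr (p / 2) * normal_density (sqrt p) 1 y" if "y > 0" for y
    using divide_right_mono[OF powr_gauss_upper[OF p that], of "sqrt (2 * pi)"]
    by (simp add: normal_density_def mult_ac)
  have sym: "normal_density (sqrt p) 1 (- x) = normal_density (- sqrt p) 1 x"
    by (simp add: normal_density_def power2_commute) (simp add: power2_eq_square algebra_simps)
  consider "x > 0" | "x < 0" | "x = 0" by linarith
  then show ?thesis
  proof cases
    case 1
    then show ?thesis using *[OF 1] by (simp add: distrib_left add_increasing2)
  next
    case 2
    have "std_normal_density (- x) = std_normal_density x" by (simp add: normal_density_def)
    then show ?thesis using *[of "- x"] 2 sym by (simp add: distrib_left add_increasing)
  qed simp
qed

lemma integrable_gaussian_abs_moment: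
  assumes p: "p > 0"
  shows "integrable std_normal_distribution (\<lambda>x. \<bar>x\<bar> powr p)"
proof -
  have "integrable lborel (\<lambda>x. std_normal_density x * \<bar>x\<bar> powr p)"
    by (rule Bochner_Integration.integrable_bound[where
          f="\<lambda>x. (p / exp 1) powr (p / 2) * (normal_density (sqrt p) 1 x + normal_density (- sqrt p) 1 x)"])
       (auto intro!: integrable_mult_right Bochner_Integration.integrable_add AE_I2
          order_trans[OF gaussian_abs_moment_pointwise_upper[OF p]])
  then show ?thesis by (subst integrable_density) auto
qed

lemma gaussian_abs_moment_upper:
  assumes p: "p > 0"
  shows "(LINT x|std_normal_distribution. \<bar>x\<bar> powr p) \<le> 2 * (p / exp 1) powr (p / 2)"
proof -
  have "(LINT x|std_normal_distribution. \<bar>x\<bar> powr p) = (LINT x|lborel. std_normal_density x * \<bar>x\<bar> powr p)"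
    by (subst integral_density) auto
  also have "\<dots> \<le> (LINT x|lborel. (p / exp 1) powr (p / 2) * (normal_density (sqrt p) 1 x + normal_density (- sqrt p) 1 x))"
    using integrable_gaussian_abs_moment[OF p]
    by (intro integral_mono gaussian_abs_moment_pointwise_upper p) (auto simp: integrable_density)
  also have "\<dots> = 2 * (p / exp 1) powr (p / 2)" by simp
  finally show ?thesis .
qed

text \<open>Half of each of the two Gaussian bumps around \<open>sqrt p\<close> and \<open>- sqrt p\<close> that lie below the integrand.\<close>

lemma gaussian_abs_moment_lower:
  assumes p: "p > 0"
  shows "(p / exp 1) powr (p / 2) / sqrt 2 \<le> (LINT x|std_normal_distribution. \<bar>x\<bar> powr p)"
proof -
  let ?C = "(p / exp 1) powr (p / 2)"
  define h where "h x = indicator {0..} x * exp (- x\<^sup>2)" for x :: real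
  have h: "has_bochner_integral lborel h (sqrt pi / 2)"
    using gaussian_moment_0 by (simp add: h_def[abs_def])
  have h1: "has_bochner_integral lborel (\<lambda>x. h (- sqrt p + 1 * x)) (sqrt pi / 2)"
    using h lborel_has_bochner_integral_real_affine_iff[of 1 h "sqrt pi / 2" "- sqrt p"] by simp
  have h2: "has_bochner_integral lborel (\<lambda>x. h (- sqrt p + (-1) * x)) (sqrt pi / 2)"
    using h lborel_has_bochner_integral_real_affine_iff[of "-1" h "sqrt pi / 2" "- sqrt p"] by simp
  have hs: "has_bochner_integral lborel (\<lambda>x. ?C / sqrt (2 * pi) * (h (- sqrt p + 1 * x) + h (- sqrt p + (-1) * x)))
     (?C / sqrt (2 * pi) * (sqrt pi / 2 + sqrt pi / 2))"
    by (intro has_bochner_integral_mult_right has_bochner_integral_add h1 h2)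
  have le: "?C / sqrt (2 * pi) * (h (- sqrt p + 1 * x) + h (- sqrt p + (-1) * x)) \<le> std_normal_density x * \<bar>x\<bar> powr p" for x
  proof -
    have sp: "sqrt p > 0" using p by simp
    have *: "?C / sqrt (2 * pi) * exp (- (y - sqrt p)\<^sup>2) \<le> std_normal_density y * y powr p" if "y \<ge> sqrt p" for y
      using divide_right_mono[OF powr_gauss_lower[OF p that], of "sqrt (2 * pi)"]
      by (simp add: normal_density_def mult_ac)
    consider "x \<ge> sqrt p" | "- x \<ge> sqrt p" | "\<bar>x\<bar> < sqrt p" by linarith
    then show ?thesis
    proof cases
      case 1
      then have "0 \<le> - sqrt p + 1 * x" "- sqrt p + (-1) * x < 0" using sp by linarith+
      then have "h (- sqrt p + 1 * x) = exp (- (x - sqrt p)\<^sup>2)" "h (- sqrt p + (-1) * x) = 0"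
        by (simp_all add: h_def indicator_def)
      moreover have "x \<ge> 0" using 1 sp by linarith
      ultimately show ?thesis using *[OF 1] by simp
    next
      case 2
      then have "0 \<le> - sqrt p + (-1) * x" "- sqrt p + 1 * x < 0" using sp by linarith+
      then have "h (- sqrt p + 1 * x) = 0" "h (- sqrt p + (-1) * x) = exp (- (- x - sqrt p)\<^sup>2)"
        by (simp_all add: h_def indicator_def)
      moreover have "std_normal_density (- x) = std_normal_density x" by (simp add: normal_density_def)
      moreover have "\<bar>x\<bar> = - x" using 2 sp by linarith
      ultimately show ?thesis using *[OF 2] by simp
    next
      case 3
      then have "- sqrt p + (-1) * x < 0" "- sqrt p + 1 * x < 0" by linarith+
      then have "h (- sqrt p + 1 * x) = 0" "h (- sqrt p + (-1) * x) = 0" by (simp_all add: h_def indicator_def)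
      then show ?thesis by simp
    qed
  qed
  have "?C / sqrt (2 * pi) * (sqrt pi / 2 + sqrt pi / 2)
    = (LINT x|lborel. ?C / sqrt (2 * pi) * (h (- sqrt p + 1 * x) + h (- sqrt p + (-1) * x)))"
    by (rule has_bochner_integral_integral_eq[OF hs, symmetric])
  also have "\<dots> \<le> (LINT x|lborel. std_normal_density x * \<bar>x\<bar> powr p)"
    using integrable_gaussian_abs_moment[OF p] hs
    by (intro integral_mono le) (auto simp: integrable_density has_bochner_integral_iff)
  also have "\<dots> = (LINT x|std_normal_distribution. \<bar>x\<bar> powr p)"
    by (subst integral_density) auto
  finally show ?thesis by (simp add: real_sqrt_mult)
qed

lemma gaussian_norm_powr:
  assumes "p > 0"
  shows "gaussian_norm p powr p = (LINT x|std_normal_distribution. \<bar>x\<bar> powr p)"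
  using assms by (simp add: gaussian_norm_def Lp_norm_def powr_powr integral_nonneg)

text \<open>Stirling's formula for Gaussian moments up to a bounded factor, whose \<open>p\<close>-th root is close to one for large \<open>p\<close>.\<close>

lemma gaussian_norm_sq_bounds:
  assumes p: "p > 0"
  shows "p / exp 1 * 2 powr (- 1 / p) \<le> (gaussian_norm p)\<^sup>2" (is ?lo)
    and "(gaussian_norm p)\<^sup>2 \<le> p / exp 1 * 4 powr (1 / p)" (is ?up)
    and "gaussian_norm p > 0" (is ?pos)
proof -
  let ?m = "LINT x|std_normal_distribution. \<bar>x\<bar> powr p"
  define C where "C = (p / exp 1) powr (p / 2)"
  have C: "C > 0" using p by (simp add: C_def)
  have m: "?m > 0" using gaussian_abs_moment_lower[OF p, folded C_def] C by (smt (verit) divide_pos_pos real_sqrt_gt_zero)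
  have g: "gaussian_norm p = ?m powr (1 / p)" by (simp add: gaussian_norm_def Lp_norm_def)
  show ?pos using m by (simp add: g)
  have g2: "(gaussian_norm p)\<^sup>2 = ?m powr (2 / p)"
    unfolding g using m by (simp add: powr_powr flip: powr_numeral)
  have C2: "C powr (2 / p) = p / exp 1" using p by (simp add: C_def powr_powr)
  have "(C / sqrt 2) powr (2 / p) \<le> (gaussian_norm p)\<^sup>2"
    unfolding g2 using gaussian_abs_moment_lower[OF p, folded C_def] p C by (intro powr_mono2) auto
  moreover have "(C / sqrt 2) powr (2 / p) = p / exp 1 * 2 powr (- 1 / p)"
  proof -
    have "sqrt 2 powr (2 / p) = 2 powr (1 / p)" by (simp add: powr_half_sqrt[symmetric] powr_powr)
    then show ?thesis using C C2 by (simp add: powr_divide powr_minus_divide)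
  qed
  ultimately show ?lo by simp
  have "(gaussian_norm p)\<^sup>2 \<le> (2 * C) powr (2 / p)"
    unfolding g2 using gaussian_abs_moment_upper[OF p, folded C_def] p m by (intro powr_mono2) auto
  moreover have "(2 * C) powr (2 / p) = p / exp 1 * 4 powr (1 / p)"
  proof -
    have "4 powr (1 / p) = (2 powr 2) powr (1 / p)" by simp
    also have "\<dots> = 2 powr (2 * (1 / p))" by (rule powr_powr)
    finally have "2 powr (2 / p) = 4 powr (1 / p)" by simp
    then show ?thesis using C C2 by (simp add: powr_mult)
  qed
  ultimately show ?up by simp
qed

section \<open>Moments of order between two and four through cosines\<close>

definition cos_remainder :: "real \<Rightarrow> real" where
  "cos_remainder x = cos x - 1 + x\<^sup>2 / 2"

lemma cos_remainder_nonneg: "0 \<le> cos_remainder x"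
  using cos_ge_quadratic[of x] by (simp add: cos_remainder_def)

lemma cos_remainder_le: "cos_remainder x \<le> x ^ 4 / 24" "cos_remainder x \<le> x\<^sup>2 / 2"
  using cos_le_quartic[of x] by (auto simp: cos_remainder_def)

text \<open>The two bounds serve as lower bounds for \<open>fourier_const\<close>: the first dominates for \<open>p\<close> near four, the second for
\<open>p\<close> near two.\<close>

lemma cos_remainder_ge: "\<bar>x\<bar> \<le> 2 \<Longrightarrow> 13 / 360 * x ^ 4 \<le> cos_remainder x" "x\<^sup>2 / 2 - 2 \<le> cos_remainder x"
proof -
  assume "\<bar>x\<bar> \<le> 2"
  then have "x\<^sup>2 \<le> 2\<^sup>2" using abs_le_square_iff[of x 2] by simp
  then have "x ^ 4 * x\<^sup>2 \<le> x ^ 4 * 4" by (intro mult_left_mono) auto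
  moreover have "x ^ 4 * x\<^sup>2 = x ^ 6" by (simp flip: power_add)
  ultimately show "13 / 360 * x ^ 4 \<le> cos_remainder x"
    using cos_ge_sextic[of x] unfolding cos_remainder_def by linarith
next
  have "-1 \<le> cos x" by simp
  then show "x\<^sup>2 / 2 - 2 \<le> cos_remainder x" unfolding cos_remainder_def by linarith
qed

lemma measurable_cos_remainder[measurable]: "cos_remainder \<in> borel_measurable borel"
  unfolding cos_remainder_def[abs_def] by measurable

lemma cos_remainder_abs: "cos_remainder \<bar>x\<bar> = cos_remainder x"
  by (simp add: cos_remainder_def)

text \<open>The normalizing constant of the representation of \<open>\<bar>y\<bar> powr p\<close> as a mixture of the functions
\<open>cos_remainder (t * y)\<close>. It is finite for \<open>2 < p < 4\<close> and blows up at both ends.\<close>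

definition fourier_const :: "real \<Rightarrow> ennreal" where
  "fourier_const p = (\<integral>\<^sup>+t. ennreal (cos_remainder t * t powr (- p - 1)) * indicator {0<..} t \<partial>lborel)"

text \<open>Substitute \<open>t / \<bar>y\<bar>\<close> for \<open>t\<close>.\<close>

lemma fourier_scaling:
  "(\<integral>\<^sup>+t. ennreal (cos_remainder (t * y) * t powr (- p - 1)) * indicator {0<..} t \<partial>lborel)
    = ennreal (\<bar>y\<bar> powr p) * fourier_const p"
proof (cases "y = 0")
  case True
  then show ?thesis by (simp add: cos_remainder_def)
next
  case False
  define c where "c = 1 / \<bar>y\<bar>"
  have c: "c > 0" using False by (simp add: c_def)
  let ?g = "\<lambda>t. ennreal (cos_remainder (t * y) * t powr (- p - 1)) * indicator {0<..} t"
  have "(\<integral>\<^sup>+t. ?g t \<partial>lborel) = ennreal c * (\<integral>\<^sup>+t. ?g (c * t) \<partial>lborel)"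
    using nn_integral_real_affine[of ?g c 0] c by simp
  also have "\<dots> = ennreal c * (\<integral>\<^sup>+t. ennreal (c powr (- p - 1)) * (ennreal (cos_remainder t * t powr (- p - 1)) * indicator {0<..} t) \<partial>lborel)"
  proof (rule arg_cong2[where f="(*)", OF refl], rule nn_integral_cong)
    fix t :: real
    show "?g (c * t) = ennreal (c powr (- p - 1)) * (ennreal (cos_remainder t * t powr (- p - 1)) * indicator {0<..} t)"
    proof (cases "t > 0")
      case True
      have "\<bar>c * t * y\<bar> = t" using \<open>y \<noteq> 0\<close> True by (simp add: c_def abs_mult)
      then have "cos_remainder (c * t * y) = cos_remainder t" by (metis cos_remainder_abs)
      then show ?thesis using True c cos_remainder_nonneg[of t]
        by (simp add: powr_mult ennreal_mult[symmetric] mult_ac)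
    next
      case False
      then have "\<not> c * t > 0" using c by (simp add: zero_less_mult_iff)
      then show ?thesis using False by simp
    qed
  qed
  also have "\<dots> = ennreal c * (ennreal (c powr (- p - 1)) * fourier_const p)"
    by (simp add: nn_integral_cmult fourier_const_def)
  also have "\<dots> = ennreal (c * c powr (- p - 1)) * fourier_const p"
    using c by (simp add: ennreal_mult mult.assoc)
  also have "c * c powr (- p - 1) = \<bar>y\<bar> powr p"
  proof -
    have "c * c powr (- p - 1) = c powr (1 + (- p - 1))" using c by (subst powr_add) simp
    also have "\<dots> = c powr (- p)" by simp
    also have "\<dots> = \<bar>y\<bar> powr p" using False by (simp add: c_def powr_minus powr_divide)
    finally show ?thesis .
  qed
  finally show ?thesis .
qed

lemma fourier_moment:
  fixes Y :: "'a \<Rightarrow> real"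
  assumes M: "prob_space M" and [measurable]: "Y \<in> borel_measurable M"
    and Y2: "integrable M (\<lambda>\<omega>. (Y \<omega>)\<^sup>2)" "(LINT \<omega>|M. (Y \<omega>)\<^sup>2) = 1"
  shows "fourier_const p * (\<integral>\<^sup>+\<omega>. ennreal (\<bar>Y \<omega>\<bar> powr p) \<partial>M)
    = (\<integral>\<^sup>+t. ennreal (((LINT \<omega>|M. cos (t * Y \<omega>)) - 1 + t\<^sup>2 / 2) * t powr (- p - 1)) * indicator {0<..} t \<partial>lborel)"
proof -
  interpret prob_space M by (rule M)
  interpret pair_sigma_finite M lborel ..
  have inner: "(\<integral>\<^sup>+\<omega>. ennreal (cos_remainder (t * Y \<omega>)) \<partial>M) = ennreal ((LINT \<omega>|M. cos (t * Y \<omega>)) - 1 + t\<^sup>2 / 2)" for t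
  proof -
    have int: "integrable M (\<lambda>\<omega>. cos (t * Y \<omega>))"
      by (rule integrable_const_bound[where B=1]) auto
    have eq: "(\<lambda>\<omega>. cos_remainder (t * Y \<omega>)) = (\<lambda>\<omega>. cos (t * Y \<omega>) - 1 + t\<^sup>2 / 2 * (Y \<omega>)\<^sup>2)"
      by (simp add: cos_remainder_def power_mult_distrib)
    have "integrable M (\<lambda>\<omega>. cos_remainder (t * Y \<omega>))"
      unfolding eq using int Y2 by auto
    then have "(\<integral>\<^sup>+\<omega>. ennreal (cos_remainder (t * Y \<omega>)) \<partial>M) = ennreal (LINT \<omega>|M. cos_remainder (t * Y \<omega>))"
      by (rule nn_integral_eq_integral) (simp add: cos_remainder_nonneg)
    also have "(LINT \<omega>|M. cos_remainder (t * Y \<omega>)) = (LINT \<omega>|M. cos (t * Y \<omega>)) - 1 + t\<^sup>2 / 2"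
      unfolding eq using int Y2 by (simp add: prob_space)
    finally show ?thesis .
  qed
  have "fourier_const p * (\<integral>\<^sup>+\<omega>. ennreal (\<bar>Y \<omega>\<bar> powr p) \<partial>M)
    = (\<integral>\<^sup>+\<omega>. ennreal (\<bar>Y \<omega>\<bar> powr p) * fourier_const p \<partial>M)"
    by (subst nn_integral_multc) (simp_all add: mult.commute)
  also have "\<dots> = (\<integral>\<^sup>+\<omega>. (\<integral>\<^sup>+t. ennreal (cos_remainder (t * Y \<omega>) * t powr (- p - 1)) * indicator {0<..} t \<partial>lborel) \<partial>M)"
    by (simp only: fourier_scaling)
  also have "\<dots> = (\<integral>\<^sup>+t. (\<integral>\<^sup>+\<omega>. ennreal (cos_remainder (t * Y \<omega>) * t powr (- p - 1)) * indicator {0<..} t \<partial>M) \<partial>lborel)"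
    by (rule Fubini'[symmetric]) simp
  also have "\<dots> = (\<integral>\<^sup>+t. ennreal (((LINT \<omega>|M. cos (t * Y \<omega>)) - 1 + t\<^sup>2 / 2) * t powr (- p - 1)) * indicator {0<..} t \<partial>lborel)"
  proof (intro nn_integral_cong)
    fix t :: real
    have "(\<integral>\<^sup>+\<omega>. ennreal (cos_remainder (t * Y \<omega>) * t powr (- p - 1)) * indicator {0<..} t \<partial>M)
      = (\<integral>\<^sup>+\<omega>. ennreal (cos_remainder (t * Y \<omega>)) * (ennreal (t powr (- p - 1)) * indicator {0<..} t) \<partial>M)"
      by (intro nn_integral_cong) (simp add: ennreal_mult cos_remainder_nonneg mult.assoc)
    also have "\<dots> = (\<integral>\<^sup>+\<omega>. ennreal (cos_remainder (t * Y \<omega>)) \<partial>M) * (ennreal (t powr (- p - 1)) * indicator {0<..} t)"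
      by (rule nn_integral_multc) simp
    also have "\<dots> = ennreal (((LINT \<omega>|M. cos (t * Y \<omega>)) - 1 + t\<^sup>2 / 2) * t powr (- p - 1)) * indicator {0<..} t"
      unfolding inner by (simp add: ennreal_mult'' mult.assoc)
    finally show "(\<integral>\<^sup>+\<omega>. ennreal (cos_remainder (t * Y \<omega>) * t powr (- p - 1)) * indicator {0<..} t \<partial>M)
      = ennreal (((LINT \<omega>|M. cos (t * Y \<omega>)) - 1 + t\<^sup>2 / 2) * t powr (- p - 1)) * indicator {0<..} t" .
  qed
  finally show ?thesis .
qed

lemma gaussian_cos_integral: "(LINT x|std_normal_distribution. cos (t * x)) = exp (- t\<^sup>2 / 2)"
proof -
  interpret real_distribution std_normal_distribution by (rule real_dist_normal_dist)
  have int: "integrable std_normal_distribution (\<lambda>x. iexp (t * x))"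
    by (rule integrable_const_bound[where B=1]) auto
  have "complex_of_real (exp (- t\<^sup>2 / 2)) = (CLINT x|std_normal_distribution. iexp (t * x))"
    using char_std_normal_distribution by (simp add: char_def fun_eq_iff)
  then have "exp (- t\<^sup>2 / 2) = Re (CLINT x|std_normal_distribution. iexp (t * x))"
    by (metis Re_complex_of_real)
  also have "\<dots> = (LINT x|std_normal_distribution. cos (t * x))"
    unfolding integral_Re[OF int, symmetric] by (simp add: Re_exp)
  finally show ?thesis ..
qed

lemma gaussian_square_integral:
  "integrable std_normal_distribution (\<lambda>x. x\<^sup>2)" "(LINT x|std_normal_distribution. x\<^sup>2) = 1"
  using std_normal_distribution_even_moments[of 1] by simp_all

lemma nn_integral_powr_near_0:
  assumes "a > -1" "c \<ge> 0"
  shows "(\<integral>\<^sup>+t. ennreal (t powr a) * indicator {0..c} t \<partial>lborel) = ennreal (c powr (a + 1) / (a + 1))"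
  by (rule nn_integral_has_integral_lebesgue'[OF _ has_integral_powr_from_0[OF assms]]) simp

lemma nn_integral_powr_tail:
  assumes "a < -1" "c > 0"
  shows "(\<integral>\<^sup>+t. ennreal (t powr a) * indicator {c..} t \<partial>lborel) = ennreal (- (c powr (a + 1)) / (a + 1))"
  by (rule nn_integral_has_integral_lebesgue'[OF _ has_integral_powr_to_inf[OF assms]]) simp

lemma power_mult_powr:
  fixes t :: real
  assumes "t > 0"
  shows "t ^ 4 * t powr (- p - 1) = t powr (3 - p)" "t\<^sup>2 * t powr (- p - 1) = t powr (1 - p)"
proof -
  have "t powr 4 * t powr (- p - 1) = t powr (4 + (- p - 1))" by (rule powr_add[symmetric])
  then show "t ^ 4 * t powr (- p - 1) = t powr (3 - p)" using assms by simp
  have "t powr 2 * t powr (- p - 1) = t powr (2 + (- p - 1))" by (rule powr_add[symmetric])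
  then show "t\<^sup>2 * t powr (- p - 1) = t powr (1 - p)" using assms by simp
qed

lemma fourier_const_finite:
  assumes p: "2 < p" "p < 4"
  shows "fourier_const p < \<infinity>"
proof -
  have "fourier_const p \<le> (\<integral>\<^sup>+t. ennreal (t powr (3 - p)) * indicator {0..1} t + ennreal (t powr (1 - p)) * indicator {1..} t \<partial>lborel)"
    unfolding fourier_const_def
  proof (intro nn_integral_mono)
    fix t :: real
    show "ennreal (cos_remainder t * t powr (- p - 1)) * indicator {0<..} t
      \<le> ennreal (t powr (3 - p)) * indicator {0..1} t + ennreal (t powr (1 - p)) * indicator {1..} t"
    proof (cases "t > 0")
      case True
      note e = power_mult_powr[OF True, of p]
      have "cos_remainder t * t powr (- p - 1) \<le> t ^ 4 * t powr (- p - 1)"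
        "cos_remainder t * t powr (- p - 1) \<le> t\<^sup>2 * t powr (- p - 1)"
      proof -
        have "0 \<le> t ^ 4" "0 \<le> t\<^sup>2" by simp_all
        then have "cos_remainder t \<le> t ^ 4" "cos_remainder t \<le> t\<^sup>2"
          using cos_remainder_le[of t] by linarith+
        then show "cos_remainder t * t powr (- p - 1) \<le> t ^ 4 * t powr (- p - 1)"
          "cos_remainder t * t powr (- p - 1) \<le> t\<^sup>2 * t powr (- p - 1)"
          by (auto intro!: mult_right_mono)
      qed
      then have le: "ennreal (cos_remainder t * t powr (- p - 1)) \<le> ennreal (t powr (3 - p))"
        "ennreal (cos_remainder t * t powr (- p - 1)) \<le> ennreal (t powr (1 - p))"
        unfolding e by (auto intro: ennreal_leI)
      show ?thesis
      proof (cases "t \<le> 1")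
        case True
        then show ?thesis using le(1) \<open>t > 0\<close> by (intro add_increasing2) auto
      next
        case False
        then show ?thesis using le(2) \<open>t > 0\<close> by (intro add_increasing) auto
      qed
    qed simp
  qed
  also have "\<dots> = (\<integral>\<^sup>+t. ennreal (t powr (3 - p)) * indicator {0..1} t \<partial>lborel) + (\<integral>\<^sup>+t. ennreal (t powr (1 - p)) * indicator {1..} t \<partial>lborel)"
    by (rule nn_integral_add) auto
  also have "\<dots> < \<infinity>"
    using nn_integral_powr_near_0[of "3 - p" 1] nn_integral_powr_tail[of "1 - p" 1] p by simp
  finally show ?thesis .
qed

lemma fourier_const_ge:
  assumes p: "2 < p" "p < 4"
  shows "ennreal (13 / 360 * (2 powr (4 - p) / (4 - p))) \<le> fourier_const p"
    and "ennreal (2 powr (2 - p) / (p * (p - 2))) \<le> fourier_const p"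
proof -
  have "ennreal (13 / 360 * (2 powr (4 - p) / (4 - p))) = (\<integral>\<^sup>+t. ennreal (13 / 360) * (ennreal (t powr (3 - p)) * indicator {0..2} t) \<partial>lborel)"
    using p by (simp add: nn_integral_cmult nn_integral_powr_near_0 ennreal_mult[symmetric])
  also have "\<dots> \<le> fourier_const p"
    unfolding fourier_const_def
  proof (intro nn_integral_mono)
    fix t :: real
    consider "t = 0" | "0 < t" "t \<le> 2" | "t < 0 \<or> t > 2" by linarith
    then show "ennreal (13 / 360) * (ennreal (t powr (3 - p)) * indicator {0..2} t)
      \<le> ennreal (cos_remainder t * t powr (- p - 1)) * indicator {0<..} t"
    proof cases
      case 2
      have "13 / 360 * t powr (3 - p) = 13 / 360 * t ^ 4 * t powr (- p - 1)"
        using 2 by (simp add: power_mult_powr(1)[symmetric])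
      also have "\<dots> \<le> cos_remainder t * t powr (- p - 1)"
        using cos_remainder_ge(1)[of t] 2 by (intro mult_right_mono) auto
      finally show ?thesis using 2 by (simp add: ennreal_mult[symmetric] ennreal_leI)
    qed auto
  qed
  finally show "ennreal (13 / 360 * (2 powr (4 - p) / (4 - p))) \<le> fourier_const p" .
  \<comment> \<open>Integrals in \<open>ennreal\<close> cannot be subtracted, so the constant two in the lower bound \<open>t\<^sup>2 / 2 - 2\<close> is moved to the other side.\<close>
  let ?I1 = "\<integral>\<^sup>+t. ennreal (t powr (1 - p)) * indicator {2..} t \<partial>lborel"
  let ?I2 = "\<integral>\<^sup>+t. ennreal (t powr (- p - 1)) * indicator {2..} t \<partial>lborel"
  have I: "?I1 = ennreal (2 powr (2 - p) / (p - 2))" "?I2 = ennreal (2 powr (- p) / p)"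
  proof -
    have "- x / (2 - p) = x / (p - 2)" "- x / (- p) = x / p" for x
      using p by (simp_all add: field_simps)
    then show "?I1 = ennreal (2 powr (2 - p) / (p - 2))" "?I2 = ennreal (2 powr (- p) / p)"
      using nn_integral_powr_tail[of "1 - p" 2] nn_integral_powr_tail[of "- p - 1" 2] p by simp_all
  qed
  have "(\<integral>\<^sup>+t. ennreal (1 / 2) * (ennreal (t powr (1 - p)) * indicator {2..} t) \<partial>lborel)
    \<le> (\<integral>\<^sup>+t. ennreal (cos_remainder t * t powr (- p - 1)) * indicator {0<..} t + ennreal 2 * (ennreal (t powr (- p - 1)) * indicator {2..} t) \<partial>lborel)"
  proof (intro nn_integral_mono)
    fix t :: real
    show "ennreal (1 / 2) * (ennreal (t powr (1 - p)) * indicator {2..} t)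
      \<le> ennreal (cos_remainder t * t powr (- p - 1)) * indicator {0<..} t + ennreal 2 * (ennreal (t powr (- p - 1)) * indicator {2..} t)"
    proof (cases "t \<ge> 2")
      case True
      have "1 / 2 * t powr (1 - p) = t\<^sup>2 / 2 * t powr (- p - 1)"
        using True by (simp add: power_mult_powr(2)[symmetric])
      also have "\<dots> \<le> (cos_remainder t + 2) * t powr (- p - 1)"
        using cos_remainder_ge(2)[of t] by (intro mult_right_mono) auto
      also have "\<dots> = cos_remainder t * t powr (- p - 1) + 2 * t powr (- p - 1)" by (simp add: algebra_simps)
      finally have "ennreal (1 / 2 * t powr (1 - p)) \<le> ennreal (cos_remainder t * t powr (- p - 1) + 2 * t powr (- p - 1))"
        by (rule ennreal_leI)
      moreover have "ennreal (1 / 2) * ennreal (t powr (1 - p)) = ennreal (1 / 2 * t powr (1 - p))"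
        "ennreal 2 * ennreal (t powr (- p - 1)) = ennreal (2 * t powr (- p - 1))"
        by (rule ennreal_mult[symmetric]; simp)+
      moreover have "ennreal (cos_remainder t * t powr (- p - 1)) + ennreal (2 * t powr (- p - 1))
        = ennreal (cos_remainder t * t powr (- p - 1) + 2 * t powr (- p - 1))"
        by (rule ennreal_plus[symmetric]) (simp_all add: cos_remainder_nonneg)
      moreover have "indicator {2..} t = (1 :: ennreal)" "indicator {0<..} t = (1 :: ennreal)"
        using True by simp_all
      ultimately show ?thesis by (simp only: mult_1_right)
    qed simp
  qed
  also have "\<dots> = fourier_const p + ennreal 2 * ?I2"
    unfolding fourier_const_def by (subst nn_integral_add) (auto simp: nn_integral_cmult)
  finally have "ennreal (1 / 2) * ?I1 \<le> fourier_const p + ennreal 2 * ?I2"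
    by (subst (asm) nn_integral_cmult) simp_all
  moreover have "ennreal (1 / 2) * ennreal (2 powr (2 - p) / (p - 2)) = ennreal (1 / 2 * (2 powr (2 - p) / (p - 2)))"
    "ennreal 2 * ennreal (2 powr (- p) / p) = ennreal (2 * (2 powr (- p) / p))"
    by (rule ennreal_mult[symmetric]; use p in simp)+
  ultimately have le: "ennreal (1 / 2 * (2 powr (2 - p) / (p - 2))) \<le> fourier_const p + ennreal (2 * (2 powr (- p) / p))"
    by (simp only: I)
  obtain K where K: "fourier_const p = ennreal K" "K \<ge> 0"
    using fourier_const_finite[OF p] by (cases "fourier_const p") auto
  have "1 / 2 * (2 powr (2 - p) / (p - 2)) \<le> K + 2 * (2 powr (- p) / p)"
    using le p K by (simp add: ennreal_plus[symmetric] del: ennreal_plus)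
  moreover have "2 powr (- p) = 2 powr (2 - p) / 4"
    using powr_add[of 2 2 "- p"] by simp
  ultimately have "2 powr (2 - p) / (p * (p - 2)) \<le> K"
    using p by (simp add: field_simps)
  then show "ennreal (2 powr (2 - p) / (p * (p - 2))) \<le> fourier_const p"
    using K by (simp add: ennreal_leI)
qed

lemma fourier_const_real:
  assumes p: "2 < p" "p < 4"
  obtains K where "fourier_const p = ennreal K" "K > 0"
    "1 / K \<le> 360 / 13 * (4 - p) * 2 powr (p - 4)" "1 / K \<le> p * (p - 2) * 2 powr (p - 2)"
proof -
  obtain K where K: "fourier_const p = ennreal K" "K \<ge> 0"
    using fourier_const_finite[OF p] by (cases "fourier_const p") auto
  have a: "13 / 360 * (2 powr (4 - p) / (4 - p)) \<le> K" and b: "2 powr (2 - p) / (p * (p - 2)) \<le> K"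
    using fourier_const_ge[OF p] K by simp_all
  have pos: "13 / 360 * (2 powr (4 - p) / (4 - p)) > 0" "2 powr (2 - p) / (p * (p - 2)) > 0" using p by simp_all
  then have K0: "K > 0" using a by linarith
  have pw: "2 powr (p - 4) = 1 / 2 powr (4 - p)" "2 powr (p - 2) = 1 / 2 powr (2 - p)"
    using powr_minus_divide[of 2 "4 - p"] powr_minus_divide[of 2 "2 - p"] by simp_all
  have "1 / K \<le> 1 / (13 / 360 * (2 powr (4 - p) / (4 - p)))"
    by (rule divide_left_mono[OF a]) (simp, rule mult_pos_pos[OF K0 pos(1)])
  also have "\<dots> = 360 / 13 * (4 - p) * 2 powr (p - 4)" using p by (simp add: pw)
  finally have 1: "1 / K \<le> 360 / 13 * (4 - p) * 2 powr (p - 4)" .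
  have "1 / K \<le> 1 / (2 powr (2 - p) / (p * (p - 2)))"
    by (rule divide_left_mono[OF b]) (simp, rule mult_pos_pos[OF K0 pos(2)])
  also have "\<dots> = p * (p - 2) * 2 powr (p - 2)" using p by (simp add: pw)
  finally show ?thesis using that[OF K(1) K0 1] by simp
qed

text \<open>The representation of \<open>\<bar>y\<bar> powr p\<close> turns the difference of the moments into an integral of the difference of the
cosine integrals, which is at most \<open>3 / 4 * \<beta>\<^sup>2 * t ^ 4\<close> by assumption and at most two always. The
first bound is integrated up to \<open>t = \<beta> powr (- 1 / 2)\<close>, where the two have the same order, and the second one
beyond. The poles of these integrals at \<open>p = 2\<close> and \<open>p = 4\<close> are cancelled by the normalizing constant.\<close>

lemma moment_ge_gaussian_of_cos:
  fixes Y :: "'a \<Rightarrow> real"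
  assumes M: "prob_space M" and Y_meas[measurable]: "Y \<in> borel_measurable M"
    and Y2: "integrable M (\<lambda>\<omega>. (Y \<omega>)\<^sup>2)" "(LINT \<omega>|M. (Y \<omega>)\<^sup>2) = 1"
    and p: "2 < p" "p < 4" and \<beta>: "\<beta> > 0"
    and cos: "\<And>t. exp (- t\<^sup>2 / 2) - 3 / 4 * \<beta>\<^sup>2 * t ^ 4 \<le> (LINT \<omega>|M. cos (t * Y \<omega>))"
    and int: "integrable M (\<lambda>\<omega>. \<bar>Y \<omega>\<bar> powr p)"
    and intG: "integrable std_normal_distribution (\<lambda>x. \<bar>x\<bar> powr p)"
  shows "(LINT x|std_normal_distribution. \<bar>x\<bar> powr p) \<le> (LINT \<omega>|M. \<bar>Y \<omega>\<bar> powr p)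
    + \<beta> powr (p / 2) * (270 / 13 * 2 powr (p - 4) + 2 * (p - 2) * 2 powr (p - 2))"
proof -
  interpret M: prob_space M by (rule M)
  interpret G: real_distribution std_normal_distribution by (rule real_dist_normal_dist)
  obtain K where K: "fourier_const p = ennreal K" "K > 0"
    and K1: "1 / K \<le> 360 / 13 * (4 - p) * 2 powr (p - 4)" and K2: "1 / K \<le> p * (p - 2) * 2 powr (p - 2)"
    by (rule fourier_const_real[OF p])
  \<comment> \<open>The point where \<open>3 / 4 * \<beta>\<^sup>2 * t ^ 4\<close> reaches constant size.\<close>
  define T where "T = \<beta> powr (- 1 / 2)"
  have T: "T > 0" using \<beta> by (simp add: T_def)
  define B where "B = 3 / 4 * \<beta>\<^sup>2"
  have B: "B > 0" using \<beta> by (simp add: B_def)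
  let ?m = "LINT \<omega>|M. \<bar>Y \<omega>\<bar> powr p"
  let ?g = "LINT x|std_normal_distribution. \<bar>x\<bar> powr p"
  let ?c = "\<lambda>t. LINT \<omega>|M. cos (t * Y \<omega>)"
  have c_meas[measurable]: "?c \<in> borel_measurable borel"
    by (intro M.borel_measurable_lebesgue_integral) simp
  have c_bound: "- 1 \<le> ?c t" for t
  proof -
    have "(LINT \<omega>|M. - 1) \<le> ?c t"
      by (intro integral_mono M.integrable_const M.integrable_const_bound[where B=1]) auto
    then show ?thesis by (simp add: M.prob_space)
  qed
  have c_nonneg: "0 \<le> ?c t - 1 + t\<^sup>2 / 2" for t
  proof -
    have int: "integrable M (\<lambda>\<omega>. cos (t * Y \<omega>))"
      by (rule M.integrable_const_bound[where B=1]) auto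
    have "(LINT \<omega>|M. 1 - t\<^sup>2 / 2 * (Y \<omega>)\<^sup>2) \<le> ?c t"
      using cos_ge_quadratic[of "t * Y \<omega>" for \<omega>] int Y2
      by (intro integral_mono) (auto simp: power_mult_distrib)
    then show ?thesis using Y2 by (simp add: M.prob_space)
  qed
  have gK: "fourier_const p * ennreal ?g
    = (\<integral>\<^sup>+t. ennreal ((exp (- t\<^sup>2 / 2) - 1 + t\<^sup>2 / 2) * t powr (- p - 1)) * indicator {0<..} t \<partial>lborel)"
    using fourier_moment[OF G.prob_space_axioms _ gaussian_square_integral, of p]
    by (simp add: gaussian_cos_integral nn_integral_eq_integral[OF intG])
  have mK: "fourier_const p * ennreal ?m
    = (\<integral>\<^sup>+t. ennreal ((?c t - 1 + t\<^sup>2 / 2) * t powr (- p - 1)) * indicator {0<..} t \<partial>lborel)"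
    using fourier_moment[OF M Y_meas Y2, of p] by (simp add: nn_integral_eq_integral[OF int])
  have "fourier_const p * ennreal ?g \<le>
    (\<integral>\<^sup>+t. ennreal ((?c t - 1 + t\<^sup>2 / 2) * t powr (- p - 1)) * indicator {0<..} t
      + (ennreal B * (ennreal (t powr (3 - p)) * indicator {0..T} t)
         + ennreal 2 * (ennreal (t powr (- p - 1)) * indicator {T..} t)) \<partial>lborel)"
    unfolding gK
  proof (intro nn_integral_mono)
    fix t :: real
    show "ennreal ((exp (- t\<^sup>2 / 2) - 1 + t\<^sup>2 / 2) * t powr (- p - 1)) * indicator {0<..} t
      \<le> ennreal ((?c t - 1 + t\<^sup>2 / 2) * t powr (- p - 1)) * indicator {0<..} t
      + (ennreal B * (ennreal (t powr (3 - p)) * indicator {0..T} t)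
         + ennreal 2 * (ennreal (t powr (- p - 1)) * indicator {T..} t))" (is "?l \<le> ?r + (?x + ?y)")
    proof (cases "t > 0")
      case True
      define A where "A = (?c t - 1 + t\<^sup>2 / 2) * t powr (- p - 1)"
      have A: "A \<ge> 0" unfolding A_def using c_nonneg[of t] by simp
      show ?thesis
      proof (cases "t \<le> T")
        case le: True
        have "exp (- t\<^sup>2 / 2) - 1 + t\<^sup>2 / 2 \<le> (?c t - 1 + t\<^sup>2 / 2) + B * t ^ 4"
          using cos[of t] by (simp add: B_def)
        then have "(exp (- t\<^sup>2 / 2) - 1 + t\<^sup>2 / 2) * t powr (- p - 1) \<le> ((?c t - 1 + t\<^sup>2 / 2) + B * t ^ 4) * t powr (- p - 1)"
          by (intro mult_right_mono) auto
        also have "\<dots> = A + B * t powr (3 - p)"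
          using power_mult_powr(1)[OF True, of p] by (simp add: A_def distrib_right mult.assoc)
        finally have "?l \<le> ennreal (A + B * t powr (3 - p))" using True by (simp add: ennreal_leI)
        also have "\<dots> = ?r + ?x"
          using True le A B by (simp add: A_def ennreal_plus ennreal_mult)
        also have "\<dots> \<le> ?r + (?x + ?y)" by (intro add_left_mono) simp
        finally show ?thesis .
      next
        case gt: False
        have "exp (- t\<^sup>2 / 2) \<le> 1" by simp
        then have "exp (- t\<^sup>2 / 2) - 1 + t\<^sup>2 / 2 \<le> (?c t - 1 + t\<^sup>2 / 2) + 2"
          using c_bound[of t] by linarith
        then have "(exp (- t\<^sup>2 / 2) - 1 + t\<^sup>2 / 2) * t powr (- p - 1) \<le> ((?c t - 1 + t\<^sup>2 / 2) + 2) * t powr (- p - 1)"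
          by (intro mult_right_mono) auto
        also have "\<dots> = A + 2 * t powr (- p - 1)" by (simp only: A_def distrib_right)
        finally have "?l \<le> ennreal (A + 2 * t powr (- p - 1))" using True by (simp add: ennreal_leI)
        also have "\<dots> = ?r + ?y"
          using True gt A by (simp add: A_def ennreal_plus ennreal_mult)
        also have "\<dots> \<le> ?r + (?x + ?y)" by (intro add_left_mono) simp
        finally show ?thesis .
      qed
    qed simp
  qed
  also have "\<dots> = fourier_const p * ennreal ?m
      + (ennreal B * (\<integral>\<^sup>+t. ennreal (t powr (3 - p)) * indicator {0..T} t \<partial>lborel)
       + ennreal 2 * (\<integral>\<^sup>+t. ennreal (t powr (- p - 1)) * indicator {T..} t \<partial>lborel))"
    unfolding mK by (simp add: nn_integral_add nn_integral_cmult)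
  also have "(\<integral>\<^sup>+t. ennreal (t powr (3 - p)) * indicator {0..T} t \<partial>lborel) = ennreal (T powr (4 - p) / (4 - p))"
    using nn_integral_powr_near_0[of "3 - p" T] p T by simp
  also have "(\<integral>\<^sup>+t. ennreal (t powr (- p - 1)) * indicator {T..} t \<partial>lborel) = ennreal (T powr (- p) / p)"
    using nn_integral_powr_tail[of "- p - 1" T] p T by simp
  finally have ineq: "fourier_const p * ennreal ?g \<le> fourier_const p * ennreal ?m
      + (ennreal B * ennreal (T powr (4 - p) / (4 - p)) + ennreal 2 * ennreal (T powr (- p) / p))" .
  have g0: "?g \<ge> 0" "?m \<ge> 0" by (simp_all add: integral_nonneg)
  have "ennreal (K * ?g) \<le> ennreal (K * ?m + (B * (T powr (4 - p) / (4 - p)) + 2 * (T powr (- p) / p)))"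
  proof -
    have "ennreal (K * ?m + (B * (T powr (4 - p) / (4 - p)) + 2 * (T powr (- p) / p)))
      = ennreal K * ennreal ?m + (ennreal B * ennreal (T powr (4 - p) / (4 - p)) + ennreal 2 * ennreal (T powr (- p) / p))"
      using K B p g0 by (simp add: ennreal_plus ennreal_mult del: times_divide_eq_right)
    moreover have "ennreal (K * ?g) = ennreal K * ennreal ?g" using K g0 by (simp add: ennreal_mult)
    ultimately show ?thesis using ineq unfolding K(1) by simp
  qed
  then have "K * ?g \<le> K * ?m + (B * (T powr (4 - p) / (4 - p)) + 2 * (T powr (- p) / p))"
    using K B p g0 by (subst (asm) ennreal_le_iff) auto
  also have "B * (T powr (4 - p) / (4 - p)) + 2 * (T powr (- p) / p) = \<beta> powr (p / 2) * (3 / 4 / (4 - p) + 2 / p)"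
  proof -
    have "\<beta>\<^sup>2 * T powr (4 - p) = \<beta> powr (p / 2)"
    proof -
      have "\<beta>\<^sup>2 * T powr (4 - p) = \<beta> powr 2 * \<beta> powr (- 1 / 2 * (4 - p))"
        using \<beta> by (simp add: T_def powr_powr)
      also have "\<dots> = \<beta> powr (2 + - 1 / 2 * (4 - p))" by (rule powr_add[symmetric])
      also have "2 + - 1 / 2 * (4 - p) = p / 2" by (simp add: field_simps)
      finally show ?thesis .
    qed
    moreover have "T powr (- p) = \<beta> powr (p / 2)" by (simp add: T_def powr_powr)
    ultimately show ?thesis by (simp add: B_def algebra_simps)
  qed
  finally have "?g \<le> ?m + 1 / K * (\<beta> powr (p / 2) * (3 / 4 / (4 - p) + 2 / p))"
    using K(2) by (simp add: field_simps)
  also have "1 / K * (\<beta> powr (p / 2) * (3 / 4 / (4 - p) + 2 / p))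
    = \<beta> powr (p / 2) * (1 / K * (3 / 4 / (4 - p)) + 1 / K * (2 / p))" by (simp only: distrib_left mult.left_commute)
  also have "\<dots> \<le> \<beta> powr (p / 2) * (360 / 13 * (4 - p) * 2 powr (p - 4) * (3 / 4 / (4 - p)) + p * (p - 2) * 2 powr (p - 2) * (2 / p))"
    using p by (intro mult_left_mono add_mono mult_right_mono K1 K2) auto
  also have "360 / 13 * (4 - p) * 2 powr (p - 4) * (3 / 4 / (4 - p)) = 270 / 13 * 2 powr (p - 4)"
  proof -
    have "360 / 13 * (4 - p) * w * (3 / 4 / (4 - p)) = 270 / 13 * w" for w :: real
      using p by (simp add: divide_simps)
    then show ?thesis .
  qed
  also have "p * (p - 2) * 2 powr (p - 2) * (2 / p) = 2 * (p - 2) * 2 powr (p - 2)"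
    using p by simp
  finally show ?thesis by simp
qed

section \<open>The Prekopa-Leindler inequality for even functions on the line\<close>

text \<open>The layer cake formula, with the heights rescaled to the interval from zero to one.\<close>

lemma level_set_integral:
  assumes [measurable]: "f \<in> borel_measurable borel" and nn: "\<And>x. f x \<ge> 0" and k: "k > 0"
  shows "(\<integral>\<^sup>+x. ennreal (min (f x) k) \<partial>lborel)
    = ennreal k * (\<integral>\<^sup>+s. indicator {0<..<1} s * emeasure lborel {x :: real. k * s < f x} \<partial>lborel)"
proof -
  have *: "ennreal (min (f x) k) = ennreal k * (\<integral>\<^sup>+s. indicator {0<..<1} s * indicator {x. k * s < f x} x \<partial>lborel)" for x
  proof -
    have "(\<integral>\<^sup>+s. indicator {0<..<1} s * indicator {x. k * s < f x} x \<partial>lborel)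
      = (\<integral>\<^sup>+s. indicator {0<..<min 1 (f x / k)} s \<partial>lborel)"
      by (intro nn_integral_cong) (use k in \<open>auto simp: indicator_def field_simps\<close>)
    also have "\<dots> = ennreal (min 1 (f x / k))" using nn[of x] k by simp
    also have "ennreal k * \<dots> = ennreal (min (f x) k)"
      using nn[of x] k by (simp add: ennreal_mult[symmetric] min_def)
    finally show ?thesis by simp
  qed
  have "(\<integral>\<^sup>+x. ennreal (min (f x) k) \<partial>lborel)
    = ennreal k * (\<integral>\<^sup>+x. (\<integral>\<^sup>+s. indicator {0<..<1} s * indicator {x. k * s < f x} x \<partial>lborel) \<partial>lborel)"
    unfolding * by (intro nn_integral_cmult) simp
  also have "(\<integral>\<^sup>+x. (\<integral>\<^sup>+s. indicator {0<..<1} s * indicator {x. k * s < f x} x \<partial>lborel) \<partial>lborel)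
    = (\<integral>\<^sup>+s. (\<integral>\<^sup>+x. indicator {0<..<1} s * indicator {x. k * s < f x} x \<partial>lborel) \<partial>lborel)"
    by (rule lborel_pair.Fubini'[symmetric]) simp
  also have "\<dots> = (\<integral>\<^sup>+s. indicator {0<..<1} s * emeasure lborel {x. k * s < f x} \<partial>lborel)"
    by (intro nn_integral_cong) (simp add: nn_integral_cmult)
  finally show ?thesis .
qed

text \<open>A set of radius \<open>r\<close> around zero has measure at most \<open>2 * r\<close>, and \<open>C\<close> contains the symmetric interval whose
radius is the combination of the radii of \<open>A\<close> and \<open>B\<close>.\<close>

lemma emeasure_symmetric_Minkowski:
  fixes A B C :: "real set"
  assumes u: "u > 0" and v: "v > 0"
    and [measurable]: "C \<in> sets borel" and A: "0 \<in> A" and B: "0 \<in> B"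
    and C: "\<And>x y. x \<in> A \<Longrightarrow> y \<in> B \<Longrightarrow> {-(u * \<bar>x\<bar> + v * \<bar>y\<bar>) .. u * \<bar>x\<bar> + v * \<bar>y\<bar>} \<subseteq> C"
  shows "ennreal u * emeasure lborel A + ennreal v * emeasure lborel B \<le> emeasure lborel C"
proof (cases "emeasure lborel C = \<infinity>")
  case False
  then obtain H where H: "emeasure lborel C = ennreal H" "H \<ge> 0"
    by (cases "emeasure lborel C") (auto simp: top_ennreal_def)
  have le: "u * \<bar>x\<bar> + v * \<bar>y\<bar> \<le> H / 2" if "x \<in> A" "y \<in> B" for x y
  proof -
    define z where "z = u * \<bar>x\<bar> + v * \<bar>y\<bar>"
    have z: "z \<ge> 0" using u v by (simp add: z_def)
    have "emeasure lborel {- z .. z} \<le> emeasure lborel C"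
      using C[OF that] by (intro emeasure_mono) (auto simp: z_def)
    then have "ennreal (2 * z) \<le> ennreal H" using z H by simp
    then show ?thesis using z H by (simp add: z_def)
  qed
  define \<alpha> where "\<alpha> = (SUP x\<in>A. \<bar>x\<bar>)"
  define \<beta> where "\<beta> = (SUP y\<in>B. \<bar>y\<bar>)"
  have bA: "bdd_above ((\<lambda>x. \<bar>x\<bar>) ` A)"
    using le[OF _ B] u by (intro bdd_aboveI2[of _ _ "H / 2 / u"]) (auto simp: field_simps)
  have bB: "bdd_above ((\<lambda>x. \<bar>x\<bar>) ` B)"
    using le[OF A] v by (intro bdd_aboveI2[of _ _ "H / 2 / v"]) (auto simp: field_simps)
  have xa: "\<bar>x\<bar> \<le> \<alpha>" if "x \<in> A" for x unfolding \<alpha>_def by (rule cSUP_upper[OF that bA])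
  have yb: "\<bar>y\<bar> \<le> \<beta>" if "y \<in> B" for y unfolding \<beta>_def by (rule cSUP_upper[OF that bB])
  have a0: "\<alpha> \<ge> 0" "\<beta> \<ge> 0" using xa[OF A] yb[OF B] by auto
  have "u * \<alpha> + v * \<beta> \<le> H / 2"
  proof -
    have "\<alpha> \<le> (H / 2 - v * \<bar>y\<bar>) / u" if "y \<in> B" for y
      unfolding \<alpha>_def using A le[OF _ that] u by (intro cSUP_least) (auto simp: field_simps)
    then have "\<beta> \<le> (H / 2 - u * \<alpha>) / v"
      unfolding \<beta>_def using B u v by (intro cSUP_least) (auto simp: field_simps)
    then show ?thesis using v by (simp add: field_simps)
  qed
  moreover have "emeasure lborel A \<le> ennreal (2 * \<alpha>)"
  proof -
    have "emeasure lborel A \<le> emeasure lborel {- \<alpha> .. \<alpha>}" using xa by (intro emeasure_mono) (auto simp: abs_le_iff minus_le_iff)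
    then show ?thesis using a0 by simp
  qed
  moreover have "emeasure lborel B \<le> ennreal (2 * \<beta>)"
  proof -
    have "emeasure lborel B \<le> emeasure lborel {- \<beta> .. \<beta>}" using yb by (intro emeasure_mono) (auto simp: abs_le_iff minus_le_iff)
    then show ?thesis using a0 by simp
  qed
  ultimately have "ennreal u * emeasure lborel A + ennreal v * emeasure lborel B
      \<le> ennreal u * ennreal (2 * \<alpha>) + ennreal v * ennreal (2 * \<beta>)"
    by (intro add_mono mult_left_mono) auto
  also have "\<dots> = ennreal (u * (2 * \<alpha>) + v * (2 * \<beta>))"
    using u v a0 by (simp add: ennreal_mult)
  also have "\<dots> \<le> emeasure lborel C"
    unfolding H using \<open>u * \<alpha> + v * \<beta> \<le> H / 2\<close> by (intro ennreal_leI) simp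
  finally show ?thesis .
qed simp

text \<open>After division by their maxima \<open>f 0\<close> and \<open>g 0\<close>, the functions \<open>f\<close> and \<open>g\<close> have nonempty level sets at the same
heights. At each height the level sets of \<open>f\<close>, \<open>g\<close> and \<open>h\<close> satisfy the Minkowski inequality above. Integration over the
heights gives an arithmetic mean of the normalized integrals, which dominates their geometric mean.\<close>

lemma prekopa_leindler_even:
  fixes f g h :: "real \<Rightarrow> real"
  assumes [measurable]: "f \<in> borel_measurable borel" "g \<in> borel_measurable borel" "h \<in> borel_measurable borel"
    and nn: "\<And>x. f x \<ge> 0" "\<And>x. g x \<ge> 0" "\<And>x. h x \<ge> 0"
    and f_max: "\<And>x. f x \<le> f 0" and g_max: "\<And>x. g x \<le> g 0"
    and f_even: "\<And>x. f \<bar>x\<bar> = f x" and g_even: "\<And>x. g \<bar>x\<bar> = g x" and h_even: "\<And>x. h \<bar>x\<bar> = h x"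
    and h_mono: "\<And>x y. 0 \<le> x \<Longrightarrow> x \<le> y \<Longrightarrow> h y \<le> h x"
    and uv: "u > 0" "v > 0" "u + v = 1"
    and h: "\<And>x y. 0 \<le> x \<Longrightarrow> 0 \<le> y \<Longrightarrow> f x powr u * g y powr v \<le> h (u * x + v * y)"
    and F: "(\<integral>\<^sup>+x. ennreal (f x) \<partial>lborel) = ennreal F" "F \<ge> 0"
    and G: "(\<integral>\<^sup>+x. ennreal (g x) \<partial>lborel) = ennreal G" "G \<ge> 0"
  shows "ennreal (F powr u * G powr v) \<le> (\<integral>\<^sup>+x. ennreal (h x) \<partial>lborel)"
proof (cases "f 0 = 0 \<or> g 0 = 0 \<or> F = 0 \<or> G = 0")
  case True
  have "F = 0" if "f 0 = 0"
  proof -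
    have "f x = 0" for x using f_max[of x] nn(1)[of x] that by simp
    then show ?thesis using F by simp
  qed
  moreover have "G = 0" if "g 0 = 0"
  proof -
    have "g x = 0" for x using g_max[of x] nn(2)[of x] that by simp
    then show ?thesis using G by simp
  qed
  ultimately show ?thesis using True by auto
next
  case False
  then have pos: "F > 0" "G > 0" and F0: "f 0 > 0" "g 0 > 0"
    using F G nn(1)[of 0] nn(2)[of 0] by auto
  define a where "a = f 0"
  define b where "b = g 0"
  \<comment> \<open>At height \<open>s\<close> the level sets are compared at \<open>a * s\<close> for \<open>f\<close>, \<open>b * s\<close> for \<open>g\<close> and \<open>c * s\<close> for \<open>h\<close>.\<close>
  define c where "c = a powr u * b powr v"
  have ab: "a > 0" "b > 0" "c > 0" using F0 by (auto simp: a_def b_def c_def)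
  let ?I = "\<lambda>k f. \<integral>\<^sup>+s. indicator {0<..<1} s * emeasure lborel {x :: real. k * s < f x} \<partial>lborel"
  have Fa: "ennreal a * ?I a f = ennreal F"
    using level_set_integral[of f a] nn ab f_max F by (simp add: a_def min_absorb1)
  have Gb: "ennreal b * ?I b g = ennreal G"
    using level_set_integral[of g b] nn ab g_max G by (simp add: b_def min_absorb1)
  have levels: "ennreal u * emeasure lborel {x. a * s < f x} + ennreal v * emeasure lborel {x. b * s < g x}
      \<le> emeasure lborel {x. c * s < h x}" if s: "0 < s" "s < 1" for s
  proof (rule emeasure_symmetric_Minkowski[OF uv(1,2)])
    show "0 \<in> {x. a * s < f x}" "0 \<in> {x. b * s < g x}" using s ab by (simp_all add: a_def b_def)
    fix x y assume xy: "x \<in> {x. a * s < f x}" "y \<in> {x. b * s < g x}"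
    have asp: "0 < a * s" "0 < b * s" using s ab by simp_all
    have "c * s = (a * s) powr u * (b * s) powr v"
    proof -
      have "s powr u * s powr v = s" using s uv by (simp flip: powr_add)
      then show ?thesis using s ab by (simp add: c_def powr_mult mult_ac)
    qed
    also have "\<dots> < f \<bar>x\<bar> powr u * g \<bar>y\<bar> powr v"
      using xy asp uv by (intro mult_strict_mono powr_less_mono2) (auto simp: f_even g_even)
    also have "\<dots> \<le> h (u * \<bar>x\<bar> + v * \<bar>y\<bar>)" by (rule h) auto
    finally have *: "c * s < h (u * \<bar>x\<bar> + v * \<bar>y\<bar>)" .
    have "c * s < h z" if "\<bar>z\<bar> \<le> u * \<bar>x\<bar> + v * \<bar>y\<bar>" for z
      using h_mono[OF _ that] * h_even[of z] by simp
    then show "{-(u * \<bar>x\<bar> + v * \<bar>y\<bar>) .. u * \<bar>x\<bar> + v * \<bar>y\<bar>} \<subseteq> {x. c * s < h x}"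
      by (auto simp: abs_le_iff)
  qed simp
  have IF: "?I a f = ennreal (F / a)"
  proof -
    have "ennreal a * ?I a f = ennreal a * ennreal (F / a)" using Fa ab F by (simp add: ennreal_mult[symmetric])
    then show ?thesis using ab by (simp add: ennreal_mult_cancel_left)
  qed
  have IG: "?I b g = ennreal (G / b)"
  proof -
    have "ennreal b * ?I b g = ennreal b * ennreal (G / b)" using Gb ab G by (simp add: ennreal_mult[symmetric])
    then show ?thesis using ab by (simp add: ennreal_mult_cancel_left)
  qed
  have "F powr u * G powr v = c * ((F / a) powr u * (G / b) powr v)"
    using ab F G by (simp add: c_def powr_divide)
  also have "\<dots> \<le> c * (u * (F / a) + v * (G / b))"
    using ab pos uv by (intro mult_left_mono Youngs_inequality_0) auto
  finally have "ennreal (F powr u * G powr v) \<le> ennreal (c * (u * (F / a) + v * (G / b)))" by (rule ennreal_leI)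
  also have "\<dots> = ennreal c * (ennreal u * ?I a f + ennreal v * ?I b g)"
  proof -
    have "ennreal (u * (F / a)) = ennreal u * ennreal (F / a)" "ennreal (v * (G / b)) = ennreal v * ennreal (G / b)"
      by (rule ennreal_mult, use ab uv F G in simp, use ab uv F G in simp)+
    then show ?thesis
      unfolding IF IG using ab uv F G by (simp add: ennreal_mult[of c] ennreal_plus del: times_divide_eq_right)
  qed
  also have "ennreal u * ?I a f + ennreal v * ?I b g
    = (\<integral>\<^sup>+s. indicator {0<..<1} s * (ennreal u * emeasure lborel {x. a * s < f x} + ennreal v * emeasure lborel {x. b * s < g x}) \<partial>lborel)"
    by (simp add: distrib_left nn_integral_add nn_integral_cmult mult.left_commute)
  also have "\<dots> \<le> ?I c h"
    using levels by (intro nn_integral_mono) (auto simp: indicator_def)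
  also have "ennreal c * ?I c h = (\<integral>\<^sup>+x. ennreal (min (h x) c) \<partial>lborel)"
    by (rule level_set_integral[symmetric]) (use nn ab in auto)
  also have "\<dots> \<le> (\<integral>\<^sup>+x. ennreal (h x) \<partial>lborel)"
    by (intro nn_integral_mono ennreal_leI) simp
  finally show ?thesis by (simp add: mult_left_mono)
qed

section \<open>Marginals of coordinatewise even log-concave functions\<close>

text \<open>Evenness in each coordinate is part of the definition: together with log-concavity it makes the
function decreasing in the modulus of each coordinate, so that the even case of the Prekopa-Leindler
inequality applies on every line. Points are functions, not vectors, so that coordinates can be integrated out one
at a time.\<close>

definition coord_log_concave :: "(('i \<Rightarrow> real) \<Rightarrow> real) \<Rightarrow> bool" where
  "coord_log_concave F \<longleftrightarrow> (\<forall>x. 0 \<le> F x) \<and> (\<forall>x i. F (x(i := - x i)) = F x) \<and>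
    (\<forall>x y u v. 0 < u \<longrightarrow> 0 < v \<longrightarrow> u + v = 1 \<longrightarrow> F x powr u * F y powr v \<le> F (\<lambda>i. u * x i + v * y i))"

lemma coord_log_concaveD:
  assumes "coord_log_concave F"
  shows "0 \<le> F x" "F (x(i := - x i)) = F x"
    "0 < u \<Longrightarrow> 0 < v \<Longrightarrow> u + v = 1 \<Longrightarrow> F x powr u * F y powr v \<le> F (\<lambda>i. u * x i + v * y i)"
  using assms by (auto simp: coord_log_concave_def)

lemma coord_log_concave_even:
  assumes F: "coord_log_concave F"
  shows "F (z(i := - t)) = F (z(i := t))" and "F (z(i := \<bar>t\<bar>)) = F (z(i := t))"
proof -
  show *: "F (z(i := - t)) = F (z(i := t))" for t
    using coord_log_concaveD(2)[OF F, of "z(i := t)" i] by simp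
  show "F (z(i := \<bar>t\<bar>)) = F (z(i := t))"
    using *[of t] by (cases "t \<ge> 0") auto
qed

text \<open>The point with coordinate \<open>s\<close> lies between those with coordinates \<open>t\<close> and \<open>- t\<close>, where \<open>F\<close> takes the same value.\<close>

lemma coord_log_concave_antimono:
  assumes F: "coord_log_concave F" and st: "0 \<le> s" "s \<le> t"
  shows "F (z(i := t)) \<le> F (z(i := s))"
proof (cases "s = t")
  case False
  with st have t: "s < t" "t > 0" by auto
  define u where "u = (t + s) / (2 * t)"
  define v where "v = (t - s) / (2 * t)"
  have uv: "u > 0" "v > 0" "u + v = 1" using st t by (auto simp: u_def v_def field_simps)
  have "(\<lambda>j. u * (z(i := t)) j + v * (z(i := - t)) j) = z(i := s)"
  proof
    fix j
    have "u * z j + v * z j = z j" using uv by (simp flip: distrib_right)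
    moreover have "u * t + v * (- t) = s" using t by (simp add: u_def v_def field_simps)
    ultimately show "u * (z(i := t)) j + v * (z(i := - t)) j = (z(i := s)) j" by simp
  qed
  then have "F (z(i := t)) powr u * F (z(i := - t)) powr v \<le> F (z(i := s))"
    using coord_log_concaveD(3)[OF F uv, of "z(i := t)" "z(i := - t)"] by simp
  moreover have "F (z(i := t)) powr u * F (z(i := - t)) powr v = F (z(i := t))"
    using coord_log_concaveD(1)[OF F, of "z(i := t)"] uv
    by (simp add: coord_log_concave_even[OF F] powr_add[symmetric])
  ultimately show ?thesis by simp
qed simp

text \<open>The integral over the \<open>i\<close>-th coordinate. It is still a function of all coordinates but does not depend on the
\<open>i\<close>-th one.\<close>

definition marginal :: "'i \<Rightarrow> (('i \<Rightarrow> real) \<Rightarrow> real) \<Rightarrow> ('i \<Rightarrow> real) \<Rightarrow> real" where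
  "marginal i F z = enn2real (\<integral>\<^sup>+t. ennreal (F (z(i := t))) \<partial>lborel)"

abbreviation lborel_fun :: "'i set \<Rightarrow> ('i \<Rightarrow> real) measure" where
  "lborel_fun I \<equiv> Pi\<^sub>M I (\<lambda>_. lborel)"

lemma measurable_fun_upd_UNIV: "(\<lambda>(z, t). z(i := t)) \<in> lborel_fun UNIV \<Otimes>\<^sub>M lborel \<rightarrow>\<^sub>M lborel_fun UNIV"
  using measurable_add_dim[of i UNIV "\<lambda>_. lborel"] by (simp add: insert_UNIV)

lemma measurable_fun_upd_section:
  assumes "F \<in> borel_measurable (lborel_fun UNIV)"
  shows "(\<lambda>t. F (z(i := t))) \<in> borel_measurable borel"
proof -
  have "(\<lambda>t. z(i := t)) \<in> lborel \<rightarrow>\<^sub>M lborel_fun UNIV"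
    by (rule measurable_PiM_single') auto
  from measurable_compose[OF this assms] show ?thesis by simp
qed

text \<open>Boundedness and bounded support in the \<open>i\<close>-th direction make the integral finite, so that the real-valued \<open>marginal\<close> is
the true one.\<close>

lemma nn_integral_marginal:
  assumes F: "F \<in> borel_measurable (lborel_fun UNIV)" and C: "\<And>x. F x \<le> C" "\<And>x. 0 \<le> F x"
    and L: "\<And>x. F x \<noteq> 0 \<Longrightarrow> \<bar>x i\<bar> \<le> L" "L \<ge> 0"
  shows "(\<integral>\<^sup>+t. ennreal (F (z(i := t))) \<partial>lborel) = ennreal (marginal i F z)"
    and "marginal i F z \<le> 2 * L * C"
proof -
  have C0: "C \<ge> 0" using C[of z] by linarith
  have le: "(\<integral>\<^sup>+t. ennreal (F (z(i := t))) \<partial>lborel) \<le> ennreal (2 * L * C)"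
  proof -
    have "(\<integral>\<^sup>+t. ennreal (F (z(i := t))) \<partial>lborel) \<le> (\<integral>\<^sup>+t. ennreal C * indicator {-L..L} t \<partial>lborel)"
    proof (intro nn_integral_mono)
      fix t
      show "ennreal (F (z(i := t))) \<le> ennreal C * indicator {-L..L} t"
        using C(1)[of "z(i := t)"] L(1)[of "z(i := t)"]
        by (cases "F (z(i := t)) = 0") (auto simp: indicator_def abs_le_iff minus_le_iff ennreal_leI)
    qed
    also have "\<dots> = ennreal (2 * L * C)"
      using C0 L(2) by (simp add: nn_integral_cmult ennreal_mult[symmetric] mult_ac)
    finally show ?thesis .
  qed
  then have fin: "(\<integral>\<^sup>+t. ennreal (F (z(i := t))) \<partial>lborel) < \<infinity>"
    by (rule le_less_trans) (simp add: top_ennreal_def[symmetric])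
  then show *: "(\<integral>\<^sup>+t. ennreal (F (z(i := t))) \<partial>lborel) = ennreal (marginal i F z)"
    unfolding marginal_def by (intro ennreal_enn2real[symmetric]) simp
  show "marginal i F z \<le> 2 * L * C"
    using le C0 L(2) unfolding * by (simp add: ennreal_le_iff)
qed

lemma measurable_marginal:
  assumes [measurable]: "F \<in> borel_measurable (lborel_fun UNIV)"
  shows "marginal i F \<in> borel_measurable (lborel_fun UNIV)"
proof -
  have [measurable]: "(\<lambda>p. F (case p of (z, t) \<Rightarrow> z(i := t))) \<in> borel_measurable (lborel_fun UNIV \<Otimes>\<^sub>M lborel)"
    by (rule measurable_compose[OF measurable_fun_upd_UNIV assms])
  have [measurable]: "(\<lambda>(z, t). F (z(i := t))) \<in> borel_measurable (lborel_fun UNIV \<Otimes>\<^sub>M lborel)"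
    by (rule measurable_cong[THEN iffD1, rotated, of "\<lambda>p. F (case p of (z, t) \<Rightarrow> z(i := t))"]) (auto split: prod.split)
  have "(\<lambda>z. enn2real (\<integral>\<^sup>+t. ennreal (F (z(i := t))) \<partial>lborel)) \<in> borel_measurable (lborel_fun UNIV)"
    by measurable
  then show ?thesis by (simp add: marginal_def[abs_def])
qed

lemma coord_log_concave_marginal:
  assumes F: "coord_log_concave F" and meas: "F \<in> borel_measurable (lborel_fun UNIV)"
    and C: "\<And>x. F x \<le> C" and L: "\<And>x. F x \<noteq> 0 \<Longrightarrow> \<bar>x i\<bar> \<le> L" "L \<ge> 0"
  shows "coord_log_concave (marginal i F)"
  unfolding coord_log_concave_def
proof (intro conjI allI impI)
  note int = nn_integral_marginal[OF meas C coord_log_concaveD(1)[OF F] L]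
  show "0 \<le> marginal i F x" for x by (simp add: marginal_def)
  show "marginal i F (x(j := - x j)) = marginal i F x" for x j
  proof -
    have "F ((x(j := - x j))(i := t)) = F (x(i := t))" for t
      using coord_log_concaveD(2)[OF F, of "x(i := t)" j]
      by (cases "j = i") (auto simp: fun_upd_twist)
    then show ?thesis by (simp add: marginal_def)
  qed
  fix x y :: "'a \<Rightarrow> real" and u v :: real
  assume uv: "0 < u" "0 < v" "u + v = 1"
  let ?z = "\<lambda>j. u * x j + v * y j"
  have "ennreal (marginal i F x powr u * marginal i F y powr v) \<le> (\<integral>\<^sup>+t. ennreal (F (?z(i := t))) \<partial>lborel)"
  proof (rule prekopa_leindler_even[where f="\<lambda>t. F (x(i := t))" and g="\<lambda>t. F (y(i := t))"])
    show "F (x(i := t)) \<le> F (x(i := 0))" "F (y(i := t)) \<le> F (y(i := 0))" for t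
      using coord_log_concave_antimono[OF F, of 0 "\<bar>t\<bar>" _ i] by (simp_all add: coord_log_concave_even[OF F])
    show "F (x(i := s)) powr u * F (y(i := t)) powr v \<le> F (?z(i := u * s + v * t))" for s t
    proof -
      have "(\<lambda>j. u * (x(i := s)) j + v * (y(i := t)) j) = ?z(i := u * s + v * t)" by auto
      then show ?thesis using coord_log_concaveD(3)[OF F uv, of "x(i := s)" "y(i := t)"] by simp
    qed
  qed (use uv int in \<open>auto simp: coord_log_concave_even[OF F] coord_log_concaveD(1)[OF F] marginal_def
       intro!: coord_log_concave_antimono[OF F] measurable_fun_upd_section meas\<close>)
  also have "\<dots> = ennreal (marginal i F ?z)" by (rule int)
  finally show "marginal i F x powr u * marginal i F y powr v \<le> marginal i F ?z"
    by (simp add: marginal_def)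
qed

lemma measurable_override_on:
  "(\<lambda>y. override_on z y K) \<in> lborel_fun K \<rightarrow>\<^sub>M lborel_fun UNIV"
proof (rule measurable_PiM_single')
  fix j
  show "(\<lambda>y. override_on z y K j) \<in> lborel_fun K \<rightarrow>\<^sub>M lborel"
    by (cases "j \<in> K") (simp_all add: override_on_def)
qed auto

text \<open>Iterated marginals. Only the coordinates in \<open>B\<close> are known to be bounded on the support; each integration
uses up one of them and the set shrinks to \<open>B - K\<close>.\<close>

lemma coord_log_concave_integrate_out:
  fixes F :: "('i \<Rightarrow> real) \<Rightarrow> real"
  assumes "finite K" and "coord_log_concave F" and "F \<in> borel_measurable (lborel_fun UNIV)"
    and "\<And>x. F x \<le> C" and "\<And>x j. F x \<noteq> 0 \<Longrightarrow> \<bar>x j\<bar> \<le> L \<or> j \<notin> B" "L \<ge> 0" "K \<subseteq> B"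
  shows "\<exists>G D. coord_log_concave G \<and> G \<in> borel_measurable (lborel_fun UNIV) \<and> (\<forall>x. G x \<le> D)
    \<and> (\<forall>x j. G x \<noteq> 0 \<longrightarrow> \<bar>x j\<bar> \<le> L \<or> j \<notin> B - K)
    \<and> (\<forall>z. (\<integral>\<^sup>+y. ennreal (F (override_on z y K)) \<partial>lborel_fun K) = ennreal (G z))"
  using assms
proof (induction K arbitrary: F C B rule: finite_induct)
  case empty
  interpret product_sigma_finite "\<lambda>_. lborel :: real measure" by standard
  have "emeasure (lborel_fun ({} :: 'i set)) (space (lborel_fun ({} :: 'i set))) = 1" by (simp add: space_PiM)
  then have "(\<integral>\<^sup>+y. ennreal (F (override_on z y {})) \<partial>lborel_fun {}) = ennreal (F z)" for z
    by simp
  then show ?case using empty by (intro exI[of _ F] exI[of _ C]) auto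
next
  case (insert i K)
  interpret product_sigma_finite "\<lambda>_. lborel :: real measure" by standard
  let ?M = "marginal i F"
  have suppi: "\<bar>x i\<bar> \<le> L" if "F x \<noteq> 0" for x using insert.prems(4)[OF that, of i] insert.prems(6) by auto
  note int = nn_integral_marginal[OF insert.prems(2,3) coord_log_concaveD(1)[OF insert.prems(1)] suppi insert.prems(5)]
  have "\<exists>G D. coord_log_concave G \<and> G \<in> borel_measurable (lborel_fun UNIV) \<and> (\<forall>x. G x \<le> D)
    \<and> (\<forall>x j. G x \<noteq> 0 \<longrightarrow> \<bar>x j\<bar> \<le> L \<or> j \<notin> (B - {i}) - K)
    \<and> (\<forall>z. (\<integral>\<^sup>+y. ennreal (?M (override_on z y K)) \<partial>lborel_fun K) = ennreal (G z))"
  proof (rule insert.IH)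
    show "coord_log_concave ?M"
      by (rule coord_log_concave_marginal[OF insert.prems(1,2,3) suppi insert.prems(5)])
    show "?M \<in> borel_measurable (lborel_fun UNIV)" by (rule measurable_marginal[OF insert.prems(2)])
    show "?M x \<le> 2 * L * C" for x by (rule int)
    show "\<bar>x j\<bar> \<le> L \<or> j \<notin> B - {i}" if "?M x \<noteq> 0" for x j
    proof (rule ccontr)
      assume *: "\<not> (\<bar>x j\<bar> \<le> L \<or> j \<notin> B - {i})"
      have "F (x(i := t)) = 0" for t
        using insert.prems(4)[of "x(i := t)" j] * by (metis Diff_iff fun_upd_other singletonI)
      then have "?M x = 0" by (simp add: marginal_def)
      with that show False by simp
    qed
  qed (use insert.prems insert.hyps in auto)
  then obtain G D where G: "coord_log_concave G" "G \<in> borel_measurable (lborel_fun UNIV)" "\<And>x. G x \<le> D"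
    "\<And>x j. G x \<noteq> 0 \<Longrightarrow> \<bar>x j\<bar> \<le> L \<or> j \<notin> (B - {i}) - K"
    "\<And>z. (\<integral>\<^sup>+y. ennreal (?M (override_on z y K)) \<partial>lborel_fun K) = ennreal (G z)"
    by (elim exE conjE) (rule that, assumption, assumption, erule spec, blast, erule spec)
  have "(\<integral>\<^sup>+y. ennreal (F (override_on z y (insert i K))) \<partial>lborel_fun (insert i K)) = ennreal (G z)" for z
  proof -
    have "(\<integral>\<^sup>+y. ennreal (F (override_on z y (insert i K))) \<partial>lborel_fun (insert i K))
      = (\<integral>\<^sup>+y. (\<integral>\<^sup>+t. ennreal (F (override_on z (y(i := t)) (insert i K))) \<partial>lborel) \<partial>lborel_fun K)"
      by (rule product_nn_integral_insert[OF insert.hyps])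
         (intro measurable_compose[OF measurable_compose[OF measurable_override_on insert.prems(2)]] measurable_ennreal)
    also have "\<dots> = (\<integral>\<^sup>+y. (\<integral>\<^sup>+t. ennreal (F ((override_on z y K)(i := t))) \<partial>lborel) \<partial>lborel_fun K)"
    proof -
      have "override_on z (y(i := t)) (insert i K) = (override_on z y K)(i := t)" for y t
        using insert.hyps by (auto simp: override_on_def fun_eq_iff)
      then show ?thesis by simp
    qed
    also have "\<dots> = ennreal (G z)"
    proof -
      have "(\<integral>\<^sup>+t. ennreal (F ((override_on z y K)(i := t))) \<partial>lborel) = ennreal (?M (override_on z y K))" for y
        by (rule int(1))
      then show ?thesis using G(5)[of z] by simp
    qed
    finally show ?thesis .
  qed
  moreover have "\<bar>x j\<bar> \<le> L \<or> j \<notin> B - insert i K" if "G x \<noteq> 0" for x j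
    using G(4)[OF that, of j] by blast
  ultimately show ?case using G by blast
qed

text \<open>Shifting the two halves of the tail towards zero turns the integral over \<open>\<bar>y\<bar> \<ge> s\<close> into an integral of an even
function over the whole line.\<close>

lemma nn_integral_even_tail:
  fixes g :: "real \<Rightarrow> real"
  assumes [measurable]: "g \<in> borel_measurable borel" and even: "\<And>y. g (- y) = g y" and s: "s \<ge> 0"
  shows "(\<integral>\<^sup>+y. ennreal (g y) * indicator {y. s \<le> \<bar>y\<bar>} y \<partial>lborel) = (\<integral>\<^sup>+y. ennreal (g (\<bar>y\<bar> + s)) \<partial>lborel)"
proof -
  have "(\<integral>\<^sup>+y. ennreal (g (\<bar>y\<bar> + s)) \<partial>lborel)
    = (\<integral>\<^sup>+y. ennreal (g (y + s)) * indicator {0..} y + ennreal (g (y - s)) * indicator {..<0} y \<partial>lborel)"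
  proof (intro nn_integral_cong)
    fix y
    have "g (- y + s) = g (y - s)" using even[of "y - s"] by simp
    then show "ennreal (g (\<bar>y\<bar> + s)) = ennreal (g (y + s)) * indicator {0..} y + ennreal (g (y - s)) * indicator {..<0} y"
      by (cases "y < 0") simp_all
  qed
  also have "\<dots> = (\<integral>\<^sup>+y. ennreal (g (y + s)) * indicator {0..} y \<partial>lborel) + (\<integral>\<^sup>+y. ennreal (g (y - s)) * indicator {..<0} y \<partial>lborel)"
    by (rule nn_integral_add) auto
  also have "(\<integral>\<^sup>+y. ennreal (g (y + s)) * indicator {0..} y \<partial>lborel) = (\<integral>\<^sup>+y. ennreal (g y) * indicator {s..} y \<partial>lborel)"
  proof -
    have "(\<integral>\<^sup>+y. ennreal (g y) * indicator {s..} y \<partial>lborel) = (\<integral>\<^sup>+y. ennreal (g (s + y)) * indicator {s..} (s + y) \<partial>lborel)"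
      using nn_integral_real_affine[of "\<lambda>y. ennreal (g y) * indicator {s..} y" 1 s] by simp
    moreover have "indicator {s..} (s + y) = (indicator {0..} y :: ennreal)" for y by (simp add: indicator_def)
    ultimately show ?thesis by (simp add: add.commute)
  qed
  also have "(\<integral>\<^sup>+y. ennreal (g (y - s)) * indicator {..<0} y \<partial>lborel) = (\<integral>\<^sup>+y. ennreal (g y) * indicator {..<- s} y \<partial>lborel)"
  proof -
    have "(\<integral>\<^sup>+y. ennreal (g y) * indicator {..<- s} y \<partial>lborel) = (\<integral>\<^sup>+y. ennreal (g (- s + y)) * indicator {..<- s} (- s + y) \<partial>lborel)"
      using nn_integral_real_affine[of "\<lambda>y. ennreal (g y) * indicator {..<- s} y" 1 "- s"] by simp
    moreover have "indicator {..<- s} (- s + y) = (indicator {..<0} y :: ennreal)" for y by (simp add: indicator_def)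
    ultimately show ?thesis by simp
  qed
  also have "(\<integral>\<^sup>+y. ennreal (g y) * indicator {s..} y \<partial>lborel) + (\<integral>\<^sup>+y. ennreal (g y) * indicator {..<- s} y \<partial>lborel)
    = (\<integral>\<^sup>+y. ennreal (g y) * indicator {s..} y + ennreal (g y) * indicator {..<- s} y \<partial>lborel)"
    by (rule nn_integral_add[symmetric]) auto
  also have "\<dots> = (\<integral>\<^sup>+y. ennreal (g y) * indicator {y. s \<le> \<bar>y\<bar>} y \<partial>lborel)"
  proof (rule nn_integral_cong_AE)
    have *: "ennreal (g y) * indicator {s..} y + ennreal (g y) * indicator {..<- s} y
      = ennreal (g y) * indicator {y. s \<le> \<bar>y\<bar>} y" if "y \<noteq> - s" for y
    proof -
      have "\<not> y < - s \<and> s \<le> \<bar>y\<bar>" if "s \<le> y" using s that by linarith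
      moreover have "s \<le> \<bar>y\<bar>" if "y < - s" using that by linarith
      moreover have "\<not> s \<le> \<bar>y\<bar>" if "\<not> s \<le> y" "\<not> y < - s" using that \<open>y \<noteq> - s\<close> by linarith
      ultimately show ?thesis by (cases "s \<le> y"; cases "y < - s") simp_all
    qed
    show "AE y in lborel. ennreal (g y) * indicator {s..} y + ennreal (g y) * indicator {..<- s} y
      = ennreal (g y) * indicator {y. s \<le> \<bar>y\<bar>} y"
      using AE_lborel_singleton[of "- s"] by eventually_elim (rule *)
  qed
  finally show ?thesis ..
qed

text \<open>Integrating out all coordinates but the \<open>i\<close>-th gives an even log-concave density \<open>g\<close> on the line. For
\<open>s\<close>, \<open>t\<close> and their combination, the tail integrals of \<open>g\<close> are integrals of the even functions \<open>g (\<bar>y\<bar> + s)\<close> and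
so on, to which the Prekopa-Leindler inequality applies once more.\<close>

lemma coord_log_concave_tail_box:
  fixes F :: "('i::finite \<Rightarrow> real) \<Rightarrow> real" and i :: 'i
  assumes F: "coord_log_concave F" and meas[measurable]: "F \<in> borel_measurable (lborel_fun UNIV)"
    and C: "\<And>x. F x \<le> C" and L: "\<And>x j. F x \<noteq> 0 \<Longrightarrow> \<bar>x j\<bar> \<le> L" "L \<ge> 0"
  defines "T \<equiv> \<lambda>s. \<integral>\<^sup>+x. ennreal (F x) * indicator {x. s \<le> \<bar>x i\<bar>} x \<partial>lborel_fun UNIV"
  assumes uv: "0 < u" "0 < v" "u + v = 1" and st: "0 \<le> s" "0 \<le> t"
  shows "ennreal (enn2real (T s) powr u * enn2real (T t) powr v) \<le> T (u * s + v * t)"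
proof -
  interpret product_sigma_finite "\<lambda>_. lborel :: real measure" by standard
  let ?K = "UNIV - {i}"
  have ins: "insert i ?K = UNIV" by auto
  obtain G D where G: "coord_log_concave G" "G \<in> borel_measurable (lborel_fun UNIV)" "\<And>x. G x \<le> D"
    "\<And>x j. G x \<noteq> 0 \<Longrightarrow> \<bar>x j\<bar> \<le> L \<or> j \<notin> UNIV - ?K"
    "\<And>z. (\<integral>\<^sup>+y. ennreal (F (override_on z y ?K)) \<partial>lborel_fun ?K) = ennreal (G z)"
  proof -
    have "\<exists>G D. coord_log_concave G \<and> G \<in> borel_measurable (lborel_fun UNIV) \<and> (\<forall>x. G x \<le> D)
      \<and> (\<forall>x j. G x \<noteq> 0 \<longrightarrow> \<bar>x j\<bar> \<le> L \<or> j \<notin> UNIV - ?K)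
      \<and> (\<forall>z. (\<integral>\<^sup>+y. ennreal (F (override_on z y ?K)) \<partial>lborel_fun ?K) = ennreal (G z))"
      by (rule coord_log_concave_integrate_out[OF _ F meas C]) (use L in auto)
    then show ?thesis by (elim exE conjE) (rule that, assumption, assumption, erule spec, blast, erule spec)
  qed
  define g where "g y = G ((\<lambda>_. 0)(i := y))" for y
  have [measurable]: "g \<in> borel_measurable borel"
    unfolding g_def by (rule measurable_fun_upd_section[OF G(2)])
  have g_even: "g (- y) = g y" for y by (simp add: g_def coord_log_concave_even[OF G(1)])
  have g_mono: "g y \<le> g x" if "0 \<le> x" "x \<le> y" for x y
    unfolding g_def by (rule coord_log_concave_antimono[OF G(1) that])
  have g_nn: "g y \<ge> 0" for y by (simp add: g_def coord_log_concaveD(1)[OF G(1)])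
  have g_lc: "g x powr u * g y powr v \<le> g (u * x + v * y)" for x y
  proof -
    have "(\<lambda>j. u * ((\<lambda>_. 0)(i := x)) j + v * ((\<lambda>_. 0)(i := y)) j) = (\<lambda>_. 0)(i := u * x + v * y)" by auto
    then show ?thesis using coord_log_concaveD(3)[OF G(1) uv, of "(\<lambda>_. 0)(i := x)" "(\<lambda>_. 0)(i := y)"]
      by (simp add: g_def)
  qed
  have g_supp: "\<bar>y\<bar> \<le> L" if "g y \<noteq> 0" for y
    using G(4)[of "(\<lambda>_. 0)(i := y)" i] that by (simp add: g_def)
  have T: "T s = (\<integral>\<^sup>+y. ennreal (g (\<bar>y\<bar> + s)) \<partial>lborel)" if s: "s \<ge> 0" for s
  proof -
    have "T s = (\<integral>\<^sup>+x. ennreal (F x) * indicator {x. s \<le> \<bar>x i\<bar>} x \<partial>lborel_fun (insert i ?K))"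
      unfolding ins by (simp add: T_def)
    also have "\<dots> = (\<integral>\<^sup>+y. (\<integral>\<^sup>+x. ennreal (F (x(i := y))) * indicator {x. s \<le> \<bar>x i\<bar>} (x(i := y)) \<partial>lborel_fun ?K) \<partial>lborel)"
    proof (rule product_nn_integral_insert_rev)
      have [measurable]: "F \<in> borel_measurable (lborel_fun (insert i ?K))" unfolding ins by (rule meas)
      show "(\<lambda>x. ennreal (F x) * indicator {x. s \<le> \<bar>x i\<bar>} x) \<in> borel_measurable (lborel_fun (insert i ?K))"
        by measurable
    qed auto
    also have "\<dots> = (\<integral>\<^sup>+y. ennreal (g y) * indicator {y. s \<le> \<bar>y\<bar>} y \<partial>lborel)"
    proof (intro nn_integral_cong)
      fix y
      have eq: "override_on ((\<lambda>_. 0)(i := y)) x ?K = x(i := y)" for x :: "'i \<Rightarrow> real"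
        by (auto simp: override_on_def fun_eq_iff)
      have "(\<integral>\<^sup>+x. ennreal (F (x(i := y))) * indicator {x. s \<le> \<bar>x i\<bar>} (x(i := y)) \<partial>lborel_fun ?K)
        = (\<integral>\<^sup>+x. ennreal (F (override_on ((\<lambda>_. 0)(i := y)) x ?K)) \<partial>lborel_fun ?K) * indicator {y. s \<le> \<bar>y\<bar>} y"
        unfolding eq by (auto simp: indicator_def)
      then show "(\<integral>\<^sup>+x. ennreal (F (x(i := y))) * indicator {x. s \<le> \<bar>x i\<bar>} (x(i := y)) \<partial>lborel_fun ?K)
        = ennreal (g y) * indicator {y. s \<le> \<bar>y\<bar>} y"
        unfolding G(5) g_def .
    qed
    also have "\<dots> = (\<integral>\<^sup>+y. ennreal (g (\<bar>y\<bar> + s)) \<partial>lborel)"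
      by (rule nn_integral_even_tail) (use s g_even in auto)
    finally show ?thesis .
  qed
  have fin: "T s = ennreal (enn2real (T s))" if s: "s \<ge> 0" for s
  proof -
    have "T s \<le> (\<integral>\<^sup>+y. ennreal (g 0) * indicator {-L..L} y \<partial>lborel)"
      unfolding T[OF s]
    proof (intro nn_integral_mono)
      fix y
      show "ennreal (g (\<bar>y\<bar> + s)) \<le> ennreal (g 0) * indicator {-L..L} y"
        using g_mono[of 0 "\<bar>y\<bar> + s"] g_supp[of "\<bar>y\<bar> + s"] s
        by (cases "g (\<bar>y\<bar> + s) = 0") (auto simp: indicator_def ennreal_leI)
    qed
    also have "\<dots> < \<infinity>" using L(2) by (simp add: nn_integral_cmult ennreal_mult_less_top)
    finally show ?thesis by (intro ennreal_enn2real[symmetric]) simp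
  qed
  have "ennreal (enn2real (T s) powr u * enn2real (T t) powr v) \<le> (\<integral>\<^sup>+y. ennreal (g (\<bar>y\<bar> + (u * s + v * t))) \<partial>lborel)"
  proof (rule prekopa_leindler_even[where f="\<lambda>y. g (\<bar>y\<bar> + s)" and g="\<lambda>y. g (\<bar>y\<bar> + t)"])
    fix x y :: real assume "0 \<le> x" "0 \<le> y"
    then show "g (\<bar>x\<bar> + s) powr u * g (\<bar>y\<bar> + t) powr v \<le> g (\<bar>u * x + v * y\<bar> + (u * s + v * t))"
      using g_lc[of "x + s" "y + t"] uv by (simp add: algebra_simps)
  next
    show "(\<integral>\<^sup>+x. ennreal (g (\<bar>x\<bar> + s)) \<partial>lborel) = ennreal (enn2real (T s))"
      "(\<integral>\<^sup>+x. ennreal (g (\<bar>x\<bar> + t)) \<partial>lborel) = ennreal (enn2real (T t))"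
      using fin st T by auto
  qed (use uv st g_nn g_mono in auto)
  then show ?thesis using T[of "u * s + v * t"] uv st by simp
qed

section \<open>Symmetrization of the density\<close>

text \<open>Set the coordinates to zero one after another.\<close>

lemma coord_log_concave_le_at_0:
  fixes F :: "('i::finite \<Rightarrow> real) \<Rightarrow> real"
  assumes F: "coord_log_concave F"
  shows "F x \<le> F (\<lambda>_. 0)"
proof -
  have "F x \<le> F (\<lambda>i. if i \<in> K then 0 else x i)" if "finite K" for K
    using that
  proof (induction K)
    case (insert i K)
    define z where "z = (\<lambda>j. if j \<in> K then 0 else x j)"
    have "F z = F (z(i := z i))" by simp
    also have "\<dots> = F (z(i := \<bar>z i\<bar>))" by (rule coord_log_concave_even(2)[OF F, symmetric])
    also have "\<dots> \<le> F (z(i := 0))" by (rule coord_log_concave_antimono[OF F]) auto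
    also have "z(i := 0) = (\<lambda>j. if j \<in> insert i K then 0 else x j)" by (auto simp: z_def)
    finally show ?case using insert.IH by (simp add: z_def)
  qed simp
  from this[of UNIV] show ?thesis by simp
qed

lemma borel_measurable_vec_lambda:
  fixes f :: "'n::finite \<Rightarrow> 'a \<Rightarrow> real"
  assumes "\<And>i. f i \<in> borel_measurable M"
  shows "(\<lambda>x. \<chi> i. f i x) \<in> borel_measurable M"
  by (subst borel_measurable_euclidean_space) (auto simp: Basis_vec_def inner_axis assms)

lemma distr_vec_lborel:
  "distr (lborel_fun (UNIV :: 'n::finite set)) borel (\<lambda>x. \<chi> i. x i) = (lborel :: (real ^ 'n) measure)"
proof (rule lborel_eqI[symmetric])
  interpret product_sigma_finite "\<lambda>_. lborel :: real measure" by standard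
  have [measurable]: "(\<lambda>x. \<chi> i. x i) \<in> lborel_fun (UNIV :: 'n set) \<rightarrow>\<^sub>M borel"
    by (rule borel_measurable_vec_lambda) simp
  fix l u :: "real ^ 'n" assume le: "\<And>b. b \<in> Basis \<Longrightarrow> l \<bullet> b \<le> u \<bullet> b"
  have lu: "l $ i \<le> u $ i" for i using le[of "axis i 1"] by (simp add: inner_axis)
  have "emeasure (distr (lborel_fun UNIV) borel (\<lambda>x. \<chi> i. x i)) (box l u)
    = emeasure (lborel_fun UNIV) (PiE UNIV (\<lambda>i. {l $ i <..< u $ i}))"
    by (subst emeasure_distr) (auto intro!: arg_cong2[where f=emeasure] simp: mem_box_cart space_PiM PiE_iff)
  also have "\<dots> = (\<Prod>i\<in>UNIV. emeasure lborel {l $ i <..< u $ i})"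
    by (rule emeasure_PiM) auto
  also have "\<dots> = ennreal (\<Prod>i\<in>UNIV. u $ i - l $ i)"
    using lu by (simp add: prod_ennreal)
  also have "(\<Prod>i\<in>UNIV. u $ i - l $ i) = (\<Prod>b\<in>Basis. (u - l) \<bullet> b)"
  proof -
    have B: "(Basis :: (real ^ 'n) set) = (\<lambda>i. axis i 1) ` UNIV" by (auto simp: Basis_vec_def)
    have inj: "inj (\<lambda>i :: 'n. axis i (1 :: real))" by (auto simp: inj_on_def axis_eq_axis)
    show ?thesis unfolding B by (subst prod.reindex[OF inj]) (simp add: inner_axis)
  qed
  finally show "emeasure (distr (lborel_fun UNIV) borel (\<lambda>x. \<chi> i. x i)) (box l u) = ennreal (\<Prod>b\<in>Basis. (u - l) \<bullet> b)" .
qed simp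

definition flip_signs :: "('n \<Rightarrow> real) \<Rightarrow> real ^ 'n \<Rightarrow> real ^ 'n" where
  "flip_signs \<eta> x = (\<chi> i. \<eta> i * x $ i)"

lemma measurable_flip_signs[measurable]: "flip_signs \<eta> \<in> borel_measurable borel"
  unfolding flip_signs_def[abs_def] by (intro borel_measurable_vec_lambda) simp

lemma flip_signs_flip_signs:
  assumes "\<And>i. \<eta> i \<in> {-1, 1}"
  shows "flip_signs \<eta> (flip_signs \<eta> x) = x"
proof -
  have "\<eta> i * \<eta> i = 1" for i using assms[of i] by auto
  then show ?thesis by (simp add: flip_signs_def vec_eq_iff flip: mult.assoc)
qed

lemma distr_flip_signs_lborel:
  fixes \<eta> :: "'n::finite \<Rightarrow> real"
  assumes \<eta>: "\<And>i. \<eta> i \<in> {-1, 1}"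
  shows "distr lborel borel (flip_signs \<eta>) = lborel"
proof -
  let ?c = "\<lambda>j :: real ^ 'n. (\<chi> i. \<eta> i) \<bullet> j"
  have T: "0 + (\<Sum>j\<in>Basis. (?c j * (x \<bullet> j)) *\<^sub>R j) = flip_signs \<eta> x" for x
  proof (subst vec_eq_iff, intro allI)
    fix i
    have "(0 + (\<Sum>j\<in>Basis. (?c j * (x \<bullet> j)) *\<^sub>R j)) $ i = (\<Sum>j\<in>Basis. (?c j * (x \<bullet> j)) *\<^sub>R j) \<bullet> axis i 1"
      by (simp add: inner_axis)
    also have "\<dots> = flip_signs \<eta> x $ i"
      by (subst inner_sum_left_Basis) (simp_all add: inner_axis flip_signs_def)
    finally show "(0 + (\<Sum>j\<in>Basis. (?c j * (x \<bullet> j)) *\<^sub>R j)) $ i = flip_signs \<eta> x $ i" .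
  qed
  have c: "\<bar>?c j\<bar> = 1" if "j \<in> Basis" for j
  proof -
    obtain i where "j = axis i 1" using \<open>j \<in> Basis\<close> by (auto simp: Basis_vec_def)
    then show ?thesis using \<eta>[of i] by (auto simp: inner_axis)
  qed
  have "lborel = density (distr lborel borel (\<lambda>x. 0 + (\<Sum>j\<in>Basis. (?c j * (x \<bullet> j)) *\<^sub>R j))) (\<lambda>_. ennreal (\<Prod>j\<in>Basis. \<bar>?c j\<bar>))"
    by (rule lborel_affine_euclidean) (use c in force)
  also have "\<dots> = density (distr lborel borel (flip_signs \<eta>)) (\<lambda>_. 1)"
    unfolding T by (simp add: c)
  also have "\<dots> = distr lborel borel (flip_signs \<eta>)" by (rule density_1)
  finally show ?thesis ..
qed

text \<open>The invariance is only almost sure: a log-concave density may be asymmetric on the boundary of its support.\<close>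

lemma density_flip_signs:
  fixes X :: "'a \<Rightarrow> real ^ 'n" and \<phi> :: "real ^ 'n \<Rightarrow> ennreal"
  assumes "unconditional M X" and D: "distributed M lborel X \<phi>" and \<eta>: "\<And>i. \<eta> i \<in> {-1, 1}"
  shows "AE x in lborel. \<phi> (flip_signs \<eta> x) = \<phi> x"
proof (rule sigma_finite_measure.density_unique[OF sigma_finite_lborel])
  let ?T = "flip_signs \<eta>"
  have [measurable]: "\<phi> \<in> borel_measurable borel" using distributed_borel_measurable[OF D] by simp
  have [measurable]: "X \<in> M \<rightarrow>\<^sub>M borel" using distributed_measurable[OF D] by simp
  show "\<phi> \<in> borel_measurable lborel" "(\<lambda>x. \<phi> (?T x)) \<in> borel_measurable lborel" by simp_all
  have law: "distr M borel X = density lborel \<phi>"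
  proof -
    have "distr M borel X = distr M lborel X" by (rule distr_cong) simp_all
    then show ?thesis using distributed_distr_eq_density[OF D] by simp
  qed
  show "density lborel (\<lambda>x. \<phi> (?T x)) = density lborel \<phi>"
  proof (rule measure_eqI)
    fix A assume "A \<in> sets (density lborel (\<lambda>x. \<phi> (?T x)))"
    then have A[measurable]: "A \<in> sets borel" by simp
    have "emeasure (density lborel (\<lambda>x. \<phi> (?T x))) A = (\<integral>\<^sup>+x. \<phi> (?T x) * indicator A (?T (?T x)) \<partial>lborel)"
      by (simp add: emeasure_density flip_signs_flip_signs[OF \<eta>])
    also have "\<dots> = (\<integral>\<^sup>+x. \<phi> x * indicator A (?T x) \<partial>distr lborel borel ?T)"
      by (subst nn_integral_distr) auto
    also have "\<dots> = (\<integral>\<^sup>+x. \<phi> x * indicator (?T -` A) x \<partial>lborel)"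
      unfolding distr_flip_signs_lborel[OF \<eta>] by (simp add: indicator_vimage)
    also have "\<dots> = emeasure (distr M borel X) (?T -` A)"
      unfolding law by (subst emeasure_density) (auto intro: measurable_sets_borel[OF measurable_flip_signs A])
    also have "\<dots> = emeasure (distr M borel (\<lambda>\<omega>. ?T (X \<omega>))) A"
      by (subst (1 2) emeasure_distr) (auto intro: measurable_sets_borel[OF measurable_flip_signs A] intro!: arg_cong2[where f=emeasure])
    also have "distr M borel (\<lambda>\<omega>. ?T (X \<omega>)) = distr M borel X"
      using assms(1) \<eta> by (simp add: unconditional_def flip_signs_def)
    finally show "emeasure (density lborel (\<lambda>x. \<phi> (?T x))) A = emeasure (density lborel \<phi>) A"
      unfolding law .
  qed simp
qed

lemma exp_minus_log_concave:
  fixes h :: "'v::real_vector \<Rightarrow> ereal"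
  assumes h: "convex_extended h" and uv: "0 < u" "0 < v" "u + v = 1"
  shows "enn2real (exp_minus (h x)) powr u * enn2real (exp_minus (h y)) powr v \<le> enn2real (exp_minus (h (u *\<^sub>R x + v *\<^sub>R y)))"
proof (cases "h x = \<infinity> \<or> h y = \<infinity>")
  case True
  then show ?thesis by (auto simp: exp_minus_def)
next
  case False
  have nm: "h z \<noteq> -\<infinity>" for z using h by (simp add: convex_extended_def)
  obtain a b where ab: "h x = ereal a" "h y = ereal b"
    using False nm[of x] nm[of y] by (cases "h x"; cases "h y") auto
  have "h (u *\<^sub>R x + v *\<^sub>R y) \<le> ereal u * h x + ereal v * h y"
    using h uv unfolding convex_extended_def by (metis less_imp_le)
  then have le: "h (u *\<^sub>R x + v *\<^sub>R y) \<le> ereal (u * a + v * b)" by (simp add: ab)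
  then obtain c where c: "h (u *\<^sub>R x + v *\<^sub>R y) = ereal c"
    using nm[of "u *\<^sub>R x + v *\<^sub>R y"] by (cases "h (u *\<^sub>R x + v *\<^sub>R y)") auto
  have "exp (- a) powr u * exp (- b) powr v = exp (- (u * a + v * b))"
    by (simp add: powr_def exp_add[symmetric] algebra_simps)
  also have "\<dots> \<le> exp (- c)" using le c by simp
  finally show ?thesis by (simp add: ab c exp_minus_def)
qed

text \<open>The geometric mean over all sign changes. It makes an almost surely unconditional density even at every point, and
it preserves log-concavity because only products and powers occur.\<close>

definition symmetrization :: "(real ^ 'n \<Rightarrow> real) \<Rightarrow> ('n \<Rightarrow> real) \<Rightarrow> real" where
  "symmetrization f x = (\<Prod>\<eta>\<in>UNIV \<rightarrow>\<^sub>E {-1, 1}. f (\<chi> i. \<eta> i * x i) powr (1 / 2 ^ CARD('n)))"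

lemma prod_flip_sign:
  assumes i: "i \<in> I"
  shows "(\<Prod>\<eta>\<in>I \<rightarrow>\<^sub>E {-1, 1 :: real}. g (\<eta>(i := - \<eta> i))) = (\<Prod>\<eta>\<in>I \<rightarrow>\<^sub>E {-1, 1}. g \<eta>)"
proof (rule prod.reindex_bij_witness[where i="\<lambda>\<eta>. \<eta>(i := - \<eta> i)" and j="\<lambda>\<eta>. \<eta>(i := - \<eta> i)"])
  fix \<eta> :: "_ \<Rightarrow> real" assume "\<eta> \<in> I \<rightarrow>\<^sub>E {-1, 1}"
  with i show "\<eta>(i := - \<eta> i) \<in> I \<rightarrow>\<^sub>E {-1, 1}"
    by (fastforce simp: PiE_iff extensional_def)
qed (use i in \<open>auto simp: PiE_iff extensional_def\<close>)

lemma coord_log_concave_symmetrization: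
  fixes f :: "real ^ 'n \<Rightarrow> real"
  assumes nn: "\<And>x. 0 \<le> f x"
    and lc: "\<And>x y u v. 0 < u \<Longrightarrow> 0 < v \<Longrightarrow> u + v = 1 \<Longrightarrow> f x powr u * f y powr v \<le> f (u *\<^sub>R x + v *\<^sub>R y)"
  shows "coord_log_concave (symmetrization f)"
  unfolding coord_log_concave_def
proof (intro conjI allI impI)
  let ?c = "1 / 2 ^ CARD('n) :: real"
  let ?E = "UNIV \<rightarrow>\<^sub>E {-1, 1 :: real} :: ('n \<Rightarrow> real) set"
  show "0 \<le> symmetrization f x" for x unfolding symmetrization_def by (intro prod_nonneg) simp
  show "symmetrization f (x(i := - x i)) = symmetrization f x" for x i
  proof -
    have "(\<chi> j. \<eta> j * (x(i := - x i)) j) = (\<chi> j. (\<eta>(i := - \<eta> i)) j * x j)" for \<eta> :: "'n \<Rightarrow> real"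
      by (simp add: vec_eq_iff)
    then have "symmetrization f (x(i := - x i)) = (\<Prod>\<eta>\<in>?E. f (\<chi> j. (\<eta>(i := - \<eta> i)) j * x j) powr ?c)"
      unfolding symmetrization_def by simp
    also have "\<dots> = symmetrization f x"
      unfolding symmetrization_def by (rule prod_flip_sign) simp
    finally show ?thesis .
  qed
  fix x y :: "'n \<Rightarrow> real" and u v :: real
  assume uv: "0 < u" "0 < v" "u + v = 1"
  let ?x = "\<lambda>\<eta>. \<chi> i. \<eta> i * x i"
  let ?y = "\<lambda>\<eta>. \<chi> i. \<eta> i * y i"
  have "symmetrization f x powr u * symmetrization f y powr v
    = (\<Prod>\<eta>\<in>?E. (f (?x \<eta>) powr u * f (?y \<eta>) powr v) powr ?c)"
    unfolding symmetrization_def prod_powr_distrib prod.distrib[symmetric]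
    by (simp add: powr_mult nn powr_powr mult.commute)
  also have "\<dots> \<le> (\<Prod>\<eta>\<in>?E. f (u *\<^sub>R ?x \<eta> + v *\<^sub>R ?y \<eta>) powr ?c)"
    by (intro prod_mono conjI powr_mono2 lc uv) (auto simp: nn)
  also have "\<dots> = symmetrization f (\<lambda>i. u * x i + v * y i)"
    unfolding symmetrization_def
    by (intro prod.cong refl arg_cong2[where f="(powr)"] arg_cong[where f=f]) (simp add: vec_eq_iff algebra_simps)
  finally show "symmetrization f x powr u * symmetrization f y powr v \<le> symmetrization f (\<lambda>i. u * x i + v * y i)" .
qed

lemma measurable_symmetrization:
  fixes f :: "real ^ 'n \<Rightarrow> real"
  assumes [measurable]: "f \<in> borel_measurable borel"
  shows "symmetrization f \<in> borel_measurable (lborel_fun UNIV)"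
proof -
  have [measurable]: "(\<lambda>x. \<chi> i. \<eta> i * x i) \<in> lborel_fun (UNIV :: 'n set) \<rightarrow>\<^sub>M borel" for \<eta>
    by (rule borel_measurable_vec_lambda) simp
  show ?thesis unfolding symmetrization_def[abs_def] by measurable
qed

lemma symmetrization_eq:
  fixes f :: "real ^ 'n \<Rightarrow> real"
  assumes nn: "0 \<le> f x" and inv: "\<And>\<eta>. (\<forall>i. \<eta> i \<in> {-1, 1}) \<Longrightarrow> f (flip_signs \<eta> x) = f x"
  shows "symmetrization f (\<lambda>i. x $ i) = f x"
proof -
  let ?E = "UNIV \<rightarrow>\<^sub>E {-1, 1 :: real} :: ('n \<Rightarrow> real) set"
  have "symmetrization f (\<lambda>i. x $ i) = (\<Prod>\<eta>\<in>?E. f x powr (1 / 2 ^ CARD('n)))"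
    unfolding symmetrization_def
  proof (intro prod.cong refl)
    fix \<eta> :: "'n \<Rightarrow> real" assume "\<eta> \<in> ?E"
    then have "\<forall>i. \<eta> i \<in> {-1, 1}" by (auto simp: PiE_iff)
    from inv[OF this] show "f (\<chi> i. \<eta> i * x $ i) powr (1 / 2 ^ CARD('n)) = f x powr (1 / 2 ^ CARD('n))"
      by (simp add: flip_signs_def)
  qed
  also have "\<dots> = f x"
  proof (cases "f x = 0")
    case False
    then have "(f x powr (1 / 2 ^ CARD('n))) ^ 2 ^ CARD('n) = (f x powr (1 / 2 ^ CARD('n))) powr real (2 ^ CARD('n))"
      using nn by (subst powr_realpow) auto
    then show ?thesis using nn by (simp add: card_sign_vectors powr_powr)
  qed (simp add: card_sign_vectors)
  finally show ?thesis .
qed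

section \<open>Log-concave tails of the coordinates\<close>

text \<open>The symmetrized density is restricted to the boxes \<open>\<bar>x\<^sub>j\<bar> \<le> L\<close>, which keeps it log-concave and even and
makes all marginals finite; then \<open>L\<close> tends to infinity.\<close>

lemma coordinate_tail_log_concave:
  fixes X :: "'a \<Rightarrow> real ^ 'n" and i :: 'n
  assumes M: "prob_space M" and uncond: "unconditional M X" and lc: "log_concave M X"
    and uv: "0 < u" "0 < v" "u + v = 1" and st: "0 \<le> s" "0 \<le> t"
  defines "N \<equiv> \<lambda>t. measure M {\<omega> \<in> space M. t \<le> \<bar>X \<omega> $ i\<bar>}"
  shows "N s powr u * N t powr v \<le> N (u * s + v * t)"
proof -
  interpret prob_space M by (rule M)
  obtain h where h: "convex_extended h" and D: "distributed M lborel X (\<lambda>x. exp_minus (h x))"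
    using lc by (auto simp: log_concave_def)
  define \<phi> where "\<phi> x = exp_minus (h x)" for x
  note D = D[folded \<phi>_def]
  have [measurable]: "\<phi> \<in> borel_measurable borel" using distributed_borel_measurable[OF D] by simp
  define f where "f x = enn2real (\<phi> x)" for x
  have [measurable]: "f \<in> borel_measurable borel" unfolding f_def by measurable
  have \<phi>f: "\<phi> x = ennreal (f x)" for x
    by (simp add: f_def \<phi>_def exp_minus_def)
  define F where "F = symmetrization f"
  have F: "coord_log_concave F"
    unfolding F_def
    by (rule coord_log_concave_symmetrization)
       (simp_all add: f_def \<phi>_def exp_minus_log_concave[OF h])
  have F_meas[measurable]: "F \<in> borel_measurable (lborel_fun UNIV)"
    unfolding F_def by (rule measurable_symmetrization) simp
  have Ff: "AE x in lborel. F (\<lambda>i. x $ i) = f x"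
  proof -
    have "AE x in lborel. \<forall>\<eta>\<in>{\<eta>. \<forall>i. \<eta> i \<in> {-1, 1}}. \<phi> (flip_signs \<eta> x) = \<phi> x"
    proof (rule AE_finite_allI)
      have "{\<eta>. \<forall>i. \<eta> i \<in> {-1, 1}} = (UNIV \<rightarrow>\<^sub>E {-1, 1} :: ('n \<Rightarrow> real) set)" by (auto simp: PiE_iff)
      then show "finite {\<eta> :: 'n \<Rightarrow> real. \<forall>i. \<eta> i \<in> {-1, 1}}" by (simp add: finite_sign_vectors)
    qed (rule density_flip_signs[OF uncond D], auto)
    then show ?thesis
    proof eventually_elim
      case (elim x)
      then show ?case unfolding F_def by (intro symmetrization_eq) (auto simp: f_def)
    qed
  qed
  define T where "T L s = (\<integral>\<^sup>+x. ennreal (F x * (if \<forall>j. \<bar>x j\<bar> \<le> real L then 1 else 0)) * indicator {x. s \<le> \<bar>x i\<bar>} x \<partial>lborel_fun UNIV)" for L s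
  have N: "ennreal (N s) = (\<integral>\<^sup>+x. ennreal (F x) * indicator {x. s \<le> \<bar>x i\<bar>} x \<partial>lborel_fun UNIV)" for s
  proof -
    have [measurable]: "(\<lambda>x. \<chi> i. x i) \<in> lborel_fun (UNIV :: 'n set) \<rightarrow>\<^sub>M borel"
      by (rule borel_measurable_vec_lambda) simp
    have [measurable]: "X \<in> M \<rightarrow>\<^sub>M borel" using distributed_measurable[OF D] by simp
    have Fv[measurable]: "(\<lambda>x :: real ^ 'n. F (\<lambda>i. x $ i)) \<in> borel_measurable borel"
    proof -
      have "(\<lambda>x :: real ^ 'n. \<lambda>i. x $ i) \<in> borel \<rightarrow>\<^sub>M lborel_fun UNIV"
        by (rule measurable_PiM_single') auto
      from measurable_compose[OF this F_meas] show ?thesis .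
    qed
    have "ennreal (N s) = emeasure M (X -` {x. s \<le> \<bar>x $ i\<bar>} \<inter> space M)"
      unfolding N_def emeasure_eq_measure by (intro arg_cong[where f="\<lambda>A. ennreal (measure M A)"]) auto
    also have "\<dots> = (\<integral>\<^sup>+x. \<phi> x * indicator {x. s \<le> \<bar>x $ i\<bar>} x \<partial>lborel)"
      by (rule distributed_emeasure[OF D]) simp
    also have "\<dots> = (\<integral>\<^sup>+x. ennreal (F (\<lambda>i. x $ i)) * indicator {x. s \<le> \<bar>x $ i\<bar>} x \<partial>lborel)"
      by (rule nn_integral_cong_AE) (use Ff in eventually_elim, simp add: \<phi>f)
    also have "\<dots> = (\<integral>\<^sup>+x. ennreal (F x) * indicator {x. s \<le> \<bar>x i\<bar>} x \<partial>lborel_fun UNIV)"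
    proof -
      have [simp]: "($) (vec_lambda x) = x" for x :: "'n \<Rightarrow> real" by (simp add: fun_eq_iff)
      show ?thesis
        by (subst distr_vec_lborel[symmetric], subst nn_integral_distr) (auto simp: indicator_def)
    qed
    finally show ?thesis .
  qed
  have T_le: "T L s \<le> ennreal (N s)" for L s
    unfolding T_def N by (intro nn_integral_mono mult_right_mono ennreal_leI) (auto simp: coord_log_concaveD(1)[OF F])
  have T_lim: "(\<lambda>L. enn2real (T L s)) \<longlonglongrightarrow> N s" for s
  proof -
    have *: "(\<lambda>L. T L s) \<longlonglongrightarrow> ennreal (N s)"
      unfolding T_def N
    proof (rule nn_integral_LIMSEQ)
      show "incseq (\<lambda>L x. ennreal (F x * (if \<forall>j. \<bar>x j\<bar> \<le> real L then 1 else 0)) * indicator {x. s \<le> \<bar>x i\<bar>} x)"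
      proof (intro incseq_SucI le_funI mult_right_mono ennreal_leI)
        fix L and x :: "'n \<Rightarrow> real"
        have "\<bar>x j\<bar> \<le> real (Suc L)" if "\<forall>j. \<bar>x j\<bar> \<le> real L" for j
          using that[rule_format, of j] by simp
        then show "F x * (if \<forall>j. \<bar>x j\<bar> \<le> real L then 1 else 0) \<le> F x * (if \<forall>j. \<bar>x j\<bar> \<le> real (Suc L) then 1 else 0)"
          using coord_log_concaveD(1)[OF F, of x] by auto
      qed simp
      fix x :: "'n \<Rightarrow> real"
      obtain K :: nat where K: "Max (range (\<lambda>j. \<bar>x j\<bar>)) \<le> real K" using real_arch_simple by blast
      have "\<bar>x j\<bar> \<le> real L" if "K \<le> L" for j L
      proof -
        have "\<bar>x j\<bar> \<le> Max (range (\<lambda>j. \<bar>x j\<bar>))" by (rule Max_ge) auto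
        then show ?thesis using K that by linarith
      qed
      then show "(\<lambda>L. ennreal (F x * (if \<forall>j. \<bar>x j\<bar> \<le> real L then 1 else 0)) * indicator {x. s \<le> \<bar>x i\<bar>} x)
        \<longlonglongrightarrow> ennreal (F x) * indicator {x. s \<le> \<bar>x i\<bar>} x"
        by (intro tendsto_eventually) (auto simp: eventually_sequentially intro!: exI[of _ K])
    qed simp
    show ?thesis by (rule tendsto_enn2real[OF *]) (simp add: N_def)
  qed
  have ineq: "enn2real (T L s) powr u * enn2real (T L t) powr v \<le> N (u * s + v * t)" for L
  proof -
    let ?F = "\<lambda>x. F x * (if \<forall>j. \<bar>x j\<bar> \<le> real L then 1 else 0)"
    have lcF: "coord_log_concave ?F"
      unfolding coord_log_concave_def
    proof (intro conjI allI impI)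
      fix x y :: "'n \<Rightarrow> real" and u v :: real and k
      show "0 \<le> ?F x" using coord_log_concaveD(1)[OF F, of x] by simp
      have "(\<forall>j. \<bar>(x(k := - x k)) j\<bar> \<le> real L) \<longleftrightarrow> (\<forall>j. \<bar>x j\<bar> \<le> real L)" by (auto simp: fun_upd_def)
      then show "?F (x(k := - x k)) = ?F x" using coord_log_concaveD(2)[OF F, of x k] by simp
      assume uv: "0 < u" "0 < v" "u + v = 1"
      have "\<bar>u * x j + v * y j\<bar> \<le> real L" if "\<bar>x j\<bar> \<le> real L" "\<bar>y j\<bar> \<le> real L" for j
      proof -
        have "\<bar>u * x j + v * y j\<bar> \<le> u * \<bar>x j\<bar> + v * \<bar>y j\<bar>"
          using uv by (simp add: abs_mult order_trans[OF abs_triangle_ineq])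
        also have "\<dots> \<le> u * real L + v * real L" using that uv by (intro add_mono mult_left_mono) auto
        also have "\<dots> = real L" using uv by (simp flip: distrib_right)
        finally show ?thesis .
      qed
      then show "?F x powr u * ?F y powr v \<le> ?F (\<lambda>i. u * x i + v * y i)"
        using coord_log_concaveD(3)[OF F uv, of x y] coord_log_concaveD(1)[OF F, of "\<lambda>i. u * x i + v * y i"] uv by auto
    qed
    have "ennreal (enn2real (T L s) powr u * enn2real (T L t) powr v) \<le> T L (u * s + v * t)"
      unfolding T_def
    proof (rule coord_log_concave_tail_box[OF lcF _ _ _ _ uv st])
      show "?F \<in> borel_measurable (lborel_fun UNIV)" by measurable
      show "?F x \<le> F (\<lambda>_. 0)" for x
        using coord_log_concave_le_at_0[OF F, of x] coord_log_concaveD(1)[OF F] by simp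
      show "\<bar>x j\<bar> \<le> real L" if "?F x \<noteq> 0" for x j
        using that by (cases "\<forall>j. \<bar>x j\<bar> \<le> real L") simp_all
    qed simp
    also have "\<dots> \<le> ennreal (N (u * s + v * t))" by (rule T_le)
    finally show ?thesis by (simp add: N_def)
  qed
  have "(\<lambda>L. enn2real (T L s) powr u * enn2real (T L t) powr v) \<longlonglongrightarrow> N s powr u * N t powr v"
    using uv by (intro tendsto_mult tendsto_powr' T_lim tendsto_const) auto
  then show ?thesis by (rule LIMSEQ_le_const2) (use ineq in blast)
qed

section \<open>The fourth moment under a log-concave tail\<close>

lemma nn_integral_power_tail:
  fixes W :: "'a \<Rightarrow> real"
  assumes M: "sigma_finite_measure M" and [measurable]: "W \<in> borel_measurable M" and W: "\<And>\<omega>. W \<omega> \<ge> 0"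
  shows "(\<integral>\<^sup>+\<omega>. ennreal (W \<omega> ^ Suc k) \<partial>M)
    = (\<integral>\<^sup>+t. ennreal (real (Suc k) * t ^ k) * indicator {0..} t * emeasure M {\<omega> \<in> space M. t \<le> W \<omega>} \<partial>lborel)"
proof -
  interpret sigma_finite_measure M by (rule M)
  interpret pair_sigma_finite M lborel ..
  have *: "ennreal (w ^ Suc k) = (\<integral>\<^sup>+t. ennreal (real (Suc k) * t ^ k) * indicator {0..} t * indicator {..w} t \<partial>lborel)"
    if w: "w \<ge> 0" for w :: real
  proof -
    have "(\<integral>\<^sup>+t. ennreal (real (Suc k) * t ^ k) * indicator {0..w} t \<partial>lborel) = ennreal (w ^ Suc k - 0 ^ Suc k)"
    proof (rule nn_integral_FTC_Icc)
      fix t :: real assume t: "t \<in> {0..w}"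
      show "((\<lambda>t. t ^ Suc k) has_real_derivative real (Suc k) * t ^ k) (at t)"
        by (auto intro!: derivative_eq_intros simp del: power_Suc)
      show "0 \<le> real (Suc k) * t ^ k" using t by simp
    qed (use w in auto)
    also have "(\<integral>\<^sup>+t. ennreal (real (Suc k) * t ^ k) * indicator {0..w} t \<partial>lborel)
      = (\<integral>\<^sup>+t. ennreal (real (Suc k) * t ^ k) * indicator {0..} t * indicator {..w} t \<partial>lborel)"
      by (intro nn_integral_cong) (auto simp: indicator_def)
    finally show ?thesis by simp
  qed
  have "(\<integral>\<^sup>+\<omega>. ennreal (W \<omega> ^ Suc k) \<partial>M)
    = (\<integral>\<^sup>+\<omega>. (\<integral>\<^sup>+t. ennreal (real (Suc k) * t ^ k) * indicator {0..} t * indicator {..W \<omega>} t \<partial>lborel) \<partial>M)"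
    by (simp only: *[OF W])
  also have "\<dots> = (\<integral>\<^sup>+t. (\<integral>\<^sup>+\<omega>. ennreal (real (Suc k) * t ^ k) * indicator {0..} t * indicator {..W \<omega>} t \<partial>M) \<partial>lborel)"
    by (rule Fubini'[symmetric]) (simp add: indicator_def)
  also have "\<dots> = (\<integral>\<^sup>+t. ennreal (real (Suc k) * t ^ k) * indicator {0..} t * emeasure M {\<omega> \<in> space M. t \<le> W \<omega>} \<partial>lborel)"
  proof (intro nn_integral_cong)
    fix t
    have "(\<integral>\<^sup>+\<omega>. indicator {..W \<omega>} t \<partial>M) = (\<integral>\<^sup>+\<omega>. indicator {\<omega> \<in> space M. t \<le> W \<omega>} \<omega> \<partial>M)"
      by (intro nn_integral_cong) (auto simp: indicator_def)
    also have "\<dots> = emeasure M {\<omega> \<in> space M. t \<le> W \<omega>}" by simp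
    finally have "(\<integral>\<^sup>+\<omega>. indicator {..W \<omega>} t \<partial>M) = emeasure M {\<omega> \<in> space M. t \<le> W \<omega>}" .
    moreover have "(\<lambda>\<omega>. indicator {..W \<omega>} t :: ennreal) \<in> borel_measurable M"
      by (simp add: indicator_def)
    ultimately show "(\<integral>\<^sup>+\<omega>. ennreal (real (Suc k) * t ^ k) * indicator {0..} t * indicator {..W \<omega>} t \<partial>M)
      = ennreal (real (Suc k) * t ^ k) * indicator {0..} t * emeasure M {\<omega> \<in> space M. t \<le> W \<omega>}"
      by (subst nn_integral_cmult) auto
  qed
  finally show ?thesis .
qed


lemma exponential_power_integral:
  "(\<integral>\<^sup>+t. ennreal (t ^ k * exp (- t)) * indicator {0..} t \<partial>lborel) = ennreal (fact k)"
  using nn_intergal_power_times_exp_Ici[of k] by simp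

text \<open>If \<open>N t1 < exp (- t1)\<close> and \<open>t > t1\<close>, then \<open>N t powr (t1 / t) \<le> N t1\<close> forces \<open>N t < exp (- t)\<close>. So \<open>N\<close> stays below
the exponential once it is below it.\<close>

lemma tail_single_crossing:
  fixes N :: "real \<Rightarrow> real"
  assumes nn: "\<And>t. 0 \<le> N t" and N0: "N 0 = 1"
    and star: "\<And>\<theta> t. 0 < \<theta> \<Longrightarrow> \<theta> < 1 \<Longrightarrow> 0 \<le> t \<Longrightarrow> N t powr \<theta> \<le> N (\<theta> * t)"
  shows "(\<forall>t\<ge>0. exp (- t) \<le> N t) \<or>
    (\<exists>t0\<ge>0. (\<forall>t. 0 \<le> t \<longrightarrow> t < t0 \<longrightarrow> exp (- t) \<le> N t) \<and> (\<forall>t>t0. N t \<le> exp (- t)))"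
proof (cases "\<forall>t\<ge>0. exp (- t) \<le> N t")
  case False
  define S where "S = {t. 0 \<le> t \<and> N t < exp (- t)}"
  obtain t where "0 \<le> t" "N t < exp (- t)" using False by (auto simp: not_le)
  then have S: "S \<noteq> {}" by (auto simp: S_def)
  have bdd: "bdd_below S" by (rule bdd_belowI[of _ 0]) (auto simp: S_def)
  \<comment> \<open>The crossing point; it need not belong to \<open>S\<close>.\<close>
  define t0 where "t0 = Inf S"
  have "t0 \<ge> 0" unfolding t0_def by (rule cInf_greatest[OF S]) (auto simp: S_def)
  moreover have "exp (- t) \<le> N t" if "0 \<le> t" "t < t0" for t
  proof (rule ccontr)
    assume "\<not> exp (- t) \<le> N t"
    then have "t \<in> S" using that by (simp add: S_def)
    then show False using cInf_lower[OF _ bdd, of t] that by (simp add: t0_def)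
  qed
  moreover have "N t \<le> exp (- t)" if "t > t0" for t
  proof -
    obtain t1 where t1: "t1 \<in> S" "t1 < t" using cInf_lessD[OF S, of t] \<open>t > t0\<close> unfolding t0_def by blast
    then have t1': "0 \<le> t1" "N t1 < exp (- t1)" by (auto simp: S_def)
    then have t1p: "t1 > 0" using N0 by (cases "t1 = 0") auto
    have "N t powr (t1 / t) \<le> N (t1 / t * t)" using t1p t1 by (intro star) auto
    then have "N t powr (t1 / t) \<le> exp (- t1)" using t1' t1p t1 by simp
    then have "(N t powr (t1 / t)) powr (t / t1) \<le> exp (- t1) powr (t / t1)"
      using t1p t1 by (intro powr_mono2) auto
    then show ?thesis using t1p t1 nn[of t] by (simp add: powr_powr powr_def[of "exp _"])
  qed
  ultimately show ?thesis by blast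
qed simp

text \<open>The second moment two is that of the standard exponential law. Let the tail \<open>N\<close> cross \<open>exp (- t)\<close> at \<open>t0\<close>. Then
\<open>(t\<^sup>2 - t0\<^sup>2) * t * (N t - exp (- t)) \<le> 0\<close> for almost every \<open>t > 0\<close>, and the integral of
\<open>t * (N t - exp (- t))\<close> vanishes because the second moments agree. So the fourth moment is at most the exponential
one, which is \<open>24\<close>. The crossing also bounds all other moments.\<close>

lemma log_concave_tail_moments:
  fixes W :: "'a \<Rightarrow> real"
  assumes M: "prob_space M" and W_meas[measurable]: "W \<in> borel_measurable M" and W: "\<And>\<omega>. W \<omega> \<ge> 0"
    and star: "\<And>\<theta> t. 0 < \<theta> \<Longrightarrow> \<theta> < 1 \<Longrightarrow> 0 \<le> t \<Longrightarrow>
      measure M {\<omega> \<in> space M. t \<le> W \<omega>} powr \<theta> \<le> measure M {\<omega> \<in> space M. \<theta> * t \<le> W \<omega>}"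
    and W2: "integrable M (\<lambda>\<omega>. (W \<omega>)\<^sup>2)" "(LINT \<omega>|M. (W \<omega>)\<^sup>2) = 2"
  shows "integrable M (\<lambda>\<omega>. W \<omega> ^ Suc k)" and "(LINT \<omega>|M. W \<omega> ^ 4) \<le> 24"
proof -
  interpret prob_space M by (rule M)
  define N where "N t = measure M {\<omega> \<in> space M. t \<le> W \<omega>}" for t
  have N_eq: "emeasure M {\<omega> \<in> space M. t \<le> W \<omega>} = ennreal (N t)" for t
    by (simp add: N_def emeasure_eq_measure)
  have N_meas[measurable]: "N \<in> borel_measurable borel"
    unfolding N_def[abs_def] by measurable
  have N01: "0 \<le> N t" "N t \<le> 1" for t by (auto simp: N_def)
  have N0: "N 0 = 1" using W by (simp add: N_def prob_space)
  define A where "A k t = t ^ k * N t * indicator {0..} t" for k t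
  define B where "B k t = t ^ k * exp (- t) * indicator {0..} t" for k and t :: real
  have A_meas[measurable]: "A k \<in> borel_measurable borel" for k unfolding A_def[abs_def] by measurable
  have B_meas[measurable]: "B k \<in> borel_measurable borel" for k unfolding B_def[abs_def] by measurable
  have A0: "A k t \<ge> 0" and B0: "B k t \<ge> 0" for k t using N01 by (auto simp: A_def B_def indicator_def)
  have WA: "(\<integral>\<^sup>+\<omega>. ennreal (W \<omega> ^ Suc k) \<partial>M) = ennreal (real (Suc k)) * (\<integral>\<^sup>+t. ennreal (A k t) \<partial>lborel)" for k
  proof -
    have "(\<integral>\<^sup>+\<omega>. ennreal (W \<omega> ^ Suc k) \<partial>M) = (\<integral>\<^sup>+t. ennreal (real (Suc k)) * ennreal (A k t) \<partial>lborel)"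
      unfolding nn_integral_power_tail[OF sigma_finite_measure_axioms W_meas W] N_eq
      by (intro nn_integral_cong)
         (use N01 in \<open>auto simp: A_def indicator_def ennreal_mult[symmetric] mult_ac simp del: of_nat_Suc\<close>)
    then show ?thesis by (simp add: nn_integral_cmult del: of_nat_Suc)
  qed
  have Bint: "has_bochner_integral lborel (B k) (fact k)" for k
  proof (rule has_bochner_integral_nn_integral)
    have "(\<integral>\<^sup>+t. ennreal (B k t) \<partial>lborel) = (\<integral>\<^sup>+t. ennreal (t ^ k * exp (- t)) * indicator {0..} t \<partial>lborel)"
      by (intro nn_integral_cong) (auto simp: B_def indicator_def)
    then show "(\<integral>\<^sup>+t. ennreal (B k t) \<partial>lborel) = ennreal (fact k)" by (simp only: exponential_power_integral)
  qed (use B0 in auto)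
  have A1: "has_bochner_integral lborel (A 1) 1"
  proof (rule has_bochner_integral_nn_integral)
    have "ennreal 2 * (\<integral>\<^sup>+t. ennreal (A 1 t) \<partial>lborel) = (\<integral>\<^sup>+\<omega>. ennreal ((W \<omega>)\<^sup>2) \<partial>M)"
      using WA[of 1] by (simp add: numeral_2_eq_2)
    also have "\<dots> = ennreal 2 * ennreal 1"
      using W2 by (subst nn_integral_eq_integral) auto
    finally show "(\<integral>\<^sup>+t. ennreal (A 1 t) \<partial>lborel) = ennreal 1"
      using ennreal_mult_cancel_left[of 2 "\<integral>\<^sup>+t. ennreal (A 1 t) \<partial>lborel" 1] by simp
  qed (use A0 in auto)
  \<comment> \<open>If \<open>N\<close> never falls below the exponential, equality of the second moments makes them equal almost everywhere.\<close>
  have "\<exists>t0\<ge>0. AE t in lborel. (0 \<le> t \<longrightarrow> t < t0 \<longrightarrow> exp (- t) \<le> N t) \<and> (t0 < t \<longrightarrow> N t \<le> exp (- t))"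
  proof -
    consider "\<forall>t\<ge>0. exp (- t) \<le> N t" |
      "\<exists>t0\<ge>0. (\<forall>t. 0 \<le> t \<longrightarrow> t < t0 \<longrightarrow> exp (- t) \<le> N t) \<and> (\<forall>t>t0. N t \<le> exp (- t))"
      using tail_single_crossing[of N] N01(1) N0 star unfolding N_def by blast
    then show ?thesis
    proof cases
      case 1
      then have le: "0 \<le> A 1 t - B 1 t" for t by (auto simp: A_def B_def indicator_def mult_left_mono)
      have "(LINT t|lborel. A 1 t - B 1 t) = 0" and int: "integrable lborel (\<lambda>t. A 1 t - B 1 t)"
        using A1 Bint[of 1] by (auto simp: has_bochner_integral_iff)
      then have "AE t in lborel. A 1 t - B 1 t = 0"
        using integral_nonneg_eq_0_iff_AE[OF int] le by simp
      then have "AE t in lborel. (0 \<le> t \<longrightarrow> t < 0 \<longrightarrow> exp (- t) \<le> N t) \<and> (0 < t \<longrightarrow> N t \<le> exp (- t))"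
        by eventually_elim (auto simp: A_def B_def)
      then show ?thesis by blast
    next
      case 2
      then show ?thesis by (elim exE conjE) (rule exI, rule conjI, assumption, rule AE_I2, blast)
    qed
  qed
  then obtain t0 where t0: "t0 \<ge> 0" and cross: "AE t in lborel. (0 \<le> t \<longrightarrow> t < t0 \<longrightarrow> exp (- t) \<le> N t) \<and> (t0 < t \<longrightarrow> N t \<le> exp (- t))"
    by blast
  have Aint: "integrable lborel (A k)" for k
  proof (rule Bochner_Integration.integrable_bound)
    show "integrable lborel (\<lambda>t. t0 ^ k * indicator {0..t0} t + B k t)"
      using Bint[of k] by (intro Bochner_Integration.integrable_add integrable_mult_right)
        (use t0 in \<open>auto simp: has_bochner_integral_iff intro!: integrable_real_indicator\<close>)
    show "AE t in lborel. norm (A k t) \<le> norm (t0 ^ k * indicator {0..t0} t + B k t)"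
      using cross
    proof eventually_elim
      case (elim t)
      have "A k t \<le> t0 ^ k * indicator {0..t0} t + B k t"
      proof -
        consider "t < 0" | "0 \<le> t" "t \<le> t0" | "t0 < t" by linarith
        then show ?thesis
        proof cases
          case 1
          then show ?thesis by (simp add: A_def B_def)
        next
          case 2
          have "t ^ k * N t \<le> t0 ^ k * 1" using 2 N01 t0 by (intro mult_mono power_mono) auto
          then show ?thesis using 2 B0[of k t] by (simp add: A_def)
        next
          case 3
          then show ?thesis using elim t0 by (simp add: A_def B_def mult_left_mono)
        qed
      qed
      then show ?case using A0[of k t] by simp
    qed
  qed simp
  show "integrable M (\<lambda>\<omega>. W \<omega> ^ Suc k)"
  proof (rule integrableI_nonneg)
    have "(\<integral>\<^sup>+t. ennreal (A k t) \<partial>lborel) < \<infinity>"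
      using Aint[of k] A0 by (subst nn_integral_eq_integral) auto
    then show "(\<integral>\<^sup>+\<omega>. ennreal (W \<omega> ^ Suc k) \<partial>M) < \<infinity>"
      unfolding WA by (simp add: ennreal_mult_less_top)
  qed (use W in auto)
  have "(LINT t|lborel. A 3 t) - t0\<^sup>2 * 1 \<le> 6 - t0\<^sup>2 * 1"
  proof -
    have "(LINT t|lborel. A 3 t - t0\<^sup>2 * A 1 t) \<le> (LINT t|lborel. B 3 t - t0\<^sup>2 * B 1 t)"
    proof (rule integral_mono_AE)
      show "AE t in lborel. A 3 t - t0\<^sup>2 * A 1 t \<le> B 3 t - t0\<^sup>2 * B 1 t"
        using cross
      proof eventually_elim
        case (elim t)
        have *: "(t\<^sup>2 - t0\<^sup>2) * (N t - exp (- t)) \<le> 0" if "0 \<le> t"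
        proof -
          consider "t < t0" | "t = t0" | "t0 < t" by linarith
          then show ?thesis
          proof cases
            case 1
            then have "t\<^sup>2 \<le> t0\<^sup>2" using that by (intro power_mono) auto
            then show ?thesis using elim that 1 by (intro mult_nonpos_nonneg) auto
          next
            case 3
            then have "t0\<^sup>2 \<le> t\<^sup>2" using t0 by (intro power_mono) auto
            then show ?thesis using elim 3 by (intro mult_nonneg_nonpos) auto
          qed simp
        qed
        have "t * ((t\<^sup>2 - t0\<^sup>2) * (N t - exp (- t))) \<le> 0" if "0 \<le> t"
          by (rule mult_nonneg_nonpos[OF that *[OF that]])
        then show ?case
          by (cases "t \<ge> 0") (auto simp: A_def B_def algebra_simps power2_eq_square power3_eq_cube)
      qed
    qed (use Aint Bint in \<open>auto simp: has_bochner_integral_iff\<close>)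
    then show ?thesis
      using Aint A1 Bint[of 3] Bint[of 1] by (simp add: has_bochner_integral_iff fact_numeral)
  qed
  then have A3: "(LINT t|lborel. A 3 t) \<le> 6" by simp
  have "(LINT \<omega>|M. W \<omega> ^ Suc 3) = enn2real (ennreal (real (Suc 3)) * (\<integral>\<^sup>+t. ennreal (A 3 t) \<partial>lborel))"
    unfolding WA[symmetric] by (rule integral_eq_nn_integral) (use W in auto)
  also have "(\<integral>\<^sup>+t. ennreal (A 3 t) \<partial>lborel) = ennreal (LINT t|lborel. A 3 t)"
    by (rule nn_integral_eq_integral) (use Aint A0 in auto)
  also have "enn2real (ennreal (real (Suc 3)) * ennreal (LINT t|lborel. A 3 t)) = 4 * (LINT t|lborel. A 3 t)"
    using A0 by (simp add: enn2real_mult integral_nonneg)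
  finally show "(LINT \<omega>|M. W \<omega> ^ 4) \<le> 24" using A3 by (simp add: eval_nat_numeral)
qed

section \<open>Moment norms and conditioning on the signs\<close>

lemma power_mean_integral:
  fixes Z :: "'a \<Rightarrow> real"
  assumes M: "prob_space M" and Z: "\<And>\<omega>. Z \<omega> \<ge> 0" "integrable M Z"
    and s: "s \<ge> 1" and Zs: "integrable M (\<lambda>\<omega>. Z \<omega> powr s)"
  shows "(LINT \<omega>|M. Z \<omega>) powr s \<le> (LINT \<omega>|M. Z \<omega> powr s)"
proof -
  interpret prob_space M by (rule M)
  define m where "m = (LINT \<omega>|M. Z \<omega>)"
  have m0: "m \<ge> 0" unfolding m_def by (intro Bochner_Integration.integral_nonneg Z(1))
  show ?thesis
  proof (cases "m = 0")
    case True
    then show ?thesis by (simp add: integral_nonneg flip: m_def)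
  next
    case False
    with m0 have m: "m > 0" by simp
    have "m powr s = (LINT \<omega>|M. m powr s + s * m powr (s - 1) * (Z \<omega> - m))"
      using Z(2) by (simp add: prob_space flip: m_def)
    also have "\<dots> \<le> (LINT \<omega>|M. Z \<omega> powr s)"
    proof (rule integral_mono)
      show "integrable M (\<lambda>\<omega>. m powr s + s * m powr (s - 1) * (Z \<omega> - m))"
        by (intro Bochner_Integration.integrable_add integrable_mult_right Bochner_Integration.integrable_diff
            integrable_const Z(2))
    qed (rule Zs, rule powr_above_tangent[OF Z(1) m s])
    finally show ?thesis by (simp add: m_def)
  qed
qed

lemma integrable_powr_smaller:
  fixes Z :: "'a \<Rightarrow> real" and p q :: real
  assumes M: "prob_space M" and Z: "Z \<in> borel_measurable M" "\<And>\<omega>. Z \<omega> \<ge> 0"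
    and q: "0 \<le> q" "q \<le> p" and int: "integrable M (\<lambda>\<omega>. Z \<omega> powr p)"
  shows "integrable M (\<lambda>\<omega>. Z \<omega> powr q)"
proof -
  interpret prob_space M by (rule M)
  note [measurable] = Z(1)
  have le: "z powr q \<le> 1 + z powr p" if z: "z \<ge> 0" for z :: real
  proof (cases "z \<le> 1")
    case True
    have "z powr q \<le> 1" by (rule powr_le1) (use q z True in auto)
    moreover have "0 \<le> z powr p" by simp
    ultimately show ?thesis by linarith
  next
    case False
    then have "z powr q \<le> z powr p" using q by (intro powr_mono) auto
    then show ?thesis by linarith
  qed
  have "norm (Z \<omega> powr q) \<le> norm (1 + Z \<omega> powr p)" for \<omega>
    using le[OF Z(2), of \<omega>] by simp
  moreover have "integrable M (\<lambda>\<omega>. 1 + Z \<omega> powr p)"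
    by (intro Bochner_Integration.integrable_add integrable_const int)
  moreover have "(\<lambda>\<omega>. Z \<omega> powr q) \<in> borel_measurable M" by measurable
  ultimately show ?thesis
    using Bochner_Integration.integrable_bound[of M "\<lambda>\<omega>. 1 + Z \<omega> powr p" "\<lambda>\<omega>. Z \<omega> powr q"] by blast
qed

lemma Lp_norm_powr:
  assumes "p > 0"
  shows "Lp_norm M p Y powr p = (LINT \<omega>|M. \<bar>Y \<omega>\<bar> powr p)"
  using assms by (simp add: Lp_norm_def powr_powr integral_nonneg)

lemma Lp_norm_nonneg: "Lp_norm M p Y \<ge> 0"
  by (simp add: Lp_norm_def)

lemma Lp_norm_power4:
  assumes "p > 0"
  shows "Lp_norm M p Y ^ 4 = (LINT \<omega>|M. \<bar>Y \<omega>\<bar> powr p) powr (4 / p)"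
proof -
  have "(Lp_norm M p Y powr p) powr (4 / p) = Lp_norm M p Y ^ 4"
    using assms Lp_norm_nonneg[of M p Y]
    by (cases "Lp_norm M p Y = 0") (auto simp: powr_powr)
  then show ?thesis by (simp add: Lp_norm_powr[OF assms])
qed

lemma Lp_norm_mono:
  assumes M: "prob_space M" and Y: "Y \<in> borel_measurable M" and q: "0 < q" "q \<le> p"
    and int: "integrable M (\<lambda>\<omega>. \<bar>Y \<omega>\<bar> powr p)"
  shows "Lp_norm M q Y \<le> Lp_norm M p Y"
proof -
  have "integrable M (\<lambda>\<omega>. \<bar>Y \<omega>\<bar> powr q)"
    by (rule integrable_powr_smaller[OF M _ _ _ q(2) int]) (use Y q in auto)
  then have "(LINT \<omega>|M. \<bar>Y \<omega>\<bar> powr q) powr (p / q) \<le> (LINT \<omega>|M. \<bar>Y \<omega>\<bar> powr p)"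
    using power_mean_integral[OF M, of "\<lambda>\<omega>. \<bar>Y \<omega>\<bar> powr q" "p / q"] q int by (simp add: powr_powr)
  then have "((LINT \<omega>|M. \<bar>Y \<omega>\<bar> powr q) powr (p / q)) powr (1 / p) \<le> (LINT \<omega>|M. \<bar>Y \<omega>\<bar> powr p) powr (1 / p)"
    using q by (intro powr_mono2) auto
  then show ?thesis using q by (simp add: Lp_norm_def powr_powr)
qed

lemma Lp_norm_scale:
  assumes "c \<ge> 0" "p > 0"
  shows "Lp_norm M p (\<lambda>\<omega>. c * Y \<omega>) = c * Lp_norm M p Y"
  using assms by (simp add: Lp_norm_def abs_mult powr_mult powr_powr integral_nonneg)

text \<open>The comparison of sign sums with \<open>n\<close> equal coefficients as second sum, and \<open>n\<close> tending to infinity.\<close>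

lemma gaussian_norm_le_rademacher:
  assumes I: "finite I" and b: "(\<Sum>i\<in>I. (b i)\<^sup>2) = 1" and p: "p \<ge> 4"
  shows "gaussian_norm p ^ 4 \<le> sign_mean I b (\<lambda>s. \<bar>s\<bar> powr p) powr (4 / p)
    + (p - 1) * (p - 2) * (p - 3) / 3 * (\<Sum>i\<in>I. (b i) ^ 4)"
proof -
  let ?R = "sign_mean I b (\<lambda>s. \<bar>s\<bar> powr p) powr (4 / p) + (p - 1) * (p - 2) * (p - 3) / 3 * (\<Sum>i\<in>I. (b i) ^ 4)"
  have R0: "?R \<ge> 0" using p by (intro add_nonneg_nonneg mult_nonneg_nonneg sum_nonneg) auto
  have "(LINT x|std_normal_distribution. \<bar>x\<bar> powr p) \<le> ?R powr (p / 4)"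
  proof (rule gaussian_moment_le_of_sign_sums)
    fix n :: nat
    let ?m = "sign_mean {..<Suc n} (\<lambda>_. 1 / sqrt (Suc n)) (\<lambda>s. \<bar>s\<bar> powr p)"
    have m0: "?m \<ge> 0" unfolding sign_mean_def by (intro divide_nonneg_nonneg sum_nonneg) auto
    have "?m powr (4 / p) \<le> ?R"
      by (rule rademacher_moment_comparison[OF I _ b _ p]) (simp_all add: power_divide)
    then have "(?m powr (4 / p)) powr (p / 4) \<le> ?R powr (p / 4)" using p by (intro powr_mono2) auto
    then show "?m \<le> ?R powr (p / 4)" using p m0 by (simp add: powr_powr)
  qed (use p integrable_gaussian_abs_moment in auto)
  then have "(LINT x|std_normal_distribution. \<bar>x\<bar> powr p) powr (4 / p) \<le> (?R powr (p / 4)) powr (4 / p)"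
    using p by (intro powr_mono2) (auto simp: integral_nonneg)
  also have "\<dots> = ?R" using p R0 by (simp add: powr_powr)
  finally show ?thesis using p by (simp add: gaussian_norm_def Lp_norm_power4)
qed

text \<open>The homogeneous form of the previous bound. Both terms on the left are polynomials in \<open>b\<close>, so that random
coefficients can be inserted and averaged.\<close>

lemma rademacher_lower_bound:
  assumes I: "finite I" and p: "p \<ge> 4"
  shows "gaussian_norm p ^ 4 * (\<Sum>i\<in>I. (b i)\<^sup>2)\<^sup>2 - (p - 1) * (p - 2) * (p - 3) / 3 * (\<Sum>i\<in>I. (b i) ^ 4)
    \<le> sign_mean I b (\<lambda>s. \<bar>s\<bar> powr p) powr (4 / p)"
proof (cases "(\<Sum>i\<in>I. (b i)\<^sup>2) = 0")
  case True
  have "0 \<le> (p - 1) * (p - 2) * (p - 3) / 3 * (\<Sum>i\<in>I. (b i) ^ 4)"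
    using p by (intro mult_nonneg_nonneg sum_nonneg) auto
  moreover have "0 \<le> sign_mean I b (\<lambda>s. \<bar>s\<bar> powr p) powr (4 / p)" by simp
  moreover have "gaussian_norm p ^ 4 * 0\<^sup>2 = 0" by simp
  ultimately show ?thesis unfolding True by linarith
next
  case False
  define B where "B = (\<Sum>i\<in>I. (b i)\<^sup>2)"
  have B: "B > 0" using False by (simp add: B_def sum_nonneg less_le)
  define r where "r = sqrt B"
  have r: "r > 0" "r\<^sup>2 = B" using B by (auto simp: r_def)
  have r4: "r ^ 4 = B\<^sup>2" using r(2) by (metis power2_eq_square power4_eq_xxxx mult.assoc)
  define b' where "b' i = b i / r" for i
  have bb: "b = (\<lambda>i. r * b' i)" using r by (simp add: b'_def)
  have "(\<Sum>i\<in>I. (b' i)\<^sup>2) = 1"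
    using B r by (simp add: b'_def power_divide flip: sum_divide_distrib B_def)
  note G = gaussian_norm_le_rademacher[OF I this p]
  have "sign_mean I b (\<lambda>s. \<bar>s\<bar> powr p) = r powr p * sign_mean I b' (\<lambda>s. \<bar>s\<bar> powr p)"
    unfolding bb sign_mean_scale using r by (simp add: abs_mult powr_mult sign_mean_cmult)
  then have "sign_mean I b (\<lambda>s. \<bar>s\<bar> powr p) powr (4 / p) = r ^ 4 * sign_mean I b' (\<lambda>s. \<bar>s\<bar> powr p) powr (4 / p)"
    using r p by (simp add: powr_mult powr_powr)
  moreover have "(\<Sum>i\<in>I. b i ^ 4) = r ^ 4 * (\<Sum>i\<in>I. b' i ^ 4)"
    unfolding bb by (simp add: power_mult_distrib sum_distrib_left)
  ultimately show ?thesis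
    unfolding B_def[symmetric] r4[symmetric]
    using mult_left_mono[OF G, of "r ^ 4"] r(1) by (simp add: algebra_simps)
qed

text \<open>Every fixed choice of signs leaves the law of \<open>X\<close> unchanged, hence so does the average over all choices.\<close>

lemma unconditional_sign_mean:
  fixes X :: "'a \<Rightarrow> real ^ 'n" and a :: "real ^ 'n"
  assumes unc: "unconditional M X" and X[measurable]: "X \<in> borel_measurable M"
    and g[measurable]: "g \<in> borel_measurable borel" and int: "integrable M (\<lambda>\<omega>. g (\<Sum>i\<in>UNIV. a $ i * X \<omega> $ i))"
  shows "integrable M (\<lambda>\<omega>. sign_mean UNIV (\<lambda>i. a $ i * X \<omega> $ i) g)"
    and "(LINT \<omega>|M. sign_mean UNIV (\<lambda>i. a $ i * X \<omega> $ i) g) = (LINT \<omega>|M. g (\<Sum>i\<in>UNIV. a $ i * X \<omega> $ i))"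
proof -
  define f where "f x = g (\<Sum>i\<in>UNIV. a $ i * x $ i)" for x :: "real ^ 'n"
  have f[measurable]: "f \<in> borel_measurable borel" unfolding f_def[abs_def] by measurable
  have *: "integrable M (\<lambda>\<omega>. f (flip_signs \<eta> (X \<omega>))) \<and> (LINT \<omega>|M. f (flip_signs \<eta> (X \<omega>))) = (LINT \<omega>|M. f (X \<omega>))"
    if \<eta>: "\<eta> \<in> UNIV \<rightarrow>\<^sub>E {-1, 1}" for \<eta>
  proof -
    have eq: "distr M borel (\<lambda>\<omega>. flip_signs \<eta> (X \<omega>)) = distr M borel X"
      using unc \<eta> by (auto simp: unconditional_def flip_signs_def PiE_iff)
    have "integrable (distr M borel (\<lambda>\<omega>. flip_signs \<eta> (X \<omega>))) f"
      unfolding eq using int by (simp add: integrable_distr_eq f_def)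
    moreover have "integral\<^sup>L (distr M borel (\<lambda>\<omega>. flip_signs \<eta> (X \<omega>))) f = integral\<^sup>L (distr M borel X) f"
      by (simp only: eq)
    ultimately show ?thesis by (simp add: integrable_distr_eq integral_distr)
  qed
  have fl: "g (\<Sum>i\<in>UNIV. a $ i * X \<omega> $ i * \<eta> i) = f (flip_signs \<eta> (X \<omega>))" for \<eta> \<omega>
    by (simp add: f_def flip_signs_def mult_ac)
  show "integrable M (\<lambda>\<omega>. sign_mean UNIV (\<lambda>i. a $ i * X \<omega> $ i) g)"
    unfolding sign_mean_def fl using * by (intro Bochner_Integration.integrable_divide Bochner_Integration.integrable_sum) auto
  have "(LINT \<omega>|M. sign_mean UNIV (\<lambda>i. a $ i * X \<omega> $ i) g)
    = (\<Sum>\<eta>\<in>UNIV \<rightarrow>\<^sub>E {-1, 1}. LINT \<omega>|M. f (flip_signs \<eta> (X \<omega>))) / 2 ^ CARD('n)"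
    unfolding sign_mean_def fl using * by (simp add: Bochner_Integration.integral_sum)
  also have "\<dots> = (LINT \<omega>|M. f (X \<omega>))" using * by (simp add: card_sign_vectors)
  finally show "(LINT \<omega>|M. sign_mean UNIV (\<lambda>i. a $ i * X \<omega> $ i) g) = (LINT \<omega>|M. g (\<Sum>i\<in>UNIV. a $ i * X \<omega> $ i))"
    by (simp add: f_def)
qed

text \<open>The mean vanishes by symmetry, so the diagonal of the covariance matrix contains the second moments.\<close>

lemma isotropic_second_moment:
  fixes X :: "'a \<Rightarrow> real ^ 'n"
  assumes M: "prob_space M" and X[measurable]: "X \<in> borel_measurable M"
    and iso: "isotropic M X" and unc: "unconditional M X"
  shows "integrable M (\<lambda>\<omega>. (X \<omega> $ i)\<^sup>2)" and "(LINT \<omega>|M. (X \<omega> $ i)\<^sup>2) = 1"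
proof -
  interpret prob_space M by (rule M)
  have Xi[measurable]: "(\<lambda>\<omega>. X \<omega> $ i) \<in> borel_measurable M"
    by (rule measurable_compose[OF X]) simp
  show int2: "integrable M (\<lambda>\<omega>. (X \<omega> $ i)\<^sup>2)" using iso by (simp add: isotropic_def)
  have int1: "integrable M (\<lambda>\<omega>. X \<omega> $ i)"
    by (rule square_integrable_imp_integrable[OF _ int2]) measurable
  \<comment> \<open>A coordinate is the linear form of a unit vector, so its mean is an average over signs.\<close>
  have sum_axis: "(\<Sum>j\<in>UNIV. axis i 1 $ j * x $ j) = x $ i" for x :: "real ^ 'n"
    by (simp add: axis_def if_distrib[of "\<lambda>c. c * _"] cong: if_cong)
  have "(LINT \<omega>|M. X \<omega> $ i) = (LINT \<omega>|M. sign_mean UNIV (\<lambda>j. axis i 1 $ j * X \<omega> $ j) (\<lambda>s. s))"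
    using unconditional_sign_mean(2)[OF unc X, of "\<lambda>s. s" "axis i 1"] int1 by (simp add: sum_axis)
  also have "\<dots> = 0" by (simp add: sign_mean_linear)
  finally have mean: "(LINT \<omega>|M. X \<omega> $ i) = 0" .
  have "covariance_matrix M X $ i $ i = 1" using iso by (simp add: isotropic_def mat_def)
  then show "(LINT \<omega>|M. (X \<omega> $ i)\<^sup>2) = 1"
    by (simp add: covariance_matrix_def mean power2_eq_square)
qed

text \<open>The factor \<open>sqrt 2\<close> normalizes the second moment to that of the standard exponential law.\<close>

lemma log_concave_coordinate_moments:
  fixes X :: "'a \<Rightarrow> real ^ 'n"
  assumes M: "prob_space M" and X[measurable]: "X \<in> borel_measurable M"
    and iso: "isotropic M X" and unc: "unconditional M X" and lc: "log_concave M X"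
  shows "integrable M (\<lambda>\<omega>. \<bar>X \<omega> $ i\<bar> ^ Suc k)" and "(LINT \<omega>|M. (X \<omega> $ i) ^ 4) \<le> 6"
proof -
  interpret prob_space M by (rule M)
  have Xi[measurable]: "(\<lambda>\<omega>. X \<omega> $ i) \<in> borel_measurable M"
    by (rule measurable_compose[OF X]) simp
  define W where "W \<omega> = sqrt 2 * \<bar>X \<omega> $ i\<bar>" for \<omega>
  have W_meas[measurable]: "W \<in> borel_measurable M" unfolding W_def[abs_def] by measurable
  have W0: "W \<omega> \<ge> 0" for \<omega> by (simp add: W_def)
  have tail: "{\<omega> \<in> space M. t \<le> W \<omega>} = {\<omega> \<in> space M. t / sqrt 2 \<le> \<bar>X \<omega> $ i\<bar>}" for t
    by (auto simp: W_def field_simps)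
  have star: "measure M {\<omega> \<in> space M. t \<le> W \<omega>} powr \<theta> \<le> measure M {\<omega> \<in> space M. \<theta> * t \<le> W \<omega>}"
    if "0 < \<theta>" "\<theta> < 1" "0 \<le> t" for \<theta> t
    using coordinate_tail_log_concave[OF M unc lc, of \<theta> "1 - \<theta>" "t / sqrt 2" 0 i] that
    by (simp add: tail prob_space)
  note X2 = isotropic_second_moment[OF M X iso unc, of i]
  have W2: "integrable M (\<lambda>\<omega>. (W \<omega>)\<^sup>2)" "(LINT \<omega>|M. (W \<omega>)\<^sup>2) = 2"
    using X2 by (simp_all add: W_def power_mult_distrib)
  have "integrable M (\<lambda>\<omega>. W \<omega> ^ Suc k)"
    by (rule log_concave_tail_moments(1)[OF M W_meas W0 star W2])
  then have "integrable M (\<lambda>\<omega>. (1 / sqrt 2) ^ Suc k * W \<omega> ^ Suc k)" by (rule integrable_mult_right)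
  moreover have "(1 / sqrt 2) ^ Suc k * W \<omega> ^ Suc k = \<bar>X \<omega> $ i\<bar> ^ Suc k" for \<omega>
    by (simp only: power_mult_distrib[symmetric]) (simp add: W_def)
  ultimately show "integrable M (\<lambda>\<omega>. \<bar>X \<omega> $ i\<bar> ^ Suc k)" by simp
  have "(LINT \<omega>|M. W \<omega> ^ 4) \<le> 24"
    by (rule log_concave_tail_moments(2)[OF M W_meas W0 star W2])
  moreover have "W \<omega> ^ 4 = 4 * (X \<omega> $ i) ^ 4" for \<omega>
  proof -
    have "sqrt 2 ^ 4 = (4 :: real)" by (simp add: power4_eq_xxxx)
    then show ?thesis by (simp add: W_def power_mult_distrib power_even_abs)
  qed
  ultimately show "(LINT \<omega>|M. (X \<omega> $ i) ^ 4) \<le> 6" by simp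
qed

section \<open>Proof of the moment bound\<close>

lemma power_le_cancel:
  fixes a b :: real
  assumes "a ^ n \<le> b ^ n" "0 \<le> b" "n > 0"
  shows "a \<le> b"
  using assms by (meson linorder_not_less power_strict_mono)

lemma abs_powr_even:
  assumes "even n" "n > 0"
  shows "\<bar>y :: real\<bar> powr real n = y ^ n"
  using assms by (cases "y = 0") (simp_all add: powr_realpow power_even_abs)

lemma gaussian_norm_4: "gaussian_norm 4 ^ 4 = 3"
proof -
  have "(LINT x|std_normal_distribution. \<bar>x\<bar> powr 4) = (LINT x|std_normal_distribution. x ^ (2 * 2))"
    using abs_powr_even[of 4] by simp
  also have "\<dots> = 3" unfolding std_normal_distribution_even_moments by (simp add: fact_numeral)
  finally show ?thesis by (simp add: gaussian_norm_def Lp_norm_power4)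
qed

lemma gaussian_norm_mono:
  assumes "0 < q" "q \<le> p"
  shows "gaussian_norm q \<le> gaussian_norm p"
proof -
  interpret real_distribution std_normal_distribution by (rule real_dist_normal_dist)
  show ?thesis unfolding gaussian_norm_def
    by (rule Lp_norm_mono[OF prob_space_axioms _ assms integrable_gaussian_abs_moment]) (use assms in auto)
qed

text \<open>The moment of order \<open>24\<close> is \<open>fact 24 / (2 ^ 12 * fact 12)\<close>.\<close>

lemma gaussian_norm_24_le: "gaussian_norm 24 \<le> 10 / 3"
proof -
  have "gaussian_norm 24 powr 24 = (LINT x|std_normal_distribution. x ^ (2 * 12))"
    unfolding gaussian_norm_def using abs_powr_even[of 24] by (subst Lp_norm_powr) simp_all
  also have "\<dots> = fact 24 / (2 ^ 12 * fact 12)" unfolding std_normal_distribution_even_moments by simp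
  also have "\<dots> \<le> (10 / 3) ^ 24" by (simp add: fact_numeral power_divide)
  finally have "gaussian_norm 24 ^ 24 \<le> (10 / 3) ^ 24"
    using gaussian_norm_sq_bounds(3)[of 24] by simp
  then show ?thesis by (rule power_le_cancel) simp_all
qed

lemma exp_1_bounds: "exp (1 :: real) < 2.72" "exp (1 :: real) > 0"
  using e_less_272 by simp_all

text \<open>The tangent at zero, with \<open>ln 2 \<le> 25 / 36\<close>.\<close>

lemma two_powr_minus_ge:
  fixes c :: real
  assumes "c \<ge> 0"
  shows "1 - 25 / 36 * c \<le> 2 powr (- c)"
proof -
  have "ln 2 * c \<le> 25 / 36 * c" using ln2_le_25_over_36 assms by (intro mult_right_mono) auto
  then have "1 - 25 / 36 * c \<le> 1 + (- c) * ln 2" by (simp add: mult.commute)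
  also have "\<dots> \<le> exp ((- c) * ln 2)" by (rule exp_ge_add_one_self)
  finally show ?thesis by (simp add: powr_def)
qed

text \<open>Both sides are of order \<open>q ^ 3\<close>, and \<open>1 / exp 1 > 1 / 3\<close> decides for large \<open>q\<close>. For small \<open>q\<close> the factors \<open>q - 1\<close>,
\<open>q - 2\<close> and \<open>q - 3\<close> on the left make up for the loss \<open>2 powr (- 1 / q)\<close> in the bound on the Gaussian norm.\<close>

lemma gaussian_norm_sq_lower:
  assumes q: "q \<ge> 4"
  shows "(q - 1) * (q - 2) * (q - 3) \<le> 3 * q\<^sup>2 * (gaussian_norm q)\<^sup>2"
proof -
  have "(q - 3) / 3 \<le> (q - 25 / 36) / 2.72" using q by simp
  also have "\<dots> \<le> (q - 25 / 36) / exp 1" using exp_1_bounds q by (intro divide_left_mono) auto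
  also have "\<dots> = q / exp 1 * (1 - 25 / 36 * (1 / q))" using q by (simp add: field_simps)
  also have "\<dots> \<le> q / exp 1 * 2 powr (- (1 / q))" using q by (intro mult_left_mono two_powr_minus_ge) auto
  also have "\<dots> \<le> (gaussian_norm q)\<^sup>2" using gaussian_norm_sq_bounds(1)[of q] q by simp
  finally have "q\<^sup>2 * (q - 3) \<le> 3 * q\<^sup>2 * (gaussian_norm q)\<^sup>2"
    using mult_left_mono[of "(q - 3) / 3" "(gaussian_norm q)\<^sup>2" "3 * q\<^sup>2"] by simp
  moreover have "(q - 1) * (q - 2) * (q - 3) \<le> q\<^sup>2 * (q - 3)"
    using q by (intro mult_right_mono) (auto simp: power2_eq_square algebra_simps)
  ultimately show ?thesis by linarith
qed

text \<open>The ratio tends to \<open>1 / sqrt 3 > 8 / 15\<close>.\<close>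

lemma gaussian_norm_third:
  assumes p: "p \<ge> 24"
  shows "8 / 15 * gaussian_norm p \<le> gaussian_norm (p / 3)"
proof -
  define q where "q = p / 3"
  have q: "q \<ge> 8" "p = 3 * q" using p by (auto simp: q_def)
  have "64 / 75 \<le> 1 - 25 / 36 * (5 / (3 * q))" using q by (simp add: field_simps)
  also have "\<dots> \<le> 2 powr (- (5 / (3 * q)))" using q by (intro two_powr_minus_ge) auto
  finally have "64 / 75 * 4 powr (1 / p) \<le> 2 powr (- (5 / (3 * q))) * 4 powr (1 / p)" by (intro mult_right_mono) auto
  also have "4 powr (1 / p) = 2 powr (2 / (3 * q))"
  proof -
    have "4 powr (1 / p) = (2 powr 2) powr (1 / p)" by simp
    also have "\<dots> = 2 powr (2 * (1 / p))" by (rule powr_powr)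
    finally show ?thesis by (simp add: q)
  qed
  also have "2 powr (- (5 / (3 * q))) * 2 powr (2 / (3 * q)) = 2 powr (- 1 / q)"
  proof -
    have "- (5 / (3 * q)) + 2 / (3 * q) = - 1 / q" using q by (simp add: field_simps)
    then show ?thesis by (simp flip: powr_add)
  qed
  finally have *: "64 / 75 * 2 powr (2 / (3 * q)) \<le> 2 powr (- 1 / q)" .
  have "(8 / 15 * gaussian_norm p)\<^sup>2 = 64 / 225 * (gaussian_norm p)\<^sup>2" by (simp add: power2_eq_square)
  also have "\<dots> \<le> 64 / 225 * (p / exp 1 * 4 powr (1 / p))"
    using gaussian_norm_sq_bounds(2)[of p] p by (intro mult_left_mono) auto
  also have "\<dots> = q / exp 1 * (64 / 75 * 2 powr (2 / (3 * q)))"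
  proof -
    have "4 powr (1 / p) = (2 powr 2) powr (1 / p)" by simp
    also have "\<dots> = 2 powr (2 * (1 / p))" by (rule powr_powr)
    finally show ?thesis by (simp add: q)
  qed
  also have "\<dots> \<le> q / exp 1 * 2 powr (- 1 / q)" using * q by (intro mult_left_mono) auto
  also have "\<dots> \<le> (gaussian_norm q)\<^sup>2" by (rule gaussian_norm_sq_bounds(1)) (use q in simp)
  finally have "(8 / 15 * gaussian_norm p)\<^sup>2 \<le> (gaussian_norm q)\<^sup>2" .
  moreover have "gaussian_norm q \<ge> 0" using gaussian_norm_sq_bounds(3)[of q] q by simp
  ultimately show ?thesis unfolding q_def by (rule power2_le_imp_le)
qed

text \<open>The normalized situation \<open>norm a = 1\<close>.\<close>

locale unconditional_linear_form = prob_space M for M :: "'a measure" +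
  fixes X :: "'a \<Rightarrow> real ^ 'n" and a :: "real ^ 'n"
  assumes X_measurable[measurable]: "X \<in> borel_measurable M"
    and iso: "isotropic M X" and unc: "unconditional M X" and lc: "log_concave M X"
    and norm_a: "norm a = 1"
begin

lemmas M = prob_space_axioms
lemmas X = X_measurable

definition linear_form :: "'a \<Rightarrow> real" where
  "linear_form \<omega> = (\<Sum>i\<in>UNIV. a $ i * X \<omega> $ i)"

definition beta :: real where
  "beta = sqrt (\<Sum>i\<in>UNIV. a $ i ^ 4)"

lemma Xi[measurable]: "(\<lambda>\<omega>. X \<omega> $ i) \<in> borel_measurable M"
  by (rule measurable_compose[OF X]) simp

lemma linear_form_measurable[measurable]: "linear_form \<in> borel_measurable M"
  unfolding linear_form_def[abs_def] by measurable

lemma sum_a2: "(\<Sum>i\<in>UNIV. (a $ i)\<^sup>2) = 1"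
proof -
  have "norm a ^ 2 = (\<Sum>i\<in>UNIV. (a $ i)\<^sup>2)"
    by (simp add: norm_vec_def L2_set_def sum_nonneg)
  then show ?thesis using norm_a by simp
qed

lemma beta_pos: "beta > 0"
proof -
  have "a \<noteq> 0" using norm_a by auto
  then obtain i where "a $ i \<noteq> 0" by (auto simp: vec_eq_iff)
  then have "0 < a $ i ^ 4" by simp
  also have "\<dots> \<le> (\<Sum>i\<in>UNIV. a $ i ^ 4)" by (rule member_le_sum) auto
  finally show ?thesis by (simp add: beta_def)
qed

lemma beta_sq: "beta\<^sup>2 = (\<Sum>i\<in>UNIV. a $ i ^ 4)"
  by (simp add: beta_def sum_nonneg)

lemma X2: "integrable M (\<lambda>\<omega>. (X \<omega> $ i)\<^sup>2)" "(LINT \<omega>|M. (X \<omega> $ i)\<^sup>2) = 1"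
  by (rule isotropic_second_moment[OF M X iso unc])+

lemma X4: "integrable M (\<lambda>\<omega>. (X \<omega> $ i) ^ 4)" "(LINT \<omega>|M. (X \<omega> $ i) ^ 4) \<le> 6"
  using log_concave_coordinate_moments(1)[OF M X iso unc lc, of i 3]
    log_concave_coordinate_moments(2)[OF M X iso unc lc, of i]
  by (simp_all add: power_even_abs)

lemma weighted_squares: "integrable M (\<lambda>\<omega>. \<Sum>i\<in>UNIV. (a $ i * X \<omega> $ i)\<^sup>2)"
    "(LINT \<omega>|M. (\<Sum>i\<in>UNIV. (a $ i * X \<omega> $ i)\<^sup>2)) = 1"
  using X2 sum_a2 by (simp_all add: power_mult_distrib)

lemma weighted_fourth_powers: "integrable M (\<lambda>\<omega>. \<Sum>i\<in>UNIV. (a $ i * X \<omega> $ i) ^ 4)"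
    "(LINT \<omega>|M. (\<Sum>i\<in>UNIV. (a $ i * X \<omega> $ i) ^ 4)) \<le> 6 * beta\<^sup>2"
proof -
  show "integrable M (\<lambda>\<omega>. \<Sum>i\<in>UNIV. (a $ i * X \<omega> $ i) ^ 4)"
    using X4 by (simp add: power_mult_distrib)
  have "(LINT \<omega>|M. (\<Sum>i\<in>UNIV. (a $ i * X \<omega> $ i) ^ 4)) = (\<Sum>i\<in>UNIV. a $ i ^ 4 * (LINT \<omega>|M. (X \<omega> $ i) ^ 4))"
    using X4 by (simp add: power_mult_distrib)
  also have "\<dots> \<le> (\<Sum>i\<in>UNIV. a $ i ^ 4 * 6)" by (intro sum_mono mult_left_mono X4) auto
  finally show "(LINT \<omega>|M. (\<Sum>i\<in>UNIV. (a $ i * X \<omega> $ i) ^ 4)) \<le> 6 * beta\<^sup>2"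
    by (simp add: beta_sq sum_distrib_left mult.commute)
qed

text \<open>A sum is at most the number of its terms times the largest one, and the moments of the coordinates are finite.\<close>

lemma linear_form_integrable:
  assumes p: "p > 0"
  shows "integrable M (\<lambda>\<omega>. \<bar>linear_form \<omega>\<bar> powr p)"
proof -
  obtain k :: nat where k: "p \<le> real k" using real_arch_simple by blast
  define m where "m = Suc k"
  have pm: "p \<le> real m" and m0: "m > 0" using k by (simp_all add: m_def)
  have "integrable M (\<lambda>\<omega>. \<bar>linear_form \<omega>\<bar> powr real m)"
  proof (rule Bochner_Integration.integrable_bound)
    have "integrable M (\<lambda>\<omega>. \<bar>X \<omega> $ i\<bar> ^ m)" for i
      unfolding m_def by (rule log_concave_coordinate_moments(1)[OF M X iso unc lc])
    then show "integrable M (\<lambda>\<omega>. real CARD('n) ^ m * (\<Sum>i\<in>UNIV. \<bar>a $ i\<bar> ^ m * \<bar>X \<omega> $ i\<bar> ^ m))" by simp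
    have "\<bar>linear_form \<omega>\<bar> powr real m \<le> real CARD('n) ^ m * (\<Sum>i\<in>UNIV. \<bar>a $ i\<bar> ^ m * \<bar>X \<omega> $ i\<bar> ^ m)" for \<omega>
    proof -
      let ?t = "\<lambda>i. \<bar>a $ i\<bar> * \<bar>X \<omega> $ i\<bar>"
      define s where "s = Max (range ?t)"
      have t: "?t i \<le> s" for i unfolding s_def by (rule Max_ge) auto
      have s_in: "s \<in> range ?t" unfolding s_def by (rule Max_in) auto
      then obtain i where i: "s = ?t i" by auto
      have "\<bar>linear_form \<omega>\<bar> \<le> (\<Sum>i\<in>UNIV. ?t i)"
        unfolding linear_form_def by (rule order_trans[OF sum_abs]) (simp add: abs_mult)
      also have "\<dots> \<le> real CARD('n) * s" using sum_bounded_above[of UNIV ?t s] t by simp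
      finally have "\<bar>linear_form \<omega>\<bar> ^ m \<le> (real CARD('n) * s) ^ m" by (intro power_mono) auto
      also have "\<dots> = real CARD('n) ^ m * s ^ m" by (rule power_mult_distrib)
      also have "s ^ m \<le> (\<Sum>i\<in>UNIV. ?t i ^ m)" unfolding i by (rule member_le_sum) auto
      finally have "\<bar>linear_form \<omega>\<bar> ^ m \<le> real CARD('n) ^ m * (\<Sum>i\<in>UNIV. ?t i ^ m)"
        by (simp add: mult_left_mono)
      moreover have "\<bar>linear_form \<omega>\<bar> powr real m = \<bar>linear_form \<omega>\<bar> ^ m"
        using m0 by (cases "linear_form \<omega> = 0") (simp_all add: powr_realpow)
      ultimately show ?thesis by (simp add: power_mult_distrib)
    qed
    then show "AE \<omega> in M. norm (\<bar>linear_form \<omega>\<bar> powr real m)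
      \<le> norm (real CARD('n) ^ m * (\<Sum>i\<in>UNIV. \<bar>a $ i\<bar> ^ m * \<bar>X \<omega> $ i\<bar> ^ m))"
      by (intro AE_I2) (auto simp: abs_of_nonneg sum_nonneg)
  qed simp
  from integrable_powr_smaller[OF M _ _ _ pm this] show ?thesis using p by simp
qed

lemma linear_form_square: "integrable M (\<lambda>\<omega>. (linear_form \<omega>)\<^sup>2)" "(LINT \<omega>|M. (linear_form \<omega>)\<^sup>2) = 1"
proof -
  have "(\<bar>y\<bar> powr 2) = y\<^sup>2" for y :: real using abs_powr_even[of 2 y] by simp
  then show int: "integrable M (\<lambda>\<omega>. (linear_form \<omega>)\<^sup>2)"
    using linear_form_integrable[of 2] by simp
  have "(LINT \<omega>|M. (linear_form \<omega>)\<^sup>2) = (LINT \<omega>|M. sign_mean UNIV (\<lambda>i. a $ i * X \<omega> $ i) (\<lambda>s. s\<^sup>2))"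
    using unconditional_sign_mean(2)[OF unc X, of "\<lambda>s. s\<^sup>2" a] int by (simp add: linear_form_def)
  also have "\<dots> = 1" using weighted_squares by (simp add: sign_mean_square)
  finally show "(LINT \<omega>|M. (linear_form \<omega>)\<^sup>2) = 1" .
qed

text \<open>Given \<open>\<bar>X\<bar>\<close>, the mean of the cosine is a product of cosines. Replacing each factor by a Gaussian one costs a fourth
power, whose mean is controlled by the fourth moments. The product of the Gaussian factors is
\<open>exp (- t\<^sup>2 / 2 * V)\<close> with \<open>V\<close> of mean one, and Jensen's inequality applies, here in the form of the tangent of the
exponential function.\<close>

lemma linear_form_cos: "exp (- t\<^sup>2 / 2) - 3 / 4 * beta\<^sup>2 * t ^ 4 \<le> (LINT \<omega>|M. cos (t * linear_form \<omega>))"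
proof -
  let ?V = "\<lambda>\<omega>. \<Sum>i\<in>UNIV. (a $ i * X \<omega> $ i)\<^sup>2"
  let ?Q = "\<lambda>\<omega>. \<Sum>i\<in>UNIV. (a $ i * X \<omega> $ i) ^ 4"
  let ?b = "\<lambda>\<omega> i. a $ i * X \<omega> $ i"
  have int: "integrable M (\<lambda>\<omega>. cos (t * linear_form \<omega>))"
    by (rule integrable_const_bound[where B=1]) auto
  note sm = unconditional_sign_mean[OF unc X, of "\<lambda>s. cos (t * s)" a, folded linear_form_def, OF _ int, simplified]
  have pw: "exp (- t\<^sup>2 / 2) * (1 - t\<^sup>2 / 2 * (?V \<omega> - 1)) - t ^ 4 / 8 * ?Q \<omega>
    \<le> sign_mean UNIV (?b \<omega>) (\<lambda>s. cos (t * s))" for \<omega>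
  proof -
    have "\<bar>(\<Prod>i\<in>UNIV. cos (t * ?b \<omega> i)) - (\<Prod>i\<in>UNIV. exp (- (t * ?b \<omega> i)\<^sup>2 / 2))\<bar>
      \<le> (\<Sum>i\<in>UNIV. \<bar>cos (t * ?b \<omega> i) - exp (- (t * ?b \<omega> i)\<^sup>2 / 2)\<bar>)"
      using norm_prod_diff[of UNIV "\<lambda>i. cos (t * ?b \<omega> i)" "\<lambda>i. exp (- (t * ?b \<omega> i)\<^sup>2 / 2)"] by simp
    also have "\<dots> \<le> (\<Sum>i\<in>UNIV. (t * ?b \<omega> i) ^ 4 / 8)" by (intro sum_mono abs_cos_minus_gauss_le)
    also have "\<dots> = t ^ 4 / 8 * ?Q \<omega>"
      unfolding sum_distrib_left by (intro sum.cong refl) (simp add: power_mult_distrib)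
    finally have 1: "(\<Prod>i\<in>UNIV. exp (- (t * ?b \<omega> i)\<^sup>2 / 2)) - t ^ 4 / 8 * ?Q \<omega> \<le> (\<Prod>i\<in>UNIV. cos (t * ?b \<omega> i))" by linarith
    have e: "(\<Sum>i\<in>UNIV. - (t * ?b \<omega> i)\<^sup>2 / 2) = - t\<^sup>2 / 2 + - (t\<^sup>2 / 2 * (?V \<omega> - 1))"
    proof -
      have "(\<Sum>i\<in>UNIV. - (t * ?b \<omega> i)\<^sup>2 / 2) = (\<Sum>i\<in>UNIV. - (t\<^sup>2 / 2) * (?b \<omega> i)\<^sup>2)"
        by (intro sum.cong refl) (simp add: power_mult_distrib)
      also have "\<dots> = - (t\<^sup>2 / 2) * ?V \<omega>" by (rule sum_distrib_left[symmetric])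
      finally show ?thesis by (simp add: algebra_simps)
    qed
    have "exp (- t\<^sup>2 / 2) * (1 - t\<^sup>2 / 2 * (?V \<omega> - 1)) \<le> exp (- t\<^sup>2 / 2) * exp (- (t\<^sup>2 / 2 * (?V \<omega> - 1)))"
      using exp_ge_add_one_self[of "- (t\<^sup>2 / 2 * (?V \<omega> - 1))"] by (intro mult_left_mono) auto
    also have "\<dots> = (\<Prod>i\<in>UNIV. exp (- (t * ?b \<omega> i)\<^sup>2 / 2))"
      unfolding exp_add[symmetric] e[symmetric] by (simp add: exp_sum)
    finally show ?thesis using 1 by (simp add: sign_mean_cos)
  qed
  have "exp (- t\<^sup>2 / 2) - t ^ 4 / 8 * (6 * beta\<^sup>2)
    \<le> exp (- t\<^sup>2 / 2) * (1 - t\<^sup>2 / 2 * (1 - 1)) - t ^ 4 / 8 * (LINT \<omega>|M. ?Q \<omega>)"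
    using mult_left_mono[OF weighted_fourth_powers(2), of "t ^ 4 / 8"] by simp
  also have "\<dots> = (LINT \<omega>|M. exp (- t\<^sup>2 / 2) * (1 - t\<^sup>2 / 2 * (?V \<omega> - 1)) - t ^ 4 / 8 * ?Q \<omega>)"
    using weighted_squares weighted_fourth_powers(1) by (simp add: prob_space)
  also have "\<dots> \<le> (LINT \<omega>|M. sign_mean UNIV (?b \<omega>) (\<lambda>s. cos (t * s)))"
    using weighted_squares weighted_fourth_powers(1) sm(1) by (intro integral_mono pw) auto
  also have "\<dots> = (LINT \<omega>|M. cos (t * linear_form \<omega>))" by (rule sm(2))
  finally show ?thesis by (simp add: mult.commute)
qed


lemma Lp_norm_linear_form_ge_1:
  assumes p: "p \<ge> 2"
  shows "1 \<le> Lp_norm M p linear_form"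
proof -
  have "Lp_norm M 2 linear_form = 1"
    using linear_form_square(2) abs_powr_even[of 2] by (simp add: Lp_norm_def)
  then show ?thesis
    using Lp_norm_mono[OF M linear_form_measurable, of 2 p] p linear_form_integrable[of p] by simp
qed

text \<open>Average the lower bound for sign sums over \<open>X\<close>. The norm of order \<open>p \<ge> 4\<close> dominates the mean of the fourth
powers of the conditional norms, and the square of \<open>\<Sum>i. (a\<^sub>i * X\<^sub>i)\<^sup>2\<close> has mean at least one.\<close>

lemma Lp_norm_linear_form_power4:
  assumes p: "p \<ge> 4"
  shows "gaussian_norm p ^ 4 - 2 * ((p - 1) * (p - 2) * (p - 3)) * beta\<^sup>2 \<le> Lp_norm M p linear_form ^ 4"
proof -
  let ?b = "\<lambda>\<omega> i. a $ i * X \<omega> $ i"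
  let ?V = "\<lambda>\<omega>. \<Sum>i\<in>UNIV. (?b \<omega> i)\<^sup>2"
  let ?Q = "\<lambda>\<omega>. \<Sum>i\<in>UNIV. (?b \<omega> i) ^ 4"
  let ?P = "(p - 1) * (p - 2) * (p - 3)"
  define Z where "Z \<omega> = sign_mean UNIV (?b \<omega>) (\<lambda>s. \<bar>s\<bar> powr p)" for \<omega>
  have P0: "?P \<ge> 0" using p by simp
  have Z0: "Z \<omega> \<ge> 0" for \<omega>
    unfolding Z_def sign_mean_def by (intro divide_nonneg_nonneg sum_nonneg) auto
  have intp: "integrable M (\<lambda>\<omega>. \<bar>linear_form \<omega>\<bar> powr p)" using p by (intro linear_form_integrable) simp
  have Z: "integrable M Z" "(LINT \<omega>|M. Z \<omega>) = (LINT \<omega>|M. \<bar>linear_form \<omega>\<bar> powr p)"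
    using unconditional_sign_mean[OF unc X, of "\<lambda>s. \<bar>s\<bar> powr p" a, folded linear_form_def] intp
    unfolding Z_def by simp_all
  have int4: "integrable M (\<lambda>\<omega>. Z \<omega> powr (4 / p))"
  proof (rule integrable_powr_smaller[OF M _ Z0])
    show "integrable M (\<lambda>\<omega>. Z \<omega> powr 1)" using Z(1) Z0 by simp
  qed (use p Z(1) in auto)
  have low: "gaussian_norm p ^ 4 * (2 * ?V \<omega> - 1) - ?P / 3 * ?Q \<omega> \<le> Z \<omega> powr (4 / p)" for \<omega>
  proof -
    \<comment> \<open>The square is replaced by its tangent at one, whose mean needs no fourth moments.\<close>
  have "2 * ?V \<omega> - 1 \<le> (?V \<omega>)\<^sup>2"
      using zero_le_power2[of "?V \<omega> - 1"] by (simp add: power2_diff)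
    then have "gaussian_norm p ^ 4 * (2 * ?V \<omega> - 1) \<le> gaussian_norm p ^ 4 * (?V \<omega>)\<^sup>2"
      by (intro mult_left_mono) auto
    then show ?thesis
      using rademacher_lower_bound[OF finite[of UNIV] p, of "?b \<omega>"] unfolding Z_def by linarith
  qed
  have "gaussian_norm p ^ 4 - 2 * ?P * beta\<^sup>2 = gaussian_norm p ^ 4 * (2 * 1 - 1) - ?P / 3 * (6 * beta\<^sup>2)"
    by simp
  also have "\<dots> \<le> gaussian_norm p ^ 4 * (2 * 1 - 1) - ?P / 3 * (LINT \<omega>|M. ?Q \<omega>)"
    using weighted_fourth_powers(2) P0 by (intro diff_left_mono mult_left_mono) auto
  also have "\<dots> = (LINT \<omega>|M. gaussian_norm p ^ 4 * (2 * ?V \<omega> - 1) - ?P / 3 * ?Q \<omega>)"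
    using weighted_squares weighted_fourth_powers(1) by (simp add: prob_space)
  also have "\<dots> \<le> (LINT \<omega>|M. Z \<omega> powr (4 / p))"
    using weighted_squares weighted_fourth_powers(1) int4 by (intro integral_mono low) auto
  also have "\<dots> \<le> (LINT \<omega>|M. Z \<omega>) powr (4 / p)"
  proof -
    have "(LINT \<omega>|M. Z \<omega> powr (4 / p)) powr (p / 4) \<le> (LINT \<omega>|M. Z \<omega>)"
      using power_mean_integral[OF M, of "\<lambda>\<omega>. Z \<omega> powr (4 / p)" "p / 4"] int4 Z(1) Z0 p
      by (simp add: powr_powr)
    then have "((LINT \<omega>|M. Z \<omega> powr (4 / p)) powr (p / 4)) powr (4 / p) \<le> (LINT \<omega>|M. Z \<omega>) powr (4 / p)"
      using p by (intro powr_mono2) auto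
    then show ?thesis using p by (simp add: powr_powr integral_nonneg)
  qed
  also have "\<dots> = Lp_norm M p linear_form ^ 4"
    unfolding Z(2) using p by (simp add: Lp_norm_power4)
  finally show ?thesis .
qed

text \<open>With \<open>g\<close> for the Gaussian norm and \<open>y = sqrt 3 * q * beta\<close>, the fourth power of the norm is at least
\<open>g ^ 4 - 2 * g\<^sup>2 * y\<^sup>2\<close>. For \<open>y > 0\<close> this is at least \<open>(g - y) ^ 4\<close> exactly if \<open>y ^ 3 \<le> 4 * g * (g - y)\<^sup>2\<close>, which holds up to
\<open>y = 7 / 10 * g\<close>.\<close>

lemma moderate_deviation_case:
  assumes q: "q \<ge> 4" and y: "sqrt 3 * q * beta \<le> 7 / 10 * gaussian_norm q"
  shows "gaussian_norm q - sqrt 3 * q * beta \<le> Lp_norm M q linear_form"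
proof -
  define g where "g = gaussian_norm q"
  define y where "y = sqrt 3 * q * beta"
  have g: "g > 0" unfolding g_def by (rule gaussian_norm_sq_bounds(3)) (use q in simp)
  have y0: "0 \<le> y" using q beta_pos by (simp add: y_def)
  have yg: "y \<le> 7 / 10 * g" using y by (simp add: y_def g_def)
  have y2: "y\<^sup>2 = 3 * q\<^sup>2 * beta\<^sup>2" by (simp add: y_def power_mult_distrib)
  have "2 * ((q - 1) * (q - 2) * (q - 3)) * beta\<^sup>2 \<le> 2 * (3 * q\<^sup>2 * g\<^sup>2) * beta\<^sup>2"
    using gaussian_norm_sq_lower[OF q] by (intro mult_right_mono mult_left_mono) (auto simp: g_def)
  also have "\<dots> = 2 * g\<^sup>2 * y\<^sup>2" by (simp add: y2)
  finally have N: "g ^ 4 - 2 * g\<^sup>2 * y\<^sup>2 \<le> Lp_norm M q linear_form ^ 4"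
    using Lp_norm_linear_form_power4[OF q] by (simp add: g_def)
  have "y ^ 3 \<le> (7 / 10 * g) ^ 3" using yg y0 by (intro power_mono)
  moreover have "(3 / 10 * g)\<^sup>2 \<le> (g - y)\<^sup>2" using yg g by (intro power_mono) auto
  then have "4 * g * (3 / 10 * g)\<^sup>2 \<le> 4 * g * (g - y)\<^sup>2" using g by (intro mult_left_mono) auto
  moreover have "(7 / 10 * g) ^ 3 \<le> 4 * g * (3 / 10 * g)\<^sup>2"
    using g by (simp add: power2_eq_square power3_eq_cube)
  ultimately have "y ^ 3 \<le> 4 * g * (g - y)\<^sup>2" by linarith
  then have "y * y ^ 3 \<le> y * (4 * g * (g - y)\<^sup>2)" using y0 by (rule mult_left_mono)
  then have "(g - y) ^ 4 \<le> g ^ 4 - 2 * g\<^sup>2 * y\<^sup>2"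
    by (simp add: power2_eq_square power3_eq_cube power4_eq_xxxx algebra_simps)
  with N have "(g - y) ^ 4 \<le> Lp_norm M q linear_form ^ 4" by linarith
  then have "g - y \<le> Lp_norm M q linear_form"
    by (rule power_le_cancel) (simp_all add: Lp_norm_nonneg)
  then show ?thesis by (simp add: g_def y_def)
qed

text \<open>If \<open>sqrt 3 * p * beta\<close> exceeds \<open>7 / 10\<close> of the Gaussian norm, the claimed bound is smaller than \<open>3 / 10\<close> of it. For
\<open>p \<le> 24\<close> this is at most one. For larger \<open>p\<close> the bound of order \<open>p / 3\<close> is already the stronger one: the
subtracted term decreases by two thirds, which is at least \<open>7 / 15\<close> of the Gaussian norm, and the Gaussian norm
decreases by at most that much.\<close>

lemma bound_large_p:
  assumes p: "p \<ge> 4"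
  shows "gaussian_norm p - sqrt 3 * p * beta \<le> Lp_norm M p linear_form"
proof (cases "sqrt 3 * p * beta \<le> 7 / 10 * gaussian_norm p")
  case True
  then show ?thesis by (rule moderate_deviation_case[OF p])
next
  case False
  show ?thesis
  proof (cases "p \<le> 24")
    case True
    then have "gaussian_norm p \<le> 10 / 3"
      using gaussian_norm_mono[of p 24] gaussian_norm_24_le p by simp
    then show ?thesis using False Lp_norm_linear_form_ge_1[of p] p by simp
  next
    case p24: False
    show ?thesis
    proof (cases "gaussian_norm p \<le> sqrt 3 * p * beta")
      case True
      then show ?thesis using Lp_norm_nonneg[of M p linear_form] by linarith
    next
      case lt: False
      have third: "8 / 15 * gaussian_norm p \<le> gaussian_norm (p / 3)"
        by (rule gaussian_norm_third) (use p24 in simp)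
      have y: "sqrt 3 * (p / 3) * beta = (sqrt 3 * p * beta) / 3" by simp
      have "gaussian_norm p - sqrt 3 * p * beta \<le> gaussian_norm (p / 3) - sqrt 3 * (p / 3) * beta"
        unfolding y using False third by linarith
      also have "\<dots> \<le> Lp_norm M (p / 3) linear_form"
      proof (rule moderate_deviation_case)
        show "sqrt 3 * (p / 3) * beta \<le> 7 / 10 * gaussian_norm (p / 3)"
          unfolding y using lt third gaussian_norm_sq_bounds(3)[of p] p by linarith
      qed (use p24 in simp)
      also have "\<dots> \<le> Lp_norm M p linear_form"
        by (rule Lp_norm_mono[OF M linear_form_measurable]) (use p linear_form_integrable in auto)
      finally show ?thesis .
    qed
  qed
qed

text \<open>Let \<open>m\<close> be the claimed bound and \<open>g\<close> the Gaussian norm. Since the norm is at least one, only \<open>m > 1\<close>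
is of interest, which forces \<open>beta \<le> 1 / 4\<close>. Then the \<open>p\<close>-th moment is at least \<open>g powr p - sqrt 3 * p\<^sup>2 * beta\<close>, and
this is at least \<open>m powr p\<close> because the derivative of \<open>x powr p\<close> is at least \<open>p\<close> between \<open>m\<close> and \<open>g\<close>.\<close>

lemma bound_small_p:
  assumes p: "2 \<le> p" "p < 4"
  shows "gaussian_norm p - sqrt 3 * p * beta \<le> Lp_norm M p linear_form"
proof (cases "gaussian_norm p - sqrt 3 * p * beta \<le> 1")
  case True
  then show ?thesis using Lp_norm_linear_form_ge_1[OF p(1)] by linarith
next
  case False
  define g where "g = gaussian_norm p"
  define m where "m = g - sqrt 3 * p * beta"
  have m: "m > 1" using False by (simp add: m_def g_def)
  have sqrt3: "17 / 10 \<le> sqrt 3" by (rule real_le_rsqrt) (simp add: power2_eq_square)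
  have g0: "g > 0" unfolding g_def by (rule gaussian_norm_sq_bounds(3)) (use p in simp)
  have g4: "g \<le> 4 / 3"
  proof -
    have "gaussian_norm 4 ^ 4 \<le> (4 / 3) ^ 4" unfolding gaussian_norm_4 by (simp add: power_divide)
    then have "gaussian_norm 4 \<le> 4 / 3"
      by (rule power_le_cancel) simp_all
    then show ?thesis using gaussian_norm_mono[of p 4] p by (simp add: g_def)
  qed
  have p2: "p > 2"
  proof (rule ccontr)
    assume "\<not> p > 2"
    then have "p = 2" using p by simp
    moreover have "gaussian_norm 2 = 1"
      using gaussian_square_integral(2) abs_powr_even[of 2] by (simp add: gaussian_norm_def Lp_norm_def)
    moreover have "sqrt 3 * 2 * beta > 0" using beta_pos by simp
    ultimately show False using False by simp
  qed
  have \<beta>: "beta \<le> 1 / 4"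
  proof -
    have "17 / 10 * 2 * beta \<le> sqrt 3 * p * beta"
      using beta_pos sqrt3 p by (intro mult_right_mono mult_mono) auto
    then show ?thesis using m g4 by (simp add: m_def)
  qed
  have intp: "integrable M (\<lambda>\<omega>. \<bar>linear_form \<omega>\<bar> powr p)" using p by (intro linear_form_integrable) simp
  have "g powr p \<le> Lp_norm M p linear_form powr p
    + beta powr (p / 2) * (270 / 13 * 2 powr (p - 4) + 2 * (p - 2) * 2 powr (p - 2))"
    using moment_ge_gaussian_of_cos[OF M linear_form_measurable linear_form_square p2 p(2) beta_pos linear_form_cos intp
        integrable_gaussian_abs_moment] p
    by (simp add: g_def gaussian_norm_powr Lp_norm_powr)
  also have "beta powr (p / 2) * (270 / 13 * 2 powr (p - 4) + 2 * (p - 2) * 2 powr (p - 2))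
    \<le> beta * (sqrt 3 * p\<^sup>2)"
  proof -
    have "beta powr (p / 2) = beta * beta powr ((p - 2) / 2)"
    proof -
      have "beta powr (p / 2) = beta powr (1 + (p - 2) / 2)" by (simp add: field_simps)
      also have "\<dots> = beta powr 1 * beta powr ((p - 2) / 2)" by (rule powr_add)
      finally show ?thesis using beta_pos by simp
    qed
    also have "\<dots> \<le> beta * (1 / 4) powr ((p - 2) / 2)"
      using beta_pos \<beta> p by (intro mult_left_mono powr_mono2) auto
    also have "(1 / 4) powr ((p - 2) / 2) = 1 / 2 powr (p - 2)"
    proof -
      have "(4 :: real) powr ((p - 2) / 2) = (2 powr 2) powr ((p - 2) / 2)" by simp
      also have "\<dots> = 2 powr (2 * ((p - 2) / 2))" by (rule powr_powr)
      finally show ?thesis by (simp add: powr_divide)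
    qed
    finally have "beta powr (p / 2) * (270 / 13 * 2 powr (p - 4) + 2 * (p - 2) * 2 powr (p - 2))
      \<le> beta * (1 / 2 powr (p - 2)) * (270 / 13 * 2 powr (p - 4) + 2 * (p - 2) * 2 powr (p - 2))"
      using p by (intro mult_right_mono) auto
    also have "\<dots> = beta * (270 / 52 + 2 * (p - 2))"
    proof -
      have "2 powr (p - 4) = 2 powr (p - 2) / (4 :: real)"
        using powr_diff[of 2 "p - 2" 2] by simp
      then show ?thesis by (simp add: field_simps)
    qed
    also have "\<dots> \<le> beta * (sqrt 3 * p\<^sup>2)"
    proof (rule mult_left_mono)
      have "270 / 52 + 2 * (p - 2) \<le> 17 / 10 * (2 * p)" using p by simp
      also have "\<dots> \<le> 17 / 10 * p\<^sup>2" using p by (simp add: power2_eq_square)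
      also have "\<dots> \<le> sqrt 3 * p\<^sup>2" using sqrt3 by (intro mult_right_mono) auto
      finally show "270 / 52 + 2 * (p - 2) \<le> sqrt 3 * p\<^sup>2" .
    qed (use beta_pos in simp)
    finally show ?thesis .
  qed
  finally have "g powr p \<le> Lp_norm M p linear_form powr p + beta * (sqrt 3 * p\<^sup>2)" by simp
  moreover have "m powr p + p * 1 * (g - m) \<le> g powr p"
  proof -
    have "p * 1 * (g - m) \<le> p * m powr (p - 1) * (g - m)"
      using m p beta_pos by (intro mult_right_mono mult_left_mono ge_one_powr_ge_zero) (auto simp: m_def)
    moreover have "m powr p + p * m powr (p - 1) * (g - m) \<le> g powr p"
      by (rule powr_above_tangent) (use g0 m p in auto)
    ultimately show ?thesis by linarith
  qed
  moreover have "p * 1 * (g - m) = beta * (sqrt 3 * p\<^sup>2)" by (simp add: m_def power2_eq_square)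
  ultimately have "m powr p \<le> Lp_norm M p linear_form powr p" by linarith
  then have "m \<le> Lp_norm M p linear_form"
    using powr_mono2[of "1 / p" "m powr p" "Lp_norm M p linear_form powr p"] p m Lp_norm_nonneg[of M p linear_form]
    by (simp add: powr_powr)
  then show ?thesis by (simp add: m_def g_def)
qed

end

theorem corollary5:
  fixes M :: "'a measure" and X :: "'a \<Rightarrow> real ^ 'n" and a :: "real ^ 'n" and p :: real
  assumes "prob_space M"
    and "X \<in> borel_measurable M"
    and "isotropic M X"
    and "unconditional M X"
    and "log_concave M X"
    and "a \<noteq> 0"
    and "p \<ge> 2"
  shows "Lp_norm M p (\<lambda>\<omega>. \<Sum>i\<in>UNIV. a $ i * X \<omega> $ i)
           \<ge> gaussian_norm p * norm a - p / norm a * sqrt (3 * (\<Sum>i\<in>UNIV. (a $ i) ^ 4))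
         \<and> gaussian_norm p * norm a - p / norm a * sqrt (3 * (\<Sum>i\<in>UNIV. (a $ i) ^ 4))
           \<ge> gaussian_norm p * norm a - sqrt 3 * p * infnorm a"
proof
  have r: "norm a > 0" using assms(6) by simp
  define a' where "a' = (1 / norm a) *\<^sub>R a"
  have a: "a = norm a *\<^sub>R a'" using r by (simp add: a'_def)
  have "norm a' = 1" using r by (simp add: a'_def)
  then interpret unconditional_linear_form M X a'
    using assms by (intro unconditional_linear_form.intro unconditional_linear_form_axioms.intro)
  have ai: "a $ i = norm a * a' $ i" for i using a by (metis vector_scaleR_component real_scaleR_def)
  have form: "(\<lambda>\<omega>. \<Sum>i\<in>UNIV. a $ i * X \<omega> $ i) = (\<lambda>\<omega>. norm a * linear_form \<omega>)"
    unfolding linear_form_def sum_distrib_left by (subst ai) (simp add: mult.assoc)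
  have fourth: "sqrt (3 * (\<Sum>i\<in>UNIV. a $ i ^ 4)) = sqrt 3 * ((norm a)\<^sup>2 * beta)"
  proof -
    have "(\<Sum>i\<in>UNIV. a $ i ^ 4) = norm a ^ 4 * beta\<^sup>2"
      unfolding beta_sq sum_distrib_left by (subst ai) (simp add: power_mult_distrib)
    also have "\<dots> = ((norm a)\<^sup>2 * beta)\<^sup>2" by (simp add: power_mult_distrib flip: power_mult)
    finally show ?thesis using beta_pos by (simp add: real_sqrt_mult)
  qed
  have "gaussian_norm p - sqrt 3 * p * beta \<le> Lp_norm M p linear_form"
    using bound_large_p bound_small_p assms(7) by (cases "p \<ge> 4") auto
  then have "norm a * (gaussian_norm p - sqrt 3 * p * beta) \<le> norm a * Lp_norm M p linear_form"
    by (intro mult_left_mono) auto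
  moreover have "p / norm a * sqrt (3 * (\<Sum>i\<in>UNIV. a $ i ^ 4)) = norm a * (sqrt 3 * p * beta)"
    unfolding fourth using r by (simp add: power2_eq_square)
  ultimately show "Lp_norm M p (\<lambda>\<omega>. \<Sum>i\<in>UNIV. a $ i * X \<omega> $ i)
      \<ge> gaussian_norm p * norm a - p / norm a * sqrt (3 * (\<Sum>i\<in>UNIV. (a $ i) ^ 4))"
    unfolding form using assms(7) by (subst Lp_norm_scale) (simp_all add: algebra_simps)
  have "(\<Sum>i\<in>UNIV. a $ i ^ 4) \<le> (\<Sum>i\<in>UNIV. (infnorm a)\<^sup>2 * (a $ i)\<^sup>2)"
  proof (rule sum_mono)
    fix i
    have "(a $ i)\<^sup>2 \<le> (infnorm a)\<^sup>2"
      using power_mono[OF component_le_infnorm_cart[of a i] abs_ge_zero, of 2] by simp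
    then have "(a $ i)\<^sup>2 * (a $ i)\<^sup>2 \<le> (infnorm a)\<^sup>2 * (a $ i)\<^sup>2" by (intro mult_right_mono) auto
    then show "a $ i ^ 4 \<le> (infnorm a)\<^sup>2 * (a $ i)\<^sup>2" by (simp flip: power_add)
  qed
  also have "\<dots> = (infnorm a * norm a)\<^sup>2"
    by (simp add: power_mult_distrib norm_vec_def L2_set_def sum_nonneg flip: sum_distrib_left)
  finally have "sqrt (\<Sum>i\<in>UNIV. a $ i ^ 4) \<le> infnorm a * norm a"
    using r by (intro real_le_lsqrt) (auto intro!: mult_nonneg_nonneg sum_nonneg simp: infnorm_pos_le)
  then have "p / norm a * (sqrt 3 * sqrt (\<Sum>i\<in>UNIV. a $ i ^ 4)) \<le> p / norm a * (sqrt 3 * (infnorm a * norm a))"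
    using r assms(7) by (intro mult_left_mono) auto
  also have "\<dots> = sqrt 3 * p * infnorm a" using r by simp
  finally show "gaussian_norm p * norm a - sqrt 3 * p * infnorm a
      \<le> gaussian_norm p * norm a - p / norm a * sqrt (3 * (\<Sum>i\<in>UNIV. (a $ i) ^ 4))"
    by (simp add: real_sqrt_mult)
qed

end
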